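(* Let $V\in H^2(0,\pi)$ be complex-valued with $\|V\|_{\infty}<\frac32$, and let $f\in L^2(0,\pi)$. Let $u(x,t)$ be the solution of \begin{align*} & \partial_t u(x,t)=-i(-\partial_x^2+V(x))u(x,t), && x\in(0,\pi),\ t>0,\\ & u(0,t)=u(\pi,t)=0, && t>0,\\ & u(x,0)=f(x), && x\in(0,\pi). \end{align*} Then there is a function $w(x,t)$ with $w(\cdot,t)\in C(0,\pi)$ for every fixed $t>0$ such that, for all co-prime $p,q\in\mathbb{N}$, the solution at time $t=2\pi\frac{p}{q}$ is given by \[ u\Big(x,2\pi\frac{p}{q}\Big)=w\Big(x,2\pi\frac{p}{q}\Big)+\frac{1}{q}\, e^{-2\pi i\langle V\rangle \frac{p}{q}} \sum_{k=0}^{q-1}\sum_{m=0}^{q-1} e^{ 2\pi i \left( m\frac{k}{q}-m^2 \frac{p}{q} \right)} f^{\mathrm{o}}\Big(x-2\pi\frac{k}{q}\Big) \] (as an identity in $L^2(0,\pi)$, i.e. for almost every $x\in(0,\pi)$).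
   Context: $\mathbb{N}=\{1,2,3,\dots\}$. $\|V\|_\infty=\max_{x\in[0,\pi]}|V(x)|$. $\langle V\rangle=\frac1\pi\int_0^\pi V(x)\,\mathrm{d}x$ is the mean of $V$. $f^{\mathrm{o}}$ denotes the odd, $2\pi$-periodic extension of $f$ to $\mathbb{R}$. $C(0,\pi)$ is the space of continuous functions on $(0,\pi)$. The solution $u$ is the unique solution in $L^2(0,\pi)$ given by the $C_0$ one-parameter semigroup: $u(\cdot,t)=e^{-iLt}f$, where $L=-\partial_x^2+V$ with domain $H^2(0,\pi)\cap H^1_0(0,\pi)\subset L^2(0,\pi)$. *)

theory Defs
  imports "HOL-Analysis.Analysis"
begin

text \<open>
  Elements of $L^2(0,\pi)$ are represented by complex-valued functions on the real line, of which
  only the restriction to the interval matters; equality in $L^2(0,\pi)$ is equality almost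
  everywhere with respect to \<open>int_measure\<close>.
\<close>

abbreviation int_measure :: "real measure"
  where "int_measure \<equiv> lebesgue_on {0<..<pi}"

definition L2 :: "(real \<Rightarrow> complex) set"
  where "L2 = {f. f \<in> borel_measurable int_measure \<and>
                  integrable int_measure (\<lambda>x. (norm (f x))\<^sup>2)}"

definition l2norm :: "(real \<Rightarrow> complex) \<Rightarrow> real"
  where "l2norm f = sqrt (LINT x|int_measure. (norm (f x))\<^sup>2)"

definition vderiv :: "(real \<Rightarrow> complex) \<Rightarrow> real \<Rightarrow> complex"
  where "vderiv \<phi> = (\<lambda>x. vector_derivative \<phi> (at x))"

text \<open>$C_c^\infty(0,\pi)$, each function being extended by zero to the real line.\<close>

definition test_functions :: "(real \<Rightarrow> complex) set"
  where "test_functions =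
    {\<phi>. (\<forall>k x. (vderiv ^^ k) \<phi> differentiable (at x)) \<and>
         (\<exists>K. compact K \<and> K \<subseteq> {0<..<pi} \<and> (\<forall>x. x \<notin> K \<longrightarrow> \<phi> x = 0))}"

definition weak_derivative :: "(real \<Rightarrow> complex) \<Rightarrow> (real \<Rightarrow> complex) \<Rightarrow> bool"
  where "weak_derivative f g \<longleftrightarrow>
    (\<forall>\<phi>\<in>test_functions.
      (LINT x|int_measure. f x * vderiv \<phi> x) = - (LINT x|int_measure. g x * \<phi> x))"

definition H2 :: "(real \<Rightarrow> complex) set"
  where "H2 = {f \<in> L2. \<exists>g\<in>L2. \<exists>h\<in>L2. weak_derivative f g \<and> weak_derivative g h}"

text \<open>$H^1_0(0,\pi)$ is the closure of $C_c^\infty(0,\pi)$ in $H^1(0,\pi)$.\<close>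

definition H10 :: "(real \<Rightarrow> complex) set"
  where "H10 = {f \<in> L2. \<exists>g\<in>L2. weak_derivative f g \<and>
    (\<exists>\<phi>. (\<forall>n. \<phi> n \<in> test_functions) \<and>
         (\<lambda>n::nat. l2norm (\<lambda>x. \<phi> n x - f x)) \<longlonglongrightarrow> 0 \<and>
         (\<lambda>n. l2norm (\<lambda>x. vderiv (\<phi> n) x - g x)) \<longlonglongrightarrow> 0)}"

text \<open>
  Linearity and boundedness together imply that each \<open>T t\<close> respects equality almost everywhere.
\<close>

definition C0_semigroup :: "(real \<Rightarrow> (real \<Rightarrow> complex) \<Rightarrow> (real \<Rightarrow> complex)) \<Rightarrow> bool"
  where "C0_semigroup T \<longleftrightarrow>
    (\<forall>t\<ge>0. \<forall>f\<in>L2. T t f \<in> L2) \<and>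
    (\<forall>t\<ge>0. \<forall>f\<in>L2. \<forall>g\<in>L2. \<forall>a b::complex.
        AE x in int_measure. T t (\<lambda>y. a * f y + b * g y) x = a * T t f x + b * T t g x) \<and>
    (\<forall>t\<ge>0. \<exists>C. \<forall>f\<in>L2. l2norm (T t f) \<le> C * l2norm f) \<and>
    (\<forall>f\<in>L2. AE x in int_measure. T 0 f x = f x) \<and>
    (\<forall>s\<ge>0. \<forall>t\<ge>0. \<forall>f\<in>L2. AE x in int_measure. T (s + t) f x = T s (T t f) x) \<and>
    (\<forall>f\<in>L2. ((\<lambda>t. l2norm (\<lambda>x. T t f x - f x)) \<longlongrightarrow> 0) (at_right 0))"

text \<open>Unbounded operators are given by their graphs, closed under equality almost everywhere.\<close>

definition generator ::
    "(real \<Rightarrow> (real \<Rightarrow> complex) \<Rightarrow> (real \<Rightarrow> complex)) \<Rightarrow> ((real \<Rightarrow> complex) \<times> (real \<Rightarrow> complex)) set"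
  where "generator T = {(f, g). f \<in> L2 \<and> g \<in> L2 \<and>
    ((\<lambda>h. l2norm (\<lambda>x. (T h f x - f x) / of_real h - g x)) \<longlongrightarrow> 0) (at_right 0)}"

definition schrodinger_op ::
    "(real \<Rightarrow> complex) \<Rightarrow> ((real \<Rightarrow> complex) \<times> (real \<Rightarrow> complex)) set"
  where "schrodinger_op V = {(f, g). f \<in> H2 \<inter> H10 \<and> g \<in> L2 \<and>
    (\<exists>f1\<in>L2. \<exists>f2\<in>L2. weak_derivative f f1 \<and> weak_derivative f1 f2 \<and>
       (AE x in int_measure. g x = - f2 x + V x * f x))}"

text \<open>
  \<open>schrodinger_solution V f u\<close> states that $u(\cdot,t) = e^{-iLt} f$ in $L^2(0,\pi)$ for
  $t \ge 0$, where $e^{-iLt}$ is the semigroup generated by $-iL$.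
\<close>

definition schrodinger_solution ::
    "(real \<Rightarrow> complex) \<Rightarrow> (real \<Rightarrow> complex) \<Rightarrow> (real \<Rightarrow> real \<Rightarrow> complex) \<Rightarrow> bool"
  where "schrodinger_solution V f u \<longleftrightarrow>
    (\<exists>T. C0_semigroup T \<and>
         generator T = (\<lambda>(g, h). (g, \<lambda>x. - \<i> * h x)) ` schrodinger_op V \<and>
         (\<forall>t\<ge>0. AE x in int_measure. u x t = T t f x))"

definition supnorm :: "(real \<Rightarrow> complex) \<Rightarrow> real"
  where "supnorm V = (SUP x\<in>{0..pi}. norm (V x))"

definition mean :: "(real \<Rightarrow> complex) \<Rightarrow> complex"
  where "mean V = (LINT x|int_measure. V x) / of_real pi"

text \<open>
  Here \<open>z\<close> is the representative of \<open>x\<close> modulo $2\pi$ in $[0,2\pi)$. The value at multiples of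
  $\pi$ is zero, as forced by oddness and periodicity.
\<close>

definition odd_ext :: "(real \<Rightarrow> complex) \<Rightarrow> real \<Rightarrow> complex"
  where "odd_ext f x =
    (let z = 2 * pi * frac (x / (2 * pi))
     in if 0 < z \<and> z < pi then f z
        else if pi < z then - f (2 * pi - z)
        else 0)"

lemma odd_ext_eq:
  assumes "0 < x" "x < pi"
  shows "odd_ext f x = f x"
proof -
  have "frac (x / (2 * pi)) = x / (2 * pi)"
    using assms by (simp add: frac_eq)
  then show ?thesis
    using assms by (simp add: odd_ext_def)
qed

lemma odd_ext_periodic: "odd_ext f (x + 2 * pi) = odd_ext f x"
proof -
  have "(x + 2 * pi) / (2 * pi) = x / (2 * pi) + 1"
    by (simp add: field_simps)
  then have "frac ((x + 2 * pi) / (2 * pi)) = frac (x / (2 * pi))"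
    by (simp only: frac_1_eq)
  then show ?thesis
    by (simp only: odd_ext_def)
qed

lemma odd_ext_minus: "odd_ext f (- x) = - odd_ext f x"
proof (cases "x / (2 * pi) \<in> \<int>")
  case True
  then show ?thesis
    by (simp add: odd_ext_def frac_neg frac_eq_0_iff[THEN iffD2])
next
  case False
  define r where "r = frac (x / (2 * pi))"
  have r: "0 < r" "r < 1"
    using False by (auto simp: r_def frac_gt_0_iff frac_lt_1)
  have "2 * pi * r > 0" "2 * pi * r < 2 * pi"
    using r by simp_all
  moreover have "frac (- x / (2 * pi)) = 1 - r"
    using False by (simp add: frac_neg r_def)
  moreover have "2 * pi * (1 - r) = 2 * pi - 2 * pi * r"
    by (simp add: algebra_simps)
  ultimately show ?thesis
    by (simp add: odd_ext_def Let_def flip: r_def)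
qed

end

theory Submission
  imports Defs
begin

text \<open>
  Let $e_n(x) = \sqrt{2/\pi} \sin(nx)$, let $a = \langle V\rangle$ and let
  $c_n(t) = e^{i(n^2+a)t} \int u(\cdot,t)\, e_n$ be the sine coefficients of the solution in the
  frame that rotates with the free flow and with the mean of the potential. They satisfy
  $c_n'(t) = -i \sum_m W_{nm} e^{i(n^2-m^2)t} c_m(t)$, where $W$ is the matrix of $V - a$ in the
  sine basis. The claim is that $\sum_n |c_n(t) - c_n(0)| < \infty$. Then
  $u(\cdot,t) - e^{-iat} e^{it\partial_x^2} f$ has an absolutely convergent sine series and is
  therefore a continuous function, which serves as $w(\cdot,t)$.

  To see the summability, integrate the equation in time. In a term with $m \neq n$ the phase
  oscillates, and an integration by parts gains the factor $1/(n^2-m^2)$. The sum of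
  $1/|n^2-m^2|$ over all $n \neq m$ is $O(m^{-3/4})$, which is square summable in $m$, as are the
  coefficients $c_m$; as the entries of $W$ are bounded, the Cauchy-Schwarz inequality bounds the
  sum over all $n$ and $m$. In the terms with $m = n$ there is no oscillation, but there $W_{nn}$
  is a multiple of the cosine coefficient of $V$ of frequency $2n$: subtracting the mean has
  removed the constant part of the diagonal. By Bessel's inequality $(W_{nn})$ is square summable,
  and the Cauchy-Schwarz inequality applies again. This is
  \<open>summable_off_resonance\<close>, which \<open>smoothing_summable\<close> applies to the flow.

  The differential equation for the coefficients is \<open>interaction_picture\<close>. The hypotheses
  provide a strongly continuous semigroup whose generator is known through its graph only, so
  three facts have to come first: orbits are bounded on compact time intervals, by the uniform
  boundedness principle (\<open>C0_semigroup_bounded_near_0\<close>); on the domain of the operator, integration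
  by parts against $e_n$ leaves no boundary terms (\<open>coef_schrodinger_op\<close>); and each $e_m$ belongs to
  the domain (\<open>sine_schrodinger_op\<close>). The equation is then differentiated for the initial data
  $e_m$, and it extends to all of $L^2$ because finite sine sums are dense.

  At $t = 2\pi p/q$ the free flow multiplies the $n$-th coefficient by $e^{-2\pi i n^2 p/q}$. This
  depends only on $n$ modulo $q$, so the discrete Fourier transform on the integers modulo $q$
  writes it as a combination of the multipliers of the translations by $2\pi k/q$, with Gauss sums
  as weights. This gives the double sum in the theorem (\<open>coef_talbot\<close>).
\<close>

section \<open>The space L2(0, pi)\<close>

text \<open>
  Bilinear, without complex conjugation, as in the definition of weak derivatives. Sine and cosine
  coefficients are values of this pairing because those functions are real-valued.
\<close>
definition pair :: "(real \<Rightarrow> complex) \<Rightarrow> (real \<Rightarrow> complex) \<Rightarrow> complex"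
  where "pair f g = (LINT x|int_measure. f x * g x)"

lemma L2_D: assumes "f \<in> L2"
  shows "f \<in> borel_measurable int_measure" "integrable int_measure (\<lambda>x. (norm (f x))\<^sup>2)"
  using assms by (auto simp: L2_def)

lemma L2_add: assumes "f \<in> L2" "g \<in> L2" shows "(\<lambda>x. f x + g x) \<in> L2"
proof -
  note [measurable] = L2_D(1)[OF assms(1)] L2_D(1)[OF assms(2)]
  have "integrable int_measure (\<lambda>x. 2 * (norm (f x))\<^sup>2 + 2 * (norm (g x))\<^sup>2)"
    using L2_D(2)[OF assms(1)] L2_D(2)[OF assms(2)] by simp
  then have "integrable int_measure (\<lambda>x. (norm (f x + g x))\<^sup>2)"
  proof (rule Bochner_Integration.integrable_bound)
    show "AE x in int_measure. norm ((norm (f x + g x))\<^sup>2)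
        \<le> norm (2 * (norm (f x))\<^sup>2 + 2 * (norm (g x))\<^sup>2)"
    proof (rule AE_I2)
      fix x
      have "(norm (f x + g x))\<^sup>2 \<le> (norm (f x) + norm (g x))\<^sup>2"
        by (intro power_mono norm_triangle_ineq) simp
      also have "\<dots> \<le> 2 * (norm (f x))\<^sup>2 + 2 * (norm (g x))\<^sup>2"
        using sum_squares_bound[of "norm (f x)" "norm (g x)"] by (simp add: power2_sum)
      finally show "norm ((norm (f x + g x))\<^sup>2) \<le> norm (2 * (norm (f x))\<^sup>2 + 2 * (norm (g x))\<^sup>2)"
        by simp
    qed
  qed measurable
  then show ?thesis by (auto simp: L2_def)
qed

lemma L2_scale: assumes "f \<in> L2" shows "(\<lambda>x. c * f x) \<in> L2"
  using L2_D[OF assms] by (auto simp: L2_def norm_mult power_mult_distrib)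

lemma L2_diff: assumes "f \<in> L2" "g \<in> L2" shows "(\<lambda>x. f x - g x) \<in> L2"
  using L2_add[OF assms(1) L2_scale[OF assms(2), of "-1"]] by simp

lemma L2_zero: "(\<lambda>x. 0) \<in> L2"
  by (auto simp: L2_def)

lemma L2_sum: "(\<And>i. i \<in> I \<Longrightarrow> f i \<in> L2) \<Longrightarrow> (\<lambda>x. \<Sum>i\<in>I. f i x) \<in> L2"
  by (induction I rule: infinite_finite_induct) (auto simp: L2_zero intro: L2_add)

lemma L2_mult_bounded:
  assumes "f \<in> L2" "h \<in> borel_measurable int_measure" "\<And>x. x \<in> {0<..<pi} \<Longrightarrow> norm (h x) \<le> B"
  shows "(\<lambda>x. h x * f x) \<in> L2"
proof -
  note [measurable] = L2_D(1)[OF assms(1)] assms(2)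
  have "integrable int_measure (\<lambda>x. B\<^sup>2 * (norm (f x))\<^sup>2)"
    using L2_D(2)[OF assms(1)] by simp
  then have "integrable int_measure (\<lambda>x. (norm (h x * f x))\<^sup>2)"
  proof (rule Bochner_Integration.integrable_bound)
    show "AE x in int_measure. norm ((norm (h x * f x))\<^sup>2) \<le> norm (B\<^sup>2 * (norm (f x))\<^sup>2)"
      using assms(3)
      by (intro AE_I2) (auto simp: norm_mult power_mult_distrib intro!: mult_right_mono power_mono)
  qed measurable
  then show ?thesis by (auto simp: L2_def)
qed

lemma integrable_pair: assumes "f \<in> L2" "g \<in> L2" shows "integrable int_measure (\<lambda>x. f x * g x)"
proof -
  note [measurable] = L2_D(1)[OF assms(1)] L2_D(1)[OF assms(2)]
  have "integrable int_measure (\<lambda>x. (norm (f x))\<^sup>2 + (norm (g x))\<^sup>2)"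
    using L2_D(2)[OF assms(1)] L2_D(2)[OF assms(2)] by simp
  then show ?thesis
  proof (rule Bochner_Integration.integrable_bound)
    show "AE x in int_measure. norm (f x * g x) \<le> norm ((norm (f x))\<^sup>2 + (norm (g x))\<^sup>2)"
    proof (rule AE_I2)
      fix x
      have "0 \<le> norm (f x) * norm (g x)" by simp
      moreover have "2 * (norm (f x) * norm (g x)) \<le> (norm (f x))\<^sup>2 + (norm (g x))\<^sup>2"
        using sum_squares_bound[of "norm (f x)" "norm (g x)"] by (simp add: mult.assoc)
      ultimately have "norm (f x) * norm (g x) \<le> (norm (f x))\<^sup>2 + (norm (g x))\<^sup>2" by linarith
      then show "norm (f x * g x) \<le> norm ((norm (f x))\<^sup>2 + (norm (g x))\<^sup>2)"
        by (simp add: norm_mult)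
    qed
  qed measurable
qed

lemma l2norm_nonneg [simp]: "0 \<le> l2norm f"
  by (simp add: l2norm_def)

lemma l2norm_power2: "(l2norm f)\<^sup>2 = (LINT x|int_measure. (norm (f x))\<^sup>2)"
  by (simp add: l2norm_def)

lemma l2norm_of_norm [simp]: "l2norm (\<lambda>x. complex_of_real (norm (f x))) = l2norm f"
  by (simp add: l2norm_def)

lemma l2norm_zero [simp]: "l2norm (\<lambda>x. 0) = 0"
  by (simp add: l2norm_def)

lemma l2norm_scale: "l2norm (\<lambda>x. c * f x) = norm c * l2norm f"
  by (simp add: l2norm_def norm_mult power_mult_distrib real_sqrt_mult)

lemma l2norm_minus_commute: "l2norm (\<lambda>x. f x - g x) = l2norm (\<lambda>x. g x - f x)"
  by (simp add: l2norm_def norm_minus_commute)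

lemma L2_norm: "f \<in> L2 \<Longrightarrow> (\<lambda>x. complex_of_real (norm (f x))) \<in> L2"
  by (auto simp: L2_def)

lemma l2norm_cong_AE:
  assumes "f \<in> L2" "g \<in> L2" "AE x in int_measure. f x = g x"
  shows "l2norm f = l2norm g"
proof -
  note [measurable] = L2_D(1)[OF assms(1)] L2_D(1)[OF assms(2)]
  show ?thesis unfolding l2norm_def
    by (intro arg_cong[where f=sqrt] integral_cong_AE) (use assms(3) in auto)
qed

lemma L2_cong_AE:
  assumes "f \<in> L2" "g \<in> borel_measurable int_measure" "AE x in int_measure. f x = g x"
  shows "g \<in> L2"
proof -
  note [measurable] = L2_D(1)[OF assms(1)] assms(2)
  have "integrable int_measure (\<lambda>x. (norm (f x))\<^sup>2) = integrable int_measure (\<lambda>x. (norm (g x))\<^sup>2)"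
    by (intro integrable_cong_AE) (use assms(3) in auto)
  then show ?thesis using L2_D(2)[OF assms(1)] by (simp add: L2_def assms(2))
qed

lemma pair_cong_AE:
  assumes "f \<in> L2" "g \<in> L2" "h \<in> L2" "AE x in int_measure. f x = g x"
  shows "pair f h = pair g h"
proof -
  note [measurable] = L2_D(1)[OF assms(1)] L2_D(1)[OF assms(2)] L2_D(1)[OF assms(3)]
  show ?thesis unfolding pair_def
    by (intro integral_cong_AE) (use assms(4) in auto)
qed

lemma l2norm_eq_0_iff: assumes "f \<in> L2" 
  shows "l2norm f = 0 \<longleftrightarrow> (AE x in int_measure. f x = 0)"
proof -
  have "l2norm f = 0 \<longleftrightarrow> (LINT x|int_measure. (norm (f x))\<^sup>2) = 0"
    by (simp add: l2norm_def)
  also have "\<dots> \<longleftrightarrow> (AE x in int_measure. (norm (f x))\<^sup>2 = 0)"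
    using L2_D(2)[OF assms] by (intro integral_nonneg_eq_0_iff_AE) auto
  finally show ?thesis by simp
qed

lemma Cauchy_Schwarz_norms:
  assumes "f \<in> L2" "g \<in> L2"
  shows "(LINT x|int_measure. norm (f x) * norm (g x)) \<le> l2norm f * l2norm g"
proof -
  let ?A = "(l2norm f)\<^sup>2" and ?B = "(l2norm g)\<^sup>2"
  let ?I = "LINT x|int_measure. norm (f x) * norm (g x)"
  have int: "integrable int_measure (\<lambda>x. norm (f x) * norm (g x))"
    using integrable_norm[OF integrable_pair[OF assms]] by (simp add: norm_mult)
  have q: "0 \<le> s\<^sup>2 * ?A - 2 * s * ?I + ?B" for s
  proof -
    have "0 \<le> (LINT x|int_measure. (s * norm (f x) - norm (g x))\<^sup>2)"
      by (intro Bochner_Integration.integral_nonneg) auto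
    also have "(\<lambda>x. (s * norm (f x) - norm (g x))\<^sup>2) =
        (\<lambda>x. s\<^sup>2 * (norm (f x))\<^sup>2 - 2 * s * (norm (f x) * norm (g x)) + (norm (g x))\<^sup>2)"
      by (auto simp: power2_eq_square algebra_simps)
    also have "(LINT x|int_measure. \<dots> x) = s\<^sup>2 * ?A - 2 * s * ?I + ?B"
      using int L2_D(2)[OF assms(1)] L2_D(2)[OF assms(2)] by (simp add: l2norm_power2)
    finally show ?thesis .
  qed
  \<comment> \<open>The quadratic polynomial in \<open>s\<close> has no sign change, so its discriminant is not positive.\<close>
  have "?I\<^sup>2 \<le> ?A * ?B"
  proof (cases "?A = 0")
    case True
    have "?I = 0"
    proof (rule ccontr)
      assume "?I \<noteq> 0"
      then have "2 * ((?B + 1) / (2 * ?I)) * ?I = ?B + 1" by (simp add: field_simps)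
      moreover have "0 \<le> 0 - 2 * ((?B + 1) / (2 * ?I)) * ?I + ?B"
        using q[of "(?B + 1) / (2 * ?I)"] unfolding True by simp
      ultimately show False by linarith
    qed
    then show ?thesis by simp
  next
    case False
    then have "?A > 0" by simp
    have "0 \<le> (?I / ?A)\<^sup>2 * ?A - 2 * (?I / ?A) * ?I + ?B" by (rule q)
    also have "\<dots> = ?B - ?I\<^sup>2 / ?A" using \<open>?A > 0\<close> by (simp add: field_simps power2_eq_square)
    finally show ?thesis using \<open>?A > 0\<close> by (simp add: field_simps)
  qed
  then have "?I\<^sup>2 \<le> (l2norm f * l2norm g)\<^sup>2" by (simp add: power_mult_distrib)
  then show ?thesis by (rule power2_le_imp_le) simp
qed

lemma norm_pair_le: assumes "f \<in> L2" "g \<in> L2" shows "norm (pair f g) \<le> l2norm f * l2norm g"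
proof -
  have "norm (pair f g) \<le> (LINT x|int_measure. norm (f x * g x))"
    unfolding pair_def by (rule integral_norm_bound)
  then show ?thesis using Cauchy_Schwarz_norms[OF assms] by (simp add: norm_mult)
qed

lemma l2norm_triangle: assumes "f \<in> L2" "g \<in> L2"
  shows "l2norm (\<lambda>x. f x + g x) \<le> l2norm f + l2norm g"
proof -
  have int: "integrable int_measure (\<lambda>x. norm (f x) * norm (g x))"
    using integrable_norm[OF integrable_pair[OF assms]] by (simp add: norm_mult)
  have "(l2norm (\<lambda>x. f x + g x))\<^sup>2 \<le>
     (LINT x|int_measure. (norm (f x))\<^sup>2 + 2 * (norm (f x) * norm (g x)) + (norm (g x))\<^sup>2)"
    unfolding l2norm_power2
  proof (rule integral_mono)
    show "integrable int_measure (\<lambda>x. (norm (f x + g x))\<^sup>2)" by (rule L2_D(2)[OF L2_add[OF assms]])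
    show "integrable int_measure (\<lambda>x. (norm (f x))\<^sup>2 + 2 * (norm (f x) * norm (g x)) + (norm (g x))\<^sup>2)"
      using int L2_D(2)[OF assms(1)] L2_D(2)[OF assms(2)] by simp
    fix x
    have "(norm (f x + g x))\<^sup>2 \<le> (norm (f x) + norm (g x))\<^sup>2"
      by (intro power_mono norm_triangle_ineq) simp
    then show "(norm (f x + g x))\<^sup>2 \<le> (norm (f x))\<^sup>2 + 2 * (norm (f x) * norm (g x)) + (norm (g x))\<^sup>2"
      by (simp add: power2_sum)
  qed
  also have "\<dots> = (l2norm f)\<^sup>2 + 2 * (LINT x|int_measure. norm (f x) * norm (g x)) + (l2norm g)\<^sup>2"
    using int L2_D(2)[OF assms(1)] L2_D(2)[OF assms(2)] by (simp add: l2norm_power2)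
  also have "\<dots> \<le> (l2norm f + l2norm g)\<^sup>2"
    using Cauchy_Schwarz_norms[OF assms] by (simp add: power2_sum)
  finally show ?thesis by (rule power2_le_imp_le) simp
qed

lemma l2norm_triangle_diff: assumes "f \<in> L2" "g \<in> L2"
  shows "l2norm (\<lambda>x. f x - g x) \<le> l2norm f + l2norm g"
  using l2norm_triangle[OF assms(1) L2_scale[OF assms(2), of "-1"]] l2norm_scale[of "-1" g] by simp

lemma l2norm_sum: "(\<And>i. i \<in> I \<Longrightarrow> f i \<in> L2) \<Longrightarrow> l2norm (\<lambda>x. \<Sum>i\<in>I. f i x) \<le> (\<Sum>i\<in>I. l2norm (f i))"
proof (induction I rule: infinite_finite_induct)
  case (insert a I)
  then have "l2norm (\<lambda>x. f a x + (\<Sum>i\<in>I. f i x)) \<le> l2norm (f a) + l2norm (\<lambda>x. \<Sum>i\<in>I. f i x)"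
    by (intro l2norm_triangle L2_sum) auto
  with insert show ?case by auto
qed auto

lemma l2norm_mult_bounded:
  assumes "f \<in> L2" "h \<in> borel_measurable int_measure" "\<And>x. x \<in> {0<..<pi} \<Longrightarrow> norm (h x) \<le> B" "0 \<le> B"
  shows "l2norm (\<lambda>x. h x * f x) \<le> B * l2norm f"
proof -
  have "(l2norm (\<lambda>x. h x * f x))\<^sup>2 \<le> (LINT x|int_measure. B\<^sup>2 * (norm (f x))\<^sup>2)"
    unfolding l2norm_power2
    by (intro integral_mono L2_D(2) L2_mult_bounded[OF assms(1,2,3)])
      (use assms L2_D(2)[OF assms(1)] in \<open>auto simp: norm_mult power_mult_distrib intro!: mult_right_mono power_mono\<close>)
  also have "\<dots> = (B * l2norm f)\<^sup>2" using assms by (simp add: power_mult_distrib l2norm_power2)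
  finally show ?thesis by (rule power2_le_imp_le) (use assms in auto)
qed

lemma pair_add: "f \<in> L2 \<Longrightarrow> g \<in> L2 \<Longrightarrow> h \<in> L2 \<Longrightarrow> pair (\<lambda>x. f x + g x) h = pair f h + pair g h"
  using integrable_pair[of f h] integrable_pair[of g h] by (simp add: pair_def distrib_right)

lemma pair_diff: "f \<in> L2 \<Longrightarrow> g \<in> L2 \<Longrightarrow> h \<in> L2 \<Longrightarrow> pair (\<lambda>x. f x - g x) h = pair f h - pair g h"
  using integrable_pair[of f h] integrable_pair[of g h] by (simp add: pair_def left_diff_distrib)

lemma pair_scale: "pair (\<lambda>x. c * f x) h = c * pair f h"
  by (simp add: pair_def mult.assoc)

lemma pair_commute: "pair f g = pair g f"
  by (simp add: pair_def mult.commute)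

lemma pair_sum: "(\<And>i. i \<in> I \<Longrightarrow> f i \<in> L2) \<Longrightarrow> h \<in> L2 \<Longrightarrow> pair (\<lambda>x. \<Sum>i\<in>I. f i x) h = (\<Sum>i\<in>I. pair (f i) h)"
  using integrable_pair[of _ h] by (simp add: pair_def sum_distrib_right)

lemma int_measure_finite: "emeasure int_measure (space int_measure) < \<infinity>"
  using emeasure_restrict_space[of "{0<..<pi}" lebesgue "{0<..<pi}"] by simp

lemma L2_bounded:
  assumes "f \<in> borel_measurable int_measure" "\<And>x. x \<in> {0<..<pi} \<Longrightarrow> norm (f x) \<le> B"
  shows "f \<in> L2"
proof -
  interpret finite_measure int_measure by (rule finite_measureI) (use int_measure_finite in auto)
  note [measurable] = assms(1)
  have "integrable int_measure (\<lambda>x. (norm (f x))\<^sup>2)"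
    by (rule integrable_const_bound[where B="B\<^sup>2"]) (use assms(2) in \<open>auto intro!: AE_I2 power_mono\<close>)
  then show ?thesis using assms by (simp add: L2_def)
qed

lemma measurable_continuous_Icc:
  assumes "continuous_on {0..pi} f" shows "f \<in> borel_measurable int_measure"
  by (intro continuous_imp_measurable_on_sets_lebesgue continuous_on_subset[OF assms]) auto

lemma L2_continuous:
  fixes f :: "real \<Rightarrow> complex"
  assumes "continuous_on {0..pi} f" shows "f \<in> L2"
proof -
  have "compact (f ` {0..pi})" by (intro compact_continuous_image assms) auto
  then obtain B where "\<And>x. x \<in> {0..pi} \<Longrightarrow> norm (f x) \<le> B"
    by (meson bounded_iff compact_imp_bounded imageI)
  then show ?thesis by (intro L2_bounded[where B=B] measurable_continuous_Icc assms) auto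
qed

lemma LINT_continuous:
  fixes f :: "real \<Rightarrow> complex"
  assumes "continuous_on {0..pi} f" shows "(LINT x|int_measure. f x) = integral {0..pi} f"
proof -
  have "integrable int_measure f"
    using integrable_pair[OF L2_continuous[OF assms] L2_continuous[of "\<lambda>x. 1"]] by simp
  then have "(LINT x|int_measure. f x) = integral {0<..<pi} f"
    by (rule lebesgue_integral_eq_integral) simp
  then show ?thesis by (simp add: integral_open_interval_real)
qed

lemma l2norm_dominated_convergence:
  assumes "g \<in> L2" "\<And>n. f n \<in> borel_measurable int_measure"
    and "\<And>n. AE x in int_measure. norm (f n x) \<le> norm (g x)"
    and "AE x in int_measure. (\<lambda>n. f n x) \<longlonglongrightarrow> 0"
  shows "(\<lambda>n. l2norm (f n)) \<longlonglongrightarrow> 0"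
proof -
  note [measurable] = assms(2)
  have "(\<lambda>n. LINT x|int_measure. (norm (f n x))\<^sup>2) \<longlonglongrightarrow> (LINT x|int_measure. (norm (0::complex))\<^sup>2)"
  proof (rule integral_dominated_convergence)
    show "integrable int_measure (\<lambda>x. (norm (g x))\<^sup>2)" by (rule L2_D(2)[OF assms(1)])
    show "AE x in int_measure. (\<lambda>n. (norm (f n x))\<^sup>2) \<longlonglongrightarrow> (norm (0::complex))\<^sup>2"
      using assms(4) by eventually_elim (intro tendsto_intros)
    show "AE x in int_measure. norm ((norm (f n x))\<^sup>2) \<le> (norm (g x))\<^sup>2" for n
      using assms(3)[of n] by eventually_elim (auto intro!: power_mono)
  qed auto
  from tendsto_real_sqrt[OF this] show ?thesis by (simp add: l2norm_def)
qed

lemma tendsto_pair: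
  assumes "\<And>n. f n \<in> L2" "g \<in> L2" "h \<in> L2" "(\<lambda>n. l2norm (\<lambda>x. f n x - g x)) \<longlonglongrightarrow> 0"
  shows "(\<lambda>n. pair (f n) h) \<longlonglongrightarrow> pair g h"
proof (rule LIMSEQ_I)
  have "(\<lambda>n. norm (pair (f n) h - pair g h)) \<longlonglongrightarrow> 0"
  proof (rule tendsto_sandwich[OF _ _ tendsto_const])
    show "\<forall>\<^sub>F n in sequentially. norm (pair (f n) h - pair g h) \<le> l2norm (\<lambda>x. f n x - g x) * l2norm h"
      using norm_pair_le[OF L2_diff[OF assms(1,2)] assms(3)] pair_diff[OF assms(1,2,3)]
      by (intro always_eventually) auto
    show "(\<lambda>n. l2norm (\<lambda>x. f n x - g x) * l2norm h) \<longlonglongrightarrow> 0"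
      using tendsto_mult_left_zero[OF assms(4)] .
  qed simp
  then have "(\<lambda>n. pair (f n) h) \<longlonglongrightarrow> pair g h"
    by (simp add: LIM_zero_cancel tendsto_norm_zero_iff)
  then show "0 < r \<Longrightarrow> \<exists>no. \<forall>n\<ge>no. norm (pair (f n) h - pair g h) < r" for r
    by (simp add: LIMSEQ_iff)
qed

lemma nn_integral_norm2: "f \<in> L2 \<Longrightarrow> (\<integral>\<^sup>+ x. ennreal ((norm (f x))\<^sup>2) \<partial>int_measure) = ennreal ((l2norm f)\<^sup>2)"
  unfolding l2norm_power2 by (intro nn_integral_eq_integral L2_D) auto

lemma L2_I_nn_integral:
  assumes "f \<in> borel_measurable int_measure" "0 \<le> C"
    "(\<integral>\<^sup>+ x. ennreal ((norm (f x))\<^sup>2) \<partial>int_measure) \<le> ennreal (C\<^sup>2)"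
  shows "f \<in> L2" "l2norm f \<le> C"
proof -
  note [measurable] = assms(1)
  have "(\<integral>\<^sup>+ x. ennreal ((norm (f x))\<^sup>2) \<partial>int_measure) < \<infinity>"
    using assms(3) by (auto intro: le_less_trans)
  then have "integrable int_measure (\<lambda>x. (norm (f x))\<^sup>2)"
    by (intro integrableI_nonneg) auto
  then show L: "f \<in> L2" using assms(1) by (simp add: L2_def)
  have "(l2norm f)\<^sup>2 \<le> C\<^sup>2" using assms(3) nn_integral_norm2[OF L] by simp
  then show "l2norm f \<le> C" using assms(2) by (rule power2_le_imp_le)
qed

text \<open>
  The part of the Riesz-Fischer theorem needed later: a sequence whose increments have summable
  norms has a limit, and the tails of the sum bound the distance to it. The increments converge
  absolutely almost everywhere by monotone convergence; Fatou's lemma gives the bounds.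
\<close>
lemma L2_complete:
  assumes x: "\<And>n. x n \<in> L2" and a: "\<And>n. l2norm (\<lambda>z. x (Suc n) z - x n z) \<le> a n" and "summable a"
  shows "\<exists>y\<in>L2. \<forall>n. l2norm (\<lambda>z. y z - x n z) \<le> (\<Sum>k. a (k + n))"
proof -
  have a0: "0 \<le> a n" for n using order_trans[OF l2norm_nonneg a] .
  note xm [measurable] = L2_D(1)[OF x]
  define D where "D k z = norm (x (Suc k) z - x k z)" for k z
  have DL: "(\<lambda>z. complex_of_real (D k z)) \<in> L2" for k
    unfolding D_def by (intro L2_norm L2_diff x)
  have D0: "0 \<le> D k z" for k z by (simp add: D_def)
  define S where "S = suminf a"
  have S0: "0 \<le> S" unfolding S_def by (intro suminf_nonneg assms a0)
  have G: "(\<integral>\<^sup>+ z. ennreal ((\<Sum>k<N. D k z)\<^sup>2) \<partial>int_measure) \<le> ennreal (S\<^sup>2)" for N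
  proof -
    let ?g = "\<lambda>z. \<Sum>k<N. complex_of_real (D k z)"
    have gL: "?g \<in> L2" by (intro L2_sum DL)
    have "l2norm ?g \<le> (\<Sum>k<N. l2norm (\<lambda>z. complex_of_real (D k z)))"
      by (intro l2norm_sum DL)
    also have "\<dots> \<le> (\<Sum>k<N. a k)"
      unfolding D_def l2norm_of_norm by (intro sum_mono a)
    also have "\<dots> \<le> S" unfolding S_def using assms(3) a0 by (intro sum_le_suminf) auto
    finally have "(l2norm ?g)\<^sup>2 \<le> S\<^sup>2" by (intro power_mono) auto
    moreover have "norm (?g z) = (\<Sum>k<N. D k z)" for z
      by (simp add: D0 sum_nonneg flip: of_real_sum)
    ultimately show ?thesis using nn_integral_norm2[OF gL] by simp
  qed
  have inc: "incseq (\<lambda>N z. ennreal ((\<Sum>k<N. D k z)\<^sup>2))"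
    by (intro incseq_SucI le_funI ennreal_leI power_mono sum_nonneg) (auto simp: D0)
  have Dm [measurable]: "(\<lambda>z. D k z) \<in> borel_measurable int_measure" for k unfolding D_def by measurable
  have "(\<integral>\<^sup>+ z. (SUP N. ennreal ((\<Sum>k<N. D k z)\<^sup>2)) \<partial>int_measure) \<le> ennreal (S\<^sup>2)"
    by (subst nn_integral_monotone_convergence_SUP[OF inc]) (auto intro!: SUP_least G)
  then have "(\<integral>\<^sup>+ z. (SUP N. ennreal ((\<Sum>k<N. D k z)\<^sup>2)) \<partial>int_measure) \<noteq> \<infinity>"
    by (auto simp: top_unique)
  then have fin: "AE z in int_measure. (SUP N. ennreal ((\<Sum>k<N. D k z)\<^sup>2)) \<noteq> \<infinity>"
    by (intro nn_integral_PInf_AE) auto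
  have conv: "AE z in int_measure. convergent (\<lambda>n. x n z)"
    using fin
  proof eventually_elim
    case (elim z)
    then obtain r where r: "(SUP N. ennreal ((\<Sum>k<N. D k z)\<^sup>2)) = ennreal r" "0 \<le> r"
      by (cases "SUP N. ennreal ((\<Sum>k<N. D k z)\<^sup>2)") auto
    have "ennreal ((\<Sum>k<N. D k z)\<^sup>2) \<le> ennreal r" for N
      unfolding r(1)[symmetric] by (intro SUP_upper) auto
    then have "(\<Sum>k<N. D k z)\<^sup>2 \<le> r" for N using r(2) by (simp add: ennreal_le_iff)
    then have "(\<Sum>k<N. D k z) \<le> sqrt r" for N by (rule real_le_rsqrt)
    then have "summable (\<lambda>k. D k z)" by (intro summableI_nonneg_bounded[where x="sqrt r"]) (auto simp: D0)
    then have "summable (\<lambda>k. x (Suc k) z - x k z)" unfolding D_def by (rule summable_norm_cancel)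
    then have "convergent (\<lambda>n. \<Sum>k<n. x (Suc k) z - x k z)" by (simp add: summable_iff_convergent)
    then have "convergent (\<lambda>n. x n z - x 0 z)" using sum_lessThan_telescope[of "\<lambda>n. x n z"] by simp
    then show ?case by (simp add: convergent_diff_const_right_iff)
  qed
  define y where "y z = lim (\<lambda>n. x n z)" for z
  have ym [measurable]: "y \<in> borel_measurable int_measure"
    unfolding y_def by (intro borel_measurable_lim_metric xm)
  have bound: "(\<lambda>z. y z - x n z) \<in> L2 \<and> l2norm (\<lambda>z. y z - x n z) \<le> (\<Sum>k. a (k + n))" for n
  proof -
    let ?C = "\<Sum>k. a (k + n)"
    have sa: "summable (\<lambda>k. a (k + n))" using assms(3) by (simp add: summable_iff_shift)
    have C0: "0 \<le> ?C" by (intro suminf_nonneg sa a0)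
    have step: "l2norm (\<lambda>z. x (n + N) z - x n z) \<le> ?C" for N
    proof -
      have "(\<lambda>z. x (n + N) z - x n z) = (\<lambda>z. \<Sum>k<N. x (Suc (k + n)) z - x (k + n) z)"
        using sum_lessThan_telescope[of "\<lambda>k. x (k + n) _" N] by (simp add: add.commute)
      then have "l2norm (\<lambda>z. x (n + N) z - x n z) \<le> (\<Sum>k<N. l2norm (\<lambda>z. x (Suc (k + n)) z - x (k + n) z))"
        using l2norm_sum[of "{..<N}" "\<lambda>k z. x (Suc (k + n)) z - x (k + n) z"] by (simp add: L2_diff x)
      also have "\<dots> \<le> (\<Sum>k<N. a (k + n))" by (intro sum_mono a)
      also have "\<dots> \<le> ?C" using sa a0 by (intro sum_le_suminf) auto
      finally show ?thesis .
    qed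
    have "(\<integral>\<^sup>+ z. ennreal ((norm (y z - x n z))\<^sup>2) \<partial>int_measure) =
        (\<integral>\<^sup>+ z. liminf (\<lambda>N. ennreal ((norm (x (n + N) z - x n z))\<^sup>2)) \<partial>int_measure)"
    proof (rule nn_integral_cong_AE, use conv in eventually_elim)
      case (elim z)
      then have "(\<lambda>N. x N z) \<longlonglongrightarrow> y z" unfolding y_def by (simp add: convergent_LIMSEQ_iff)
      then have "(\<lambda>N. x (n + N) z) \<longlonglongrightarrow> y z" using LIMSEQ_ignore_initial_segment[of "\<lambda>N. x N z" "y z" n] by (simp add: add.commute)
      then have "(\<lambda>N. ennreal ((norm (x (n + N) z - x n z))\<^sup>2)) \<longlonglongrightarrow> ennreal ((norm (y z - x n z))\<^sup>2)"
        by (intro tendsto_intros) auto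
      then show ?case by (intro lim_imp_Liminf[symmetric]) auto
    qed
    also have "\<dots> \<le> liminf (\<lambda>N. \<integral>\<^sup>+ z. ennreal ((norm (x (n + N) z - x n z))\<^sup>2) \<partial>int_measure)"
      by (intro nn_integral_liminf) measurable
    also have "\<dots> \<le> liminf (\<lambda>N. ennreal (?C\<^sup>2))"
    proof (intro Liminf_mono always_eventually allI)
      fix N
      show "(\<integral>\<^sup>+ z. ennreal ((norm (x (n + N) z - x n z))\<^sup>2) \<partial>int_measure) \<le> ennreal (?C\<^sup>2)"
        unfolding nn_integral_norm2[OF L2_diff[OF x x]]
        by (intro ennreal_leI power_mono step) auto
    qed
    also have "\<dots> = ennreal (?C\<^sup>2)" by (intro Liminf_const) auto
    finally show ?thesis using L2_I_nn_integral[OF _ C0, of "\<lambda>z. y z - x n z"] by simp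
  qed
  have "y \<in> L2" using L2_add[OF conjunct1[OF bound[of 0]] x[of 0]] by simp
  then show ?thesis using bound by blast
qed

section \<open>Sine series\<close>

text \<open>
  Indexing by all natural numbers, with the zero function at index 0, avoids shifted indices; the
  family is orthonormal apart from that element.
\<close>
definition sine :: "nat \<Rightarrow> real \<Rightarrow> complex"
  where "sine n x = of_real (sqrt (2 / pi) * sin (real n * x))"

definition coef :: "(real \<Rightarrow> complex) \<Rightarrow> nat \<Rightarrow> complex"
  where "coef f n = pair f (sine n)"

definition sine_sum :: "nat \<Rightarrow> (real \<Rightarrow> complex) \<Rightarrow> real \<Rightarrow> complex"
  where "sine_sum N f x = (\<Sum>n<N. coef f n * sine n x)"

lemma continuous_on_sine [continuous_intros]: "continuous_on S (sine n)"
  unfolding sine_def by (intro continuous_intros)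

lemma sine_L2: "sine n \<in> L2"
  by (intro L2_continuous continuous_intros)

lemma LINT_cos: "(LINT x|int_measure. complex_of_real (cos (of_int k * x))) = (if k = 0 then of_real pi else 0)"
proof -
  have "(LINT x|int_measure. complex_of_real (cos (of_int k * x))) = integral {0..pi} (\<lambda>x. complex_of_real (cos (of_int k * x)))"
    by (intro LINT_continuous continuous_intros)
  also have "\<dots> = (if k = 0 then of_real pi else 0)"
  proof (cases "k = 0")
    case False
    have "((\<lambda>x. complex_of_real (cos (of_int k * x))) has_integral
        complex_of_real (sin (of_int k * pi) / of_int k) - complex_of_real (sin (of_int k * 0) / of_int k)) {0..pi}"
      by (rule fundamental_theorem_of_calculus[OF pi_ge_zero])
        (rule has_vector_derivative_of_real,
          use False in \<open>auto intro!: derivative_eq_intros\<close>)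
    moreover have "sin (of_int k * pi) = 0" by (metis mult.commute sin_int_times_real sin_npi_int)
    ultimately show ?thesis using False by (simp add: integral_unique)
  qed (simp add: scaleR_conv_of_real)
  finally show ?thesis .
qed

lemma integrable_continuous_int_measure:
  fixes f :: "real \<Rightarrow> complex"
  assumes "continuous_on {0..pi} f" shows "integrable int_measure f"
  using integrable_pair[OF L2_continuous[OF assms] L2_continuous[of "\<lambda>x. 1"]] by simp

lemma pair_sine_sine: "pair (sine n) (sine m) = (if n = m \<and> n \<noteq> 0 then 1 else 0)"
proof -
  have "sine n x * sine m x = of_real (1 / pi) *
     (of_real (cos (of_int (int n - int m) * x)) - of_real (cos (of_int (int n + int m) * x)))" for x
  proof -
    have "sine n x * sine m x = of_real ((sqrt (2 / pi) * sqrt (2 / pi)) * (sin (real n * x) * sin (real m * x)))"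
      unfolding sine_def by (simp only: of_real_mult mult_ac)
    also have "sqrt (2 / pi) * sqrt (2 / pi) = 2 / pi" by simp
    also have "sin (real n * x) * sin (real m * x) = (cos (of_int (int n - int m) * x) - cos (of_int (int n + int m) * x)) / 2"
      unfolding sin_times_sin by (simp add: left_diff_distrib distrib_right)
    also have "2 / pi * ((cos (of_int (int n - int m) * x) - cos (of_int (int n + int m) * x)) / 2)
        = 1 / pi * (cos (of_int (int n - int m) * x) - cos (of_int (int n + int m) * x))"
      by (simp add: field_simps)
    finally show ?thesis by (simp only: of_real_mult of_real_diff)
  qed
  then have "pair (sine n) (sine m) = of_real (1 / pi) *
     ((LINT x|int_measure. of_real (cos (of_int (int n - int m) * x))) -
      (LINT x|int_measure. of_real (cos (of_int (int n + int m) * x))))"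
    unfolding pair_def
    by (simp add: integrable_continuous_int_measure continuous_intros del: of_int_diff of_int_add of_real_divide)
  also have "\<dots> = (if n = m \<and> n \<noteq> 0 then 1 else 0)"
    unfolding LINT_cos by auto
  finally show ?thesis .
qed

text \<open>
  The cosines of even frequency appear on the diagonal of the matrix of the potential, since
  $\sin^2(nx) = (1 - \cos(2nx))/2$.
\<close>
definition cosine2 :: "nat \<Rightarrow> real \<Rightarrow> complex"
  where "cosine2 n x = of_real (sqrt (1 / pi) * cos (2 * real n * x))"

lemma continuous_on_cosine2 [continuous_intros]: "continuous_on S (cosine2 n)"
  unfolding cosine2_def by (intro continuous_intros)

lemma cosine2_L2: "cosine2 n \<in> L2"
  by (intro L2_continuous continuous_intros)

lemma pair_cosine2: "pair (cosine2 n) (cosine2 m) = (if n = m then if n = 0 then 1 else 1 / 2 else 0)"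
proof -
  have "cosine2 n x * cosine2 m x = of_real (1 / (2 * pi)) *
     (of_real (cos (of_int (2 * int n - 2 * int m) * x)) + of_real (cos (of_int (2 * int n + 2 * int m) * x)))" for x
  proof -
    have "cosine2 n x * cosine2 m x = of_real ((sqrt (1 / pi) * sqrt (1 / pi)) * (cos (2 * real n * x) * cos (2 * real m * x)))"
      unfolding cosine2_def by (simp only: of_real_mult mult_ac)
    also have "sqrt (1 / pi) * sqrt (1 / pi) = 1 / pi" by simp
    also have "cos (2 * real n * x) * cos (2 * real m * x) = (cos (of_int (2 * int n - 2 * int m) * x) + cos (of_int (2 * int n + 2 * int m) * x)) / 2"
      unfolding cos_times_cos by (simp add: left_diff_distrib distrib_right)
    also have "1 / pi * ((cos (of_int (2 * int n - 2 * int m) * x) + cos (of_int (2 * int n + 2 * int m) * x)) / 2)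
        = 1 / (2 * pi) * (cos (of_int (2 * int n - 2 * int m) * x) + cos (of_int (2 * int n + 2 * int m) * x))"
      by (simp add: field_simps)
    finally show ?thesis by (simp only: of_real_mult of_real_add)
  qed
  then have "pair (cosine2 n) (cosine2 m) = of_real (1 / (2 * pi)) *
     ((LINT x|int_measure. of_real (cos (of_int (2 * int n - 2 * int m) * x))) +
      (LINT x|int_measure. of_real (cos (of_int (2 * int n + 2 * int m) * x))))"
    unfolding pair_def
    by (simp add: integrable_continuous_int_measure continuous_intros del: of_int_diff of_int_add of_real_divide of_int_mult)
  also have "\<dots> = (if n = m then if n = 0 then 1 else 1 / 2 else 0)"
    unfolding LINT_cos by auto
  finally show ?thesis .
qed

lemma l2norm_power2_pair: assumes "h \<in> L2" shows "(l2norm h)\<^sup>2 = Re (pair h (\<lambda>x. cnj (h x)))"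
proof -
  have "pair h (\<lambda>x. cnj (h x)) = complex_of_real (LINT x|int_measure. (norm (h x))\<^sup>2)"
    unfolding pair_def by (simp add: complex_norm_square[symmetric] del: of_real_power)
  then show ?thesis by (simp add: l2norm_power2)
qed

text \<open>
  The general step of Bessel's inequality. The vector \<open>e\<close> may be shorter than a unit vector, which
  covers both the zero function among the sines and the cosines normalised uniformly.
\<close>
lemma l2norm_remove_component:
  assumes h: "h \<in> L2" and e: "(\<lambda>x. complex_of_real (e x)) \<in> L2"
    and c: "c = pair h (\<lambda>x. complex_of_real (e x))"
    and e1: "Re (pair (\<lambda>x. complex_of_real (e x)) (\<lambda>x. complex_of_real (e x))) \<le> 1"
  shows "(l2norm (\<lambda>x. h x - c * of_real (e x)))\<^sup>2 + (norm c)\<^sup>2 \<le> (l2norm h)\<^sup>2"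
proof -
  let ?e = "\<lambda>x. complex_of_real (e x)"
  have "l2norm (\<lambda>x. c * ?e x) ^ 2 \<le> (norm c)\<^sup>2"
    using e1 l2norm_power2_pair[OF e] mult_left_mono[of "(l2norm ?e)\<^sup>2" 1 "(norm c)\<^sup>2"]
    by (simp add: l2norm_scale power_mult_distrib)
  moreover have "(l2norm (\<lambda>x. h x - c * ?e x))\<^sup>2 = (l2norm h)\<^sup>2 - 2 * (norm c)\<^sup>2 + (l2norm (\<lambda>x. c * ?e x))\<^sup>2"
  proof -
    define r where "r x = Re (cnj c * (h x * ?e x))" for x
    have i: "integrable int_measure (\<lambda>x. cnj c * (h x * ?e x))"
      using integrable_pair[OF h e] by simp
    have ir: "integrable int_measure r" unfolding r_def[abs_def] by (rule integrable_Re[OF i])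
    have "(norm (h x - c * ?e x))\<^sup>2 = (norm (h x))\<^sup>2 - 2 * r x + (norm (c * ?e x))\<^sup>2" for x
      unfolding cmod_power2 r_def by (simp add: power2_eq_square algebra_simps)
    then have "(l2norm (\<lambda>x. h x - c * ?e x))\<^sup>2 = (LINT x|int_measure. (norm (h x))\<^sup>2 - 2 * r x + (norm (c * ?e x))\<^sup>2)"
      unfolding l2norm_power2 by simp
    also have "\<dots> = (l2norm h)\<^sup>2 - 2 * (LINT x|int_measure. r x) + (l2norm (\<lambda>x. c * ?e x))\<^sup>2"
      using ir L2_D(2)[OF h] L2_D(2)[OF L2_scale[OF e, of c]]
      by (simp add: l2norm_power2 del: norm_mult)
    also have "(LINT x|int_measure. r x) = Re (LINT x|int_measure. cnj c * (h x * ?e x))"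
      unfolding r_def by (rule integral_Re[OF i])
    also have "(LINT x|int_measure. cnj c * (h x * ?e x)) = cnj c * c"
      by (simp add: c pair_def)
    also have "Re (cnj c * c) = (norm c)\<^sup>2" unfolding cmod_power2 by (simp add: power2_eq_square)
    finally show ?thesis .
  qed
  ultimately show ?thesis by simp
qed

lemma Bessel_ineq:
  fixes e :: "nat \<Rightarrow> real \<Rightarrow> real"
  assumes f: "f \<in> L2" and e: "\<And>n. (\<lambda>x. complex_of_real (e n x)) \<in> L2"
    and orth: "\<And>n m. n \<noteq> m \<Longrightarrow> pair (\<lambda>x. complex_of_real (e n x)) (\<lambda>x. complex_of_real (e m x)) = 0"
    and e1: "\<And>n. Re (pair (\<lambda>x. complex_of_real (e n x)) (\<lambda>x. complex_of_real (e n x))) \<le> 1"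
    and c: "\<And>n. c n = pair f (\<lambda>x. complex_of_real (e n x))"
  shows "(l2norm (\<lambda>x. f x - (\<Sum>n<N. c n * of_real (e n x))))\<^sup>2 + (\<Sum>n<N. (norm (c n))\<^sup>2) \<le> (l2norm f)\<^sup>2"
proof (induction N)
  case (Suc N)
  let ?h = "\<lambda>x. f x - (\<Sum>n<N. c n * of_real (e n x))"
  have h: "?h \<in> L2" by (intro L2_diff f L2_sum L2_scale e)
  have "pair ?h (\<lambda>x. of_real (e N x)) = c N - (\<Sum>n<N. pair (\<lambda>x. c n * of_real (e n x)) (\<lambda>x. of_real (e N x)))"
    using f e by (simp add: pair_diff L2_sum L2_scale pair_sum c)
  also have "\<dots> = c N" by (simp add: pair_scale orth)
  finally have "(l2norm (\<lambda>x. ?h x - c N * of_real (e N x)))\<^sup>2 + (norm (c N))\<^sup>2 \<le> (l2norm ?h)\<^sup>2"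
    by (intro l2norm_remove_component[OF h e _ e1]) simp
  then show ?case using Suc by (simp add: algebra_simps)
qed simp

lemma Bessel_sine: assumes "f \<in> L2"
  shows "(l2norm (\<lambda>x. f x - sine_sum N f x))\<^sup>2 + (\<Sum>n<N. (norm (coef f n))\<^sup>2) \<le> (l2norm f)\<^sup>2"
proof -
  have s: "sine n = (\<lambda>x. complex_of_real (sqrt (2 / pi) * sin (real n * x)))" for n
    by (simp add: sine_def fun_eq_iff)
  show ?thesis
    unfolding sine_sum_def sine_def[of _ ]
    by (rule Bessel_ineq[OF assms]; unfold s[symmetric] coef_def) (auto simp: sine_L2 pair_sine_sine)
qed

lemma sum_norm_coef_le: assumes "f \<in> L2" shows "(\<Sum>n<N. (norm (coef f n))\<^sup>2) \<le> (l2norm f)\<^sup>2"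
  using Bessel_sine[OF assms, of N] zero_le_power2[of "l2norm (\<lambda>x. f x - sine_sum N f x)"] by linarith

lemma l2norm_sine_rem_le: assumes "f \<in> L2" shows "l2norm (\<lambda>x. f x - sine_sum N f x) \<le> l2norm f"
proof (rule power2_le_imp_le)
  show "(l2norm (\<lambda>x. f x - sine_sum N f x))\<^sup>2 \<le> (l2norm f)\<^sup>2"
    using Bessel_sine[OF assms, of N] by (smt (verit) sum_nonneg zero_le_power2)
qed simp

lemma sum_norm_cosine2_le: assumes "f \<in> L2" shows "(\<Sum>n<N. (norm (pair f (cosine2 n)))\<^sup>2) \<le> (l2norm f)\<^sup>2"
proof -
  have s: "cosine2 n = (\<lambda>x. complex_of_real (sqrt (1 / pi) * cos (2 * real n * x)))" for n
    by (simp add: cosine2_def fun_eq_iff)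
  have "(l2norm (\<lambda>x. f x - (\<Sum>n<N. pair f (cosine2 n) * of_real (sqrt (1 / pi) * cos (2 * real n * x)))))\<^sup>2
      + (\<Sum>n<N. (norm (pair f (cosine2 n)))\<^sup>2) \<le> (l2norm f)\<^sup>2"
    by (rule Bessel_ineq[OF assms]; unfold s[symmetric]) (auto simp: cosine2_L2 pair_cosine2)
  then show ?thesis
    by (smt (verit) zero_le_power2)
qed

lemma sine_sum_L2: "sine_sum N f \<in> L2"
  unfolding sine_sum_def[abs_def] by (intro L2_sum L2_scale sine_L2)

lemma coef_lin:
  assumes "f \<in> L2" "g \<in> L2" shows "coef (\<lambda>x. a * f x + b * g x) n = a * coef f n + b * coef g n"
  using assms by (simp add: coef_def pair_add L2_scale sine_L2 pair_scale)

lemma sine_sum_lin: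
  assumes "f \<in> L2" "g \<in> L2" shows "sine_sum N (\<lambda>x. a * f x + b * g x) x = a * sine_sum N f x + b * sine_sum N g x"
  by (simp add: sine_sum_def coef_lin[OF assms] sum_distrib_left algebra_simps sum.distrib)

text \<open>
  The functions whose sine series converges to them in $L^2$. They form a closed subspace, and
  completeness of the sine system is the statement that this subspace is everything.
\<close>
definition sine_span :: "(real \<Rightarrow> complex) set"
  where "sine_span = {f \<in> L2. (\<lambda>N. l2norm (\<lambda>x. f x - sine_sum N f x)) \<longlonglongrightarrow> 0}"

lemma sine_span_lin:
  assumes "f \<in> sine_span" "g \<in> sine_span" shows "(\<lambda>x. a * f x + b * g x) \<in> sine_span"
proof -
  have L: "f \<in> L2" "g \<in> L2" using assms by (auto simp: sine_span_def)
  have "(\<lambda>N. l2norm (\<lambda>x. (a * f x + b * g x) - sine_sum N (\<lambda>x. a * f x + b * g x) x)) \<longlonglongrightarrow> 0"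
  proof (rule tendsto_sandwich[OF _ _ tendsto_const])
    show "(\<lambda>N. norm a * l2norm (\<lambda>x. f x - sine_sum N f x) + norm b * l2norm (\<lambda>x. g x - sine_sum N g x)) \<longlonglongrightarrow> 0"
      using assms by (auto simp: sine_span_def intro!: tendsto_eq_intros)
    show "\<forall>\<^sub>F N in sequentially. l2norm (\<lambda>x. (a * f x + b * g x) - sine_sum N (\<lambda>x. a * f x + b * g x) x)
       \<le> norm a * l2norm (\<lambda>x. f x - sine_sum N f x) + norm b * l2norm (\<lambda>x. g x - sine_sum N g x)"
    proof (intro always_eventually allI)
      fix N
      have "(\<lambda>x. (a * f x + b * g x) - sine_sum N (\<lambda>x. a * f x + b * g x) x) =
         (\<lambda>x. a * (f x - sine_sum N f x) + b * (g x - sine_sum N g x))"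
        by (simp add: sine_sum_lin[OF L] fun_eq_iff algebra_simps)
      then show "l2norm (\<lambda>x. (a * f x + b * g x) - sine_sum N (\<lambda>x. a * f x + b * g x) x)
       \<le> norm a * l2norm (\<lambda>x. f x - sine_sum N f x) + norm b * l2norm (\<lambda>x. g x - sine_sum N g x)"
        using l2norm_triangle[of "\<lambda>x. a * (f x - sine_sum N f x)" "\<lambda>x. b * (g x - sine_sum N g x)"] L
        by (simp add: l2norm_scale L2_scale L2_diff sine_sum_L2)
    qed
  qed auto
  then show ?thesis using L by (simp add: sine_span_def L2_add L2_scale)
qed

text \<open>
  The remainder operators \<open>f - sine_sum N f\<close> have norm at most 1, so convergence to 0 passes to
  limits.
\<close>
lemma sine_span_closed:
  assumes f: "\<And>k. f k \<in> sine_span" and g: "g \<in> L2" and lim: "(\<lambda>k. l2norm (\<lambda>x. f k x - g x)) \<longlonglongrightarrow> 0"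
  shows "g \<in> sine_span"
proof -
  have L: "f k \<in> L2" for k using f by (auto simp: sine_span_def)
  have "(\<lambda>N. l2norm (\<lambda>x. g x - sine_sum N g x)) \<longlonglongrightarrow> 0"
  proof (rule LIMSEQ_I)
    fix r :: real assume r: "0 < r"
    obtain k where k: "l2norm (\<lambda>x. f k x - g x) < r / 2"
      using LIMSEQ_D[OF lim, of "r / 2"] r by auto
    have "(\<lambda>N. l2norm (\<lambda>x. f k x - sine_sum N (f k) x)) \<longlonglongrightarrow> 0" using f by (auto simp: sine_span_def)
    from LIMSEQ_D[OF this, of "r / 2"] r obtain N0
      where N0: "\<And>N. N \<ge> N0 \<Longrightarrow> l2norm (\<lambda>x. f k x - sine_sum N (f k) x) < r / 2" by auto
    have "l2norm (\<lambda>x. g x - sine_sum N g x) < r" if "N \<ge> N0" for N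
    proof -
      let ?d = "\<lambda>x. 1 * g x + (-1) * f k x"
      have d: "?d \<in> L2" using L2_diff[OF g L] by simp
      have eq: "(\<lambda>x. g x - sine_sum N g x) = (\<lambda>x. (?d x - sine_sum N ?d x) + (f k x - sine_sum N (f k) x))"
        unfolding sine_sum_lin[OF g L] by simp
      have "l2norm (\<lambda>x. g x - sine_sum N g x) \<le> l2norm (\<lambda>x. ?d x - sine_sum N ?d x) + l2norm (\<lambda>x. f k x - sine_sum N (f k) x)"
        by (subst eq, rule l2norm_triangle[OF L2_diff[OF d sine_sum_L2] L2_diff[OF L sine_sum_L2]])
      moreover have "l2norm (\<lambda>x. ?d x - sine_sum N ?d x) < r / 2"
        using l2norm_sine_rem_le[OF d, of N] k l2norm_minus_commute[of g "f k"] by simp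
      ultimately show ?thesis using N0[OF that] by simp
    qed
    then show "\<exists>no. \<forall>n\<ge>no. norm (l2norm (\<lambda>x. g x - sine_sum n g x) - 0) < r" by auto
  qed
  then show ?thesis using g by (simp add: sine_span_def)
qed

lemma sine_in_span: "sine m \<in> sine_span"
proof -
  have eq: "sine_sum N (sine m) x = sine m x" if "N > m" for N x
  proof -
    have "sine_sum N (sine m) x = (\<Sum>n<N. if n = m then (if m \<noteq> 0 then sine m x else 0) else 0)"
      unfolding sine_sum_def coef_def pair_sine_sine by (intro sum.cong) auto
    also have "\<dots> = sine m x" using that by (simp add: sine_def)
    finally show ?thesis .
  qed
  have "(\<lambda>N. l2norm (\<lambda>x. sine m x - sine_sum N (sine m) x)) \<longlonglongrightarrow> 0"
    by (intro tendsto_eventually eventually_sequentiallyI[of "Suc m"]) (simp add: eq)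
  then show ?thesis by (simp add: sine_span_def sine_L2)
qed

text \<open>
  By $2\sin(nx)\cos x = \sin((n+1)x) + \sin((n-1)x)$, multiplication by $\cos x$ preserves sine
  polynomials.
\<close>
lemma sine_mult_cos_power: "(\<lambda>x. sine n x * of_real (cos x) ^ k) \<in> sine_span"
proof (induction k arbitrary: n)
  case (Suc k)
  show ?case
  proof (cases n)
    case 0
    then show ?thesis using Suc[of 0] by (simp add: sine_def)
  next
    case (Suc m)
    have step: "sine n x * of_real (cos x) = (1/2) * sine (Suc n) x + (1/2) * sine m x" for x
    proof -
      have "sin (real n * x) * cos x = (sin (real (Suc n) * x) + sin (real m * x)) / 2"
        unfolding sin_times_cos using Suc by (simp add: algebra_simps)
      then have "sqrt (2 / pi) * (sin (real n * x) * cos x) = sqrt (2 / pi) * ((sin (real (Suc n) * x) + sin (real m * x)) / 2)"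
        by (simp only:)
      also have "\<dots> = (1/2) * (sqrt (2 / pi) * sin (real (Suc n) * x)) + (1/2) * (sqrt (2 / pi) * sin (real m * x))"
        by (simp add: field_simps)
      finally have "sqrt (2 / pi) * sin (real n * x) * cos x = (1/2) * (sqrt (2 / pi) * sin (real (Suc n) * x)) + (1/2) * (sqrt (2 / pi) * sin (real m * x))"
        by (simp only: mult.assoc)
      then have "complex_of_real (sqrt (2 / pi) * sin (real n * x) * cos x)
          = of_real ((1/2) * (sqrt (2 / pi) * sin (real (Suc n) * x)) + (1/2) * (sqrt (2 / pi) * sin (real m * x)))"
        by (simp only:)
      then show ?thesis unfolding sine_def by (simp only: of_real_mult of_real_add of_real_divide of_real_1 of_real_numeral)
    qed
    have "sine n x * of_real (cos x) ^ Suc k = (1/2) * (sine (Suc n) x * of_real (cos x) ^ k) + (1/2) * (sine m x * of_real (cos x) ^ k)" for x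
    proof -
      have "sine n x * of_real (cos x) ^ Suc k = (sine n x * of_real (cos x)) * of_real (cos x) ^ k"
        by (simp only: power_Suc mult.assoc)
      then show ?thesis unfolding step by (simp only: distrib_right mult.assoc)
    qed
    then show ?thesis using sine_span_lin[OF Suc.IH[of "Suc n"] Suc.IH[of m], of "1/2" "1/2"] by simp
  qed
qed (simp add: sine_in_span)

lemma sin_mult_cos_power: "(\<lambda>x. of_real (sin x) * of_real (cos x) ^ k) \<in> sine_span"
proof -
  define s where "s = complex_of_real (sqrt (2 / pi))"
  have "s \<noteq> 0" by (simp add: s_def)
  moreover have "sine 1 x = s * of_real (sin x)" for x by (simp add: sine_def s_def)
  ultimately have "(1 / s) * (sine 1 x * of_real (cos x) ^ k) + 0 * (sine 1 x * of_real (cos x) ^ k)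
      = of_real (sin x) * of_real (cos x) ^ k" for x
    by simp
  then show ?thesis
    using sine_span_lin[OF sine_mult_cos_power[of 1 k] sine_mult_cos_power[of 1 k], of "1 / s" 0] by simp
qed

lemma sine_poly_cos_in_span:
  "(\<lambda>x. of_real (sin x) * (\<Sum>i\<le>k. a i * of_real (cos x) ^ i)) \<in> sine_span"
proof (induction k)
  case 0
  show ?case
    using sine_span_lin[OF sin_mult_cos_power[of 0] sin_mult_cos_power[of 0], of "a 0" 0]
    by (simp add: mult.commute)
next
  case (Suc k)
  have "of_real (sin x) * (\<Sum>i\<le>Suc k. a i * of_real (cos x) ^ i)
     = 1 * (of_real (sin x) * (\<Sum>i\<le>k. a i * of_real (cos x) ^ i))
       + a (Suc k) * (of_real (sin x) * of_real (cos x) ^ Suc k)" for x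
    by (simp add: distrib_left del: power_Suc)
  then show ?case
    using sine_span_lin[OF Suc sin_mult_cos_power[of "Suc k"], of 1 "a (Suc k)"] by (simp only:)
qed

text \<open>
  In the variable $y = \cos x$ the function \<open>g\<close> is continuous on $[-1,1]$, so the Weierstrass theorem
  approximates it uniformly by polynomials in $\cos x$. The factor $\sin x$ turns these into sine
  polynomials.
\<close>
lemma continuous_sin_mult_in_span:
  assumes "continuous_on {0..pi} g" shows "(\<lambda>x. of_real (sin x) * g x) \<in> sine_span"
proof -
  have "continuous_on {-1..1} (\<lambda>y. g (arccos y))"
    by (rule continuous_on_compose2[OF assms continuous_on_arccos'])
      (auto simp: arccos_lbound arccos_ubound)
  have "\<forall>n. \<exists>Q. Q \<in> sine_span \<and> (\<forall>x\<in>{0<..<pi}. norm (Q x - of_real (sin x) * g x) \<le> 1 / real (Suc n))" (is "\<forall>n. \<exists>Q. ?P n Q")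
  proof
    fix n
    obtain p where p: "polynomial_function p" "\<And>y. y \<in> {-1..1} \<Longrightarrow> norm (g (arccos y) - p y) < 1 / real (Suc n)"
      using Stone_Weierstrass_polynomial_function[of "{-1..1::real}" "\<lambda>y. g (arccos y)" "1 / real (Suc n)"]
        \<open>continuous_on {-1..1} (\<lambda>y. g (arccos y))\<close> by auto
    have "real_polynomial_function (Re \<circ> p)" "real_polynomial_function (Im \<circ> p)"
      using p(1) bounded_linear_Re bounded_linear_Im unfolding polynomial_function_def by auto
    then obtain a k b l where ab: "Re \<circ> p = (\<lambda>x. \<Sum>i\<le>k. a i * x ^ i)" "Im \<circ> p = (\<lambda>x. \<Sum>i\<le>l. b i * x ^ i)"
      unfolding real_polynomial_function_iff_sum by blast
    have pe: "p y = (\<Sum>i\<le>k. of_real (a i) * of_real y ^ i) + \<i> * (\<Sum>i\<le>l. of_real (b i) * of_real y ^ i)" for y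
    proof -
      have "p y = of_real ((Re \<circ> p) y) + \<i> * of_real ((Im \<circ> p) y)" by (simp add: complex_eq_iff)
      then show ?thesis by (simp add: ab)
    qed
    let ?Q = "\<lambda>x. 1 * (of_real (sin x) * (\<Sum>i\<le>k. of_real (a i) * of_real (cos x) ^ i))
     + \<i> * (of_real (sin x) * (\<Sum>i\<le>l. of_real (b i) * of_real (cos x) ^ i))"
    have "norm (?Q x - of_real (sin x) * g x) \<le> 1 / real (Suc n)" if "x \<in> {0<..<pi}" for x
    proof -
      have "?Q x - of_real (sin x) * g x = of_real (- sin x) * (g (arccos (cos x)) - p (cos x))"
        using that by (simp add: pe arccos_cos algebra_simps)
      then have "norm (?Q x - of_real (sin x) * g x) = \<bar>sin x\<bar> * norm (g (arccos (cos x)) - p (cos x))"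
        by (simp only: norm_mult norm_of_real abs_minus_cancel)
      also have "\<dots> \<le> 1 * (1 / real (Suc n))"
        by (intro mult_mono abs_sin_le_one less_imp_le[OF p(2)]) auto
      finally show ?thesis by simp
    qed
    moreover have "?Q \<in> sine_span" by (intro sine_span_lin sine_poly_cos_in_span)
    ultimately show "\<exists>Q. ?P n Q"
      by (intro exI[of _ ?Q] conjI ballI)
  qed
  from choice[OF this] obtain Q where Q: "\<And>n. Q n \<in> sine_span"
    and b: "\<And>n x. x \<in> {0<..<pi} \<Longrightarrow> norm (Q n x - of_real (sin x) * g x) \<le> 1 / real (Suc n)"
    by blast
  show ?thesis
  proof (rule sine_span_closed[OF Q])
    show L: "(\<lambda>x. of_real (sin x) * g x) \<in> L2" by (intro L2_continuous continuous_intros assms)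
    have Qm: "(\<lambda>x. Q n x - of_real (sin x) * g x) \<in> borel_measurable int_measure" for n
      using Q L by (intro L2_D(1) L2_diff) (auto simp: sine_span_def)
    show "(\<lambda>n. l2norm (\<lambda>x. Q n x - of_real (sin x) * g x)) \<longlonglongrightarrow> 0"
    proof (rule l2norm_dominated_convergence[OF L2_continuous[of "\<lambda>x. 1"] Qm])
      show "AE x in int_measure. norm (Q n x - of_real (sin x) * g x) \<le> norm (1::complex)" for n
      proof (rule AE_I2)
        fix x assume "x \<in> space int_measure"
        then have "norm (Q n x - of_real (sin x) * g x) \<le> 1 / real (Suc n)" by (intro b) simp
        also have "\<dots> \<le> norm (1::complex)" by simp
        finally show "norm (Q n x - of_real (sin x) * g x) \<le> norm (1::complex)" .
      qed
      show "AE x in int_measure. (\<lambda>n. Q n x - of_real (sin x) * g x) \<longlonglongrightarrow> 0"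
      proof (rule AE_I2)
        fix x assume "x \<in> space int_measure"
        then show "(\<lambda>n. Q n x - of_real (sin x) * g x) \<longlonglongrightarrow> 0"
          using b[of x] by (intro tendsto_norm_zero_cancel[OF tendsto_sandwich[OF _ _ tendsto_const LIMSEQ_inverse_real_of_nat]])
            (auto simp: divide_inverse)
      qed
    qed auto
  qed
qed

text \<open>
  Measurable functions are limits almost everywhere of continuous ones. Projecting the values onto
  the ball of radius \<open>B\<close> keeps continuity and the limit, and makes dominated convergence applicable.
\<close>
lemma bounded_measurable_continuous_approx:
  fixes h :: "real \<Rightarrow> complex"
  assumes "h \<in> borel_measurable int_measure" "0 \<le> B" "\<And>x. x \<in> {0<..<pi} \<Longrightarrow> norm (h x) \<le> B"
  obtains g where "\<And>n. continuous_on UNIV (g n)" "\<And>n x. norm (g n x) \<le> B"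
    "AE x in int_measure. (\<lambda>n. g n x) \<longlonglongrightarrow> h x"
proof -
  have "h measurable_on {0<..<pi}" using assms(1) by (simp add: measurable_on_iff_borel_measurable)
  then obtain N g where Ng: "negligible N \<and> (\<forall>n. continuous_on UNIV (g n)) \<and>
     (\<forall>x. x \<notin> N \<longrightarrow> (\<lambda>n. g n x) \<longlonglongrightarrow> (if x \<in> {0<..<pi} then h x else 0))"
    unfolding measurable_on_def by (elim exE)
  from Ng have N: "negligible N" and g: "\<And>n. continuous_on UNIV (g n)"
    and lim: "\<And>x. x \<notin> N \<Longrightarrow> (\<lambda>n. g n x) \<longlonglongrightarrow> (if x \<in> {0<..<pi} then h x else 0)"
    by blast+
  let ?P = "closest_point (cball (0::complex) B)"
  have cP: "continuous_on UNIV ?P" using assms(2) by (intro continuous_on_closest_point) auto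
  show ?thesis
  proof (rule that[of "\<lambda>n x. ?P (g n x)"])
    show "continuous_on UNIV (\<lambda>x. ?P (g n x))" for n
      by (rule continuous_on_compose2[OF cP g]) auto
    show "norm (?P (g n x)) \<le> B" for n x
      using closest_point_in_set[of "cball (0::complex) B" "g n x"] assms(2) by auto
    have "AE x in lebesgue. x \<notin> N" using N by (simp add: negligible_iff_null_sets AE_not_in)
    then have "AE x in int_measure. x \<notin> N" by (intro AE_restrict_space_iff[THEN iffD2]) auto
    moreover have "AE x in int_measure. x \<in> {0<..<pi}" by (intro AE_I2) auto
    ultimately show "AE x in int_measure. (\<lambda>n. ?P (g n x)) \<longlonglongrightarrow> h x"
    proof eventually_elim
      case (elim x)
      have "isCont ?P (h x)" using cP by (simp add: continuous_on_eq_continuous_at)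
      then have "(\<lambda>n. ?P (g n x)) \<longlonglongrightarrow> ?P (h x)" using lim[OF elim(1)] elim(2) by (auto intro: isCont_tendsto_compose)
      moreover have "?P (h x) = h x" using assms(3)[OF elim(2)] by (intro closest_point_self) auto
      ultimately show ?case by simp
    qed
  qed
qed

lemma sin_bounded_in_span:
  assumes "h \<in> borel_measurable int_measure" "0 \<le> B" "\<And>x. x \<in> {0<..<pi} \<Longrightarrow> norm (h x) \<le> B"
  shows "(\<lambda>x. of_real (sin x) * h x) \<in> sine_span"
proof -
  obtain g where g: "\<And>n. continuous_on UNIV (g n)" "\<And>n x. norm (g n x) \<le> B"
    and lim: "AE x in int_measure. (\<lambda>n. g n x) \<longlonglongrightarrow> h x"
    using bounded_measurable_continuous_approx[OF assms] by blast
  have gs: "(\<lambda>x. of_real (sin x) * g n x) \<in> sine_span" for n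
    by (intro continuous_sin_mult_in_span continuous_on_subset[OF g(1)]) auto
  have hL: "(\<lambda>x. of_real (sin x) * h x) \<in> L2"
    by (rule L2_mult_bounded[where B=1])
      (auto intro!: L2_bounded[OF assms(1,3)] measurable_continuous_Icc continuous_intros)
  show ?thesis
  proof (rule sine_span_closed[OF gs hL])
    show "(\<lambda>k. l2norm (\<lambda>x. of_real (sin x) * g k x - of_real (sin x) * h x)) \<longlonglongrightarrow> 0"
    proof (rule l2norm_dominated_convergence[OF L2_continuous[of "\<lambda>x. of_real (2 * B)"]])
      show "(\<lambda>x. of_real (sin x) * g k x - of_real (sin x) * h x) \<in> borel_measurable int_measure" for k
        using gs hL by (intro L2_D(1) L2_diff) (auto simp: sine_span_def)
      show "AE x in int_measure. norm (of_real (sin x) * g k x - of_real (sin x) * h x) \<le> norm (complex_of_real (2 * B))" for k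
      proof (rule AE_I2)
        fix x assume x: "x \<in> space int_measure"
        have "norm (of_real (sin x) * g k x - of_real (sin x) * h x) = \<bar>sin x\<bar> * norm (g k x - h x)"
          by (simp add: norm_mult flip: right_diff_distrib)
        also have "\<dots> \<le> 1 * (B + B)"
          using g(2)[of k x] assms(3)[of x] x
          by (intro mult_mono order_trans[OF norm_triangle_ineq4] add_mono) auto
        finally show "norm (of_real (sin x) * g k x - of_real (sin x) * h x) \<le> norm (complex_of_real (2 * B))"
          using assms(2) by simp
      qed
      show "AE x in int_measure. (\<lambda>n. of_real (sin x) * g n x - of_real (sin x) * h x) \<longlonglongrightarrow> 0"
        using lim by eventually_elim (auto intro!: tendsto_eq_intros)
    qed auto
  qed
qed

text \<open>
  Setting \<open>f\<close> to zero where it is large or $\sin x$ is small, on sets that shrink to the empty set,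
  leaves a function of the form $h(x) \sin x$ with \<open>h\<close> bounded.
\<close>
lemma sine_span_eq_L2: "sine_span = L2"
proof
  show "L2 \<subseteq> sine_span"
  proof
    fix f assume f: "f \<in> L2"
    note [measurable] = L2_D(1)[OF f]
    have [measurable]: "(\<lambda>x. complex_of_real (sin x)) \<in> borel_measurable int_measure"
      "(\<lambda>x. sin x) \<in> borel_measurable int_measure"
      by (intro measurable_continuous_Icc continuous_intros)+
    define G where "G n = {x. norm (f x) \<le> real n \<and> 1 / real (Suc n) \<le> sin x}" for n
    define h where "h n x = (if x \<in> G n then f x / of_real (sin x) else 0)" for n x
    have Gm [measurable]: "Measurable.pred int_measure (\<lambda>x. x \<in> G n)" for n
      unfolding G_def by simp
    have hm: "h n \<in> borel_measurable int_measure" for n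
      unfolding h_def[abs_def] by measurable
    have hB: "norm (h n x) \<le> real n * real (Suc n)" for n x
    proof (cases "x \<in> G n")
      case True
      then have a: "norm (f x) \<le> real n" "1 / real (Suc n) \<le> sin x" by (auto simp: G_def)
      then have "0 < sin x" by (smt (verit) divide_pos_pos of_nat_0_less_iff zero_less_Suc)
      have "norm (f x) / sin x \<le> real n / (1 / real (Suc n))"
        using a by (intro frac_le) auto
      then show ?thesis using True \<open>0 < sin x\<close> by (simp add: h_def norm_divide)
    qed (simp add: h_def)
    have sh: "of_real (sin x) * h n x = (if x \<in> G n then f x else 0)" for n x
    proof (cases "x \<in> G n")
      case True
      then have "0 < sin x" unfolding G_def by (smt (verit) divide_pos_pos of_nat_0_less_iff zero_less_Suc mem_Collect_eq)
      then show ?thesis using True by (simp add: h_def)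
    qed (simp add: h_def)
    have span: "(\<lambda>x. if x \<in> G n then f x else 0) \<in> sine_span" for n
      using sin_bounded_in_span[OF hm _ hB, of n] by (simp add: sh)
    show "f \<in> sine_span"
    proof (rule sine_span_closed[OF span f])
      show "(\<lambda>n. l2norm (\<lambda>x. (if x \<in> G n then f x else 0) - f x)) \<longlonglongrightarrow> 0"
      proof (rule l2norm_dominated_convergence[OF f])
        show "(\<lambda>x. (if x \<in> G n then f x else 0) - f x) \<in> borel_measurable int_measure" for n by measurable
        show "AE x in int_measure. norm ((if x \<in> G n then f x else 0) - f x) \<le> norm (f x)" for n by auto
        show "AE x in int_measure. (\<lambda>n. (if x \<in> G n then f x else 0) - f x) \<longlonglongrightarrow> 0"
        proof (rule AE_I2)
          fix x assume "x \<in> space int_measure"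
          then have s: "0 < sin x" by (auto intro: sin_gt_zero)
          obtain n0 where n0: "norm (f x) + 1 / sin x \<le> real n0" using real_arch_simple by blast
          have "x \<in> G n" if "n \<ge> n0" for n
          proof -
            have "norm (f x) + 1 / sin x \<le> real n" using n0 that by (meson of_nat_le_iff order_trans)
            moreover have "0 < 1 / sin x" using s by simp
            ultimately have "norm (f x) \<le> real n" "1 / sin x \<le> real (Suc n)"
              using norm_ge_zero[of "f x"] unfolding of_nat_Suc by linarith+
            then show ?thesis using s by (auto simp: G_def field_simps)
          qed
          then show "(\<lambda>n. (if x \<in> G n then f x else 0) - f x) \<longlonglongrightarrow> 0"
            by (intro tendsto_eventually eventually_sequentiallyI[of n0]) simp
        qed
      qed
    qed
  qed
qed (auto simp: sine_span_def)

lemma sine_sum_tendsto: "f \<in> L2 \<Longrightarrow> (\<lambda>N. l2norm (\<lambda>x. f x - sine_sum N f x)) \<longlonglongrightarrow> 0"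
  using sine_span_eq_L2 by (auto simp: sine_span_def)

lemma Parseval_sums: assumes "f \<in> L2" "h \<in> L2" shows "(\<lambda>n. coef f n * coef h n) sums pair f h"
proof -
  have "(\<lambda>N. pair (sine_sum N f) h) \<longlonglongrightarrow> pair f h"
    by (rule tendsto_pair[OF sine_sum_L2 assms])
      (use sine_sum_tendsto[OF assms(1)] in \<open>simp add: l2norm_minus_commute[of "sine_sum _ f" f]\<close>)
  moreover have "pair (sine_sum N f) h = (\<Sum>n<N. coef f n * coef h n)" for N
    unfolding sine_sum_def[abs_def]
    by (simp add: pair_sum L2_scale sine_L2 assms pair_scale coef_def pair_commute[of h])
  ultimately show ?thesis by (simp add: sums_def)
qed

lemma coef_zero_imp_AE_zero: assumes "f \<in> L2" "\<And>n. coef f n = 0" shows "AE x in int_measure. f x = 0"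
proof -
  have "(\<lambda>N. l2norm f) \<longlonglongrightarrow> 0"
    using sine_sum_tendsto[OF assms(1)] by (simp add: sine_sum_def assms(2))
  then have "l2norm f = 0" by (simp add: LIMSEQ_const_iff)
  then show ?thesis using assms(1) by (simp add: l2norm_eq_0_iff)
qed

text \<open>
  The form in which density of the sines is used: an identity between bounded linear functionals
  needs to be checked on sines only.
\<close>
lemma L2_functional_eq_0:
  fixes D :: "(real \<Rightarrow> complex) \<Rightarrow> complex"
  assumes lin: "\<And>f g a b. f \<in> L2 \<Longrightarrow> g \<in> L2 \<Longrightarrow> D (\<lambda>x. a * f x + b * g x) = a * D f + b * D g"
    and bound: "\<And>f. f \<in> L2 \<Longrightarrow> norm (D f) \<le> K * l2norm f"
    and sine: "\<And>m. D (sine m) = 0"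
    and f: "f \<in> L2"
  shows "D f = 0"
proof -
  have D_sum: "D (sine_sum N f) = 0" for N
  proof (induction N)
    case 0
    show ?case using lin[OF L2_zero L2_zero, of 0 0] by (simp add: sine_sum_def[abs_def])
  next
    case (Suc N)
    have "sine_sum (Suc N) f = (\<lambda>x. 1 * sine_sum N f x + coef f N * sine N x)"
      by (simp add: sine_sum_def fun_eq_iff)
    then show ?case using lin[OF sine_sum_L2 sine_L2, of 1 N f "coef f N" N] Suc sine by simp
  qed
  have "norm (D f) \<le> 0"
  proof (rule LIMSEQ_le_const)
    show "(\<lambda>N. K * l2norm (\<lambda>x. f x - sine_sum N f x)) \<longlonglongrightarrow> 0"
      using tendsto_mult_right_zero[OF sine_sum_tendsto[OF f]] .
    have "norm (D f) \<le> K * l2norm (\<lambda>x. f x - sine_sum N f x)" for N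
    proof -
      have "D (\<lambda>x. 1 * f x + (-1) * sine_sum N f x) = D f"
        unfolding lin[OF f sine_sum_L2] by (simp add: D_sum)
      then show ?thesis using bound[OF L2_diff[OF f sine_sum_L2], of N f] by simp
    qed
    then show "\<exists>N. \<forall>n\<ge>N. norm (D f) \<le> K * l2norm (\<lambda>x. f x - sine_sum n f x)" by blast
  qed
  then show ?thesis by simp
qed

section \<open>The domain of the Schroedinger operator\<close>

text \<open>
  The function $y^{-k} e^{-1/y}$, extended by zero to $y \le 0$. The derivatives of \<open>flat 0\<close> are
  combinations of these functions, so that smoothness follows without explicit formulas for higher
  derivatives.
\<close>
definition flat :: "nat \<Rightarrow> real \<Rightarrow> real"
  where "flat k y = (if 0 < y then (1 / y) ^ k * exp (- (1 / y)) else 0)"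

lemma flat_nonneg: "0 \<le> flat k y"
  by (simp add: flat_def)

lemma power_mult_exp_minus_le_fact: fixes z :: real assumes "0 \<le> z" shows "z ^ m * exp (- z) \<le> fact m"
proof -
  have "(\<Sum>n\<in>{m}. z ^ n /\<^sub>R fact n) \<le> exp z"
    unfolding exp_def by (rule sum_le_suminf[OF summable_exp_generic]) (use assms in auto)
  then have "z ^ m \<le> fact m * exp z" by (simp add: field_simps)
  then show ?thesis by (simp add: exp_minus field_simps)
qed

lemma flat_le_fact: "flat k y \<le> fact k"
  using power_mult_exp_minus_le_fact[of "1 / y" k] by (simp add: flat_def)

lemma flat_le_power2: "flat k y \<le> fact (k + 2) * y\<^sup>2"
proof (cases "0 < y")
  case True
  have "flat k y = flat (k + 2) y * y\<^sup>2"
    using True by (simp add: flat_def power2_eq_square field_simps power_add)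
  also have "\<dots> \<le> fact (k + 2) * y\<^sup>2" by (intro mult_right_mono flat_le_fact) auto
  finally show ?thesis .
qed (simp add: flat_def)

text \<open>
  At the origin the quadratic bound \<open>flat_le_power2\<close> forces the derivative to vanish.
\<close>
lemma flat_has_derivative: "(flat k has_real_derivative flat (k + 2) y - real k * flat (k + 1) y) (at y)"
proof (cases y "0 :: real" rule: linorder_cases)
  case less
  have "(flat k has_real_derivative 0) (at y)"
    by (rule DERIV_cong_ev[THEN iffD1, OF refl _ refl DERIV_const[of 0]])
      (use less in \<open>auto simp: flat_def eventually_nhds intro!: exI[of _ "{..<0::real}"]\<close>)
  then show ?thesis using less by (simp add: flat_def)
next
  case equal
  have "((\<lambda>h. (flat k (0 + h) - flat k 0) / h) \<longlongrightarrow> 0) (at 0)"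
  proof (rule Lim_null_comparison)
    show "\<forall>\<^sub>F h in at 0. norm ((flat k (0 + h) - flat k 0) / h) \<le> fact (k + 2) * \<bar>h\<bar>"
    proof (rule always_eventually, rule allI)
      fix h :: real
      have "flat k h / \<bar>h\<bar> \<le> fact (k + 2) * h\<^sup>2 / \<bar>h\<bar>" by (intro divide_right_mono flat_le_power2) auto
      also have "\<dots> = fact (k + 2) * \<bar>h\<bar>" by (cases "h = 0") (auto simp: power2_eq_square abs_if)
      finally show "norm ((flat k (0 + h) - flat k 0) / h) \<le> fact (k + 2) * \<bar>h\<bar>"
        by (simp add: flat_nonneg) (simp add: flat_def)
    qed
    show "((\<lambda>h. fact (k + 2) * \<bar>h\<bar>) \<longlongrightarrow> (0::real)) (at 0)" by (auto intro!: tendsto_eq_intros)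
  qed
  then have "(flat k has_real_derivative 0) (at 0)" by (simp add: DERIV_def)
  then show ?thesis using equal by (simp add: flat_def)
next
  case greater
  have "((\<lambda>y. (1 / y) ^ k * exp (- (1 / y))) has_real_derivative flat (k + 2) y - real k * flat (k + 1) y) (at y)"
  proof (cases k)
    case 0
    show ?thesis unfolding 0 using greater
      by (auto intro!: derivative_eq_intros simp: flat_def power2_eq_square)
  next
    case (Suc j)
    show ?thesis unfolding Suc using greater
      by (auto intro!: derivative_eq_intros simp: flat_def power2_eq_square divide_simps)
        (simp add: algebra_simps, cases j, auto)
  qed
  then show ?thesis
    by (rule DERIV_cong_ev[OF refl _ refl, THEN iffD1, rotated])
      (use greater in \<open>auto simp: flat_def eventually_nhds intro!: exI[of _ "{0<..}"]\<close>)
qed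

text \<open>
  An algebra of functions that is closed under differentiation; its elements are therefore
  infinitely differentiable, which makes membership in the space of test functions checkable.
\<close>
inductive_set smooth_algebra :: "(real \<Rightarrow> complex) set" where
  const: "(\<lambda>x. c) \<in> smooth_algebra"
| sin: "(\<lambda>x. of_real (sin (a * x))) \<in> smooth_algebra"
| cos: "(\<lambda>x. of_real (cos (a * x))) \<in> smooth_algebra"
| flat: "(\<lambda>x. of_real (flat k (a * x + b))) \<in> smooth_algebra"
| add: "\<phi> \<in> smooth_algebra \<Longrightarrow> \<psi> \<in> smooth_algebra \<Longrightarrow> (\<lambda>x. \<phi> x + \<psi> x) \<in> smooth_algebra"
| mult: "\<phi> \<in> smooth_algebra \<Longrightarrow> \<psi> \<in> smooth_algebra \<Longrightarrow> (\<lambda>x. \<phi> x * \<psi> x) \<in> smooth_algebra"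

lemma smooth_algebra_has_derivative:
  assumes "\<phi> \<in> smooth_algebra"
  shows "\<exists>\<psi>\<in>smooth_algebra. \<forall>x. (\<phi> has_vector_derivative \<psi> x) (at x)"
  using assms
proof induction
  case (const c)
  show ?case by (rule bexI[of _ "\<lambda>x. 0"]) (auto intro: smooth_algebra.const)
next
  case (sin a)
  have "((\<lambda>x. complex_of_real (sin (a * x))) has_vector_derivative of_real (a * cos (a * x))) (at x)" for x
    by (rule has_vector_derivative_of_real) (auto intro!: derivative_eq_intros)
  moreover have "(\<lambda>x. of_real a * of_real (cos (a * x))) \<in> smooth_algebra"
    by (intro smooth_algebra.intros)
  ultimately show ?case by (intro bexI[of _ "\<lambda>x. of_real a * of_real (cos (a * x))"]) auto
next
  case (cos a)
  have "((\<lambda>x. complex_of_real (cos (a * x))) has_vector_derivative of_real (- a * sin (a * x))) (at x)" for x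
    by (rule has_vector_derivative_of_real) (auto intro!: derivative_eq_intros)
  moreover have "(\<lambda>x. of_real (- a) * of_real (sin (a * x))) \<in> smooth_algebra"
    by (intro smooth_algebra.intros)
  ultimately show ?case by (intro bexI[of _ "\<lambda>x. of_real (- a) * of_real (sin (a * x))"]) auto
next
  case (flat k a b)
  have "((\<lambda>x. complex_of_real (flat k (a * x + b))) has_vector_derivative
     of_real ((flat (k + 2) (a * x + b) - real k * flat (k + 1) (a * x + b)) * a)) (at x)" for x
    by (rule has_vector_derivative_of_real, rule DERIV_chain2[OF flat_has_derivative])
      (auto intro!: derivative_eq_intros)
  moreover have "(\<lambda>x. of_real a * of_real (flat (k + 2) (a * x + b)) + of_real (- (a * real k)) * of_real (flat (k + 1) (a * x + b))) \<in> smooth_algebra"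
    by (intro smooth_algebra.intros)
  ultimately show ?case
    by (intro bexI[of _ "\<lambda>x. of_real a * of_real (flat (k + 2) (a * x + b)) + of_real (- (a * real k)) * of_real (flat (k + 1) (a * x + b))"])
      (auto simp: algebra_simps)
next
  case (add \<phi> \<psi>)
  then obtain \<phi>' \<psi>' where "\<phi>' \<in> smooth_algebra" "\<forall>x. (\<phi> has_vector_derivative \<phi>' x) (at x)"
    "\<psi>' \<in> smooth_algebra" "\<forall>x. (\<psi> has_vector_derivative \<psi>' x) (at x)" by blast
  then show ?case
    by (intro bexI[of _ "\<lambda>x. \<phi>' x + \<psi>' x"]) (auto intro: has_vector_derivative_add smooth_algebra.add)
next
  case (mult \<phi> \<psi>)
  then obtain \<phi>' \<psi>' where "\<phi>' \<in> smooth_algebra" "\<forall>x. (\<phi> has_vector_derivative \<phi>' x) (at x)"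
    "\<psi>' \<in> smooth_algebra" "\<forall>x. (\<psi> has_vector_derivative \<psi>' x) (at x)" by blast
  then show ?case using mult.hyps
    by (intro bexI[of _ "\<lambda>x. \<phi> x * \<psi>' x + \<phi>' x * \<psi> x"])
      (auto intro!: has_vector_derivative_mult smooth_algebra.add smooth_algebra.mult)
qed

lemma smooth_algebra_vderiv: assumes "\<phi> \<in> smooth_algebra" shows "vderiv \<phi> \<in> smooth_algebra"
proof -
  obtain \<psi> where p: "\<psi> \<in> smooth_algebra" "\<And>x. (\<phi> has_vector_derivative \<psi> x) (at x)"
    using smooth_algebra_has_derivative[OF assms] by blast
  have "vderiv \<phi> = \<psi>" unfolding vderiv_def using p(2) by (simp add: vector_derivative_at fun_eq_iff)
  then show ?thesis using p(1) by simp
qed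

lemma smooth_algebra_differentiable: assumes "\<phi> \<in> smooth_algebra" shows "(vderiv ^^ k) \<phi> differentiable (at x)"
proof -
  have "(vderiv ^^ k) \<phi> \<in> smooth_algebra"
    by (induction k) (auto simp: assms smooth_algebra_vderiv)
  then show ?thesis using smooth_algebra_has_derivative differentiableI_vector by blast
qed

text \<open>
  A smooth function supported in $[1/(k+1), \pi - 1/(k+1)]$ that tends to 1 inside the interval as
  \<open>k\<close> grows; pointwise convergence is what dominated convergence asks for.
\<close>
definition cutoff :: "nat \<Rightarrow> real \<Rightarrow> real"
  where "cutoff k x = flat 0 (real (Suc k) * x - 1) * flat 0 (real (Suc k) * (pi - x) - 1)"

lemma cutoff_smooth: "(\<lambda>x. of_real (cutoff k x)) \<in> smooth_algebra"
proof -
  have "complex_of_real (cutoff k x) = of_real (flat 0 (real (Suc k) * x + (-1))) *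
     of_real (flat 0 (- real (Suc k) * x + (real (Suc k) * pi - 1)))" for x
    unfolding cutoff_def by (simp add: algebra_simps)
  then show ?thesis
    using smooth_algebra.mult[OF smooth_algebra.flat[of 0 "real (Suc k)" "-1"]
      smooth_algebra.flat[of 0 "- real (Suc k)" "real (Suc k) * pi - 1"]] by simp
qed

lemma cutoff_bounds: "0 \<le> cutoff k x" "cutoff k x \<le> 1"
  using flat_le_fact[of 0] mult_mono[of _ 1 _ "1::real"] by (auto simp: cutoff_def flat_nonneg intro!: mult_le_one)

lemma cutoff_test_function:
  assumes "\<phi> \<in> smooth_algebra" shows "(\<lambda>x. of_real (cutoff k x) * \<phi> x) \<in> test_functions"
proof -
  let ?K = "{1 / real (Suc k) .. pi - 1 / real (Suc k)}"
  have "of_real (cutoff k x) * \<phi> x = 0" if "x \<notin> ?K" for x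
  proof -
    have "real (Suc k) * x < 1 \<or> real (Suc k) * (pi - x) < 1"
      using that by (auto simp: field_simps)
    then show ?thesis by (auto simp: cutoff_def flat_def)
  qed
  moreover have "?K \<subseteq> {0<..<pi}"
  proof
    fix x assume "x \<in> ?K"
    moreover have "0 < 1 / real (Suc k)" by simp
    ultimately show "x \<in> {0<..<pi}"
      unfolding atLeastAtMost_iff greaterThanLessThan_iff by linarith
  qed
  moreover have "compact ?K" by simp
  ultimately show ?thesis
    unfolding test_functions_def mem_Collect_eq
    by (intro conjI allI impI exI[of _ ?K] smooth_algebra_differentiable smooth_algebra.mult cutoff_smooth assms)
qed

lemma flat_at_top: "((\<lambda>y. flat k y) \<longlongrightarrow> (if k = 0 then 1 else 0)) at_top"
proof -
  have i: "((\<lambda>y::real. 1 / y) \<longlongrightarrow> 0) at_top"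
    using tendsto_inverse_0_at_top[OF filterlim_ident] by (simp add: inverse_eq_divide)
  have "((\<lambda>y::real. (1 / y) ^ k * exp (- (1 / y))) \<longlongrightarrow> 0 ^ k * exp (- 0)) at_top"
    by (intro tendsto_intros i)
  moreover have "\<forall>\<^sub>F y in at_top. (1 / y) ^ k * exp (- (1 / y)) = flat k y"
    using eventually_gt_at_top[of "0::real"] by eventually_elim (simp add: flat_def)
  ultimately show ?thesis by (auto simp: power_0_left dest: Lim_transform_eventually)
qed

lemma flat_scaled_tendsto:
  assumes "0 < x" shows "(\<lambda>n. flat k (real (Suc n) * x - 1)) \<longlonglongrightarrow> (if k = 0 then 1 else 0)"
proof (rule filterlim_compose[OF flat_at_top])
  show "filterlim (\<lambda>n. real (Suc n) * x - 1) at_top sequentially"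
  proof (rule filterlim_at_top_mono)
    show "filterlim (\<lambda>n. - 1 + x * real n) at_top sequentially"
      by (intro filterlim_tendsto_add_at_top[OF tendsto_const]
          filterlim_tendsto_pos_mult_at_top[OF tendsto_const assms filterlim_real_sequentially])
    show "\<forall>\<^sub>F n in sequentially. - 1 + x * real n \<le> real (Suc n) * x - 1"
      using assms by (intro always_eventually) (auto simp: algebra_simps)
  qed
qed

definition dsine :: "nat \<Rightarrow> real \<Rightarrow> complex"
  where "dsine n x = of_real (sqrt (2 / pi) * real n * cos (real n * x))"

lemma sine_smooth: "sine n \<in> smooth_algebra"
  using smooth_algebra.mult[OF smooth_algebra.const[of "of_real (sqrt (2 / pi))"] smooth_algebra.sin[of "real n"]]
  by (simp add: sine_def[abs_def])

lemma dsine_smooth: "dsine n \<in> smooth_algebra"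
  using smooth_algebra.mult[OF smooth_algebra.const[of "of_real (sqrt (2 / pi) * real n)"] smooth_algebra.cos[of "real n"]]
  by (simp add: dsine_def[abs_def])

lemma continuous_on_dsine [continuous_intros]: "continuous_on S (dsine n)"
  unfolding dsine_def by (intro continuous_intros)

lemma dsine_L2: "dsine n \<in> L2"
  by (intro L2_continuous continuous_intros)

lemma sine_has_derivative: "(sine n has_vector_derivative dsine n x) (at x within S)"
  unfolding sine_def[abs_def] dsine_def
  by (rule has_vector_derivative_of_real) (auto intro!: derivative_eq_intros)

lemma dsine_has_derivative: "(dsine n has_vector_derivative - (of_nat n)\<^sup>2 * sine n x) (at x within S)"
proof -
  have "(dsine n has_vector_derivative of_real (- (real n)\<^sup>2 * (sqrt (2 / pi) * sin (real n * x)))) (at x within S)"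
    unfolding dsine_def[abs_def]
    by (rule has_vector_derivative_of_real) (auto intro!: derivative_eq_intros simp: power2_eq_square)
  then show ?thesis by (simp add: sine_def)
qed

lemma test_function_has_derivative:
  assumes "\<phi> \<in> test_functions" shows "(\<phi> has_vector_derivative vderiv \<phi> x) (at x within S)"
proof -
  have "\<forall>k x. (vderiv ^^ k) \<phi> differentiable (at x)" using assms by (simp add: test_functions_def)
  from this[rule_format, of 0 x] have "\<phi> differentiable (at x)" by simp
  then show ?thesis
    unfolding vderiv_def by (auto simp: vector_derivative_works intro: has_vector_derivative_at_within)
qed

lemma test_function_continuous:
  assumes "\<phi> \<in> test_functions" shows "continuous_on S \<phi>" "continuous_on S (vderiv \<phi>)"
proof -
  have d: "\<forall>k x. (vderiv ^^ k) \<phi> differentiable (at x)" using assms by (simp add: test_functions_def)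
  from d[rule_format, of 0] show "continuous_on S \<phi>"
    by (auto intro!: continuous_at_imp_continuous_on differentiable_imp_continuous_within)
  from d[rule_format, of 1] show "continuous_on S (vderiv \<phi>)"
    by (auto intro!: continuous_at_imp_continuous_on differentiable_imp_continuous_within)
qed

lemma test_function_L2: assumes "\<phi> \<in> test_functions" shows "\<phi> \<in> L2" "vderiv \<phi> \<in> L2"
  using test_function_continuous[OF assms] by (auto intro: L2_continuous)

text \<open>
  There are no boundary terms because \<open>\<phi>\<close> vanishes at both ends, whatever \<open>s\<close> does there.
\<close>
lemma test_function_integration_by_parts:
  assumes \<phi>: "\<phi> \<in> test_functions"
    and s: "\<And>x. x \<in> {0..pi} \<Longrightarrow> (s has_vector_derivative s' x) (at x within {0..pi})"
    and s'c: "continuous_on {0..pi} s'"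
  shows "pair (vderiv \<phi>) s = - pair \<phi> s'"
proof -
  obtain K where K: "K \<subseteq> {0<..<pi}" "\<And>x. x \<notin> K \<Longrightarrow> \<phi> x = 0"
    using \<phi> by (auto simp: test_functions_def)
  have "0 \<notin> K" "pi \<notin> K" using K(1) by auto
  then have z: "\<phi> 0 = 0" "\<phi> pi = 0" by (auto intro: K(2))
  have sc: "continuous_on {0..pi} s" using s by (rule continuous_on_vector_derivative)
  note c = test_function_continuous[OF \<phi>]
  have L: "s \<in> L2" "s' \<in> L2" using sc s'c by (auto intro: L2_continuous)
  have "((\<lambda>x. \<phi> x * s' x + vderiv \<phi> x * s x) has_integral \<phi> pi * s pi - \<phi> 0 * s 0) {0..pi}"
    by (intro fundamental_theorem_of_calculus has_vector_derivative_mult test_function_has_derivative[OF \<phi>] s) auto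
  then have "integral {0..pi} (\<lambda>x. \<phi> x * s' x + vderiv \<phi> x * s x) = 0" by (simp add: z integral_unique)
  then have "(LINT x|int_measure. \<phi> x * s' x + vderiv \<phi> x * s x) = 0"
    by (subst LINT_continuous) (auto intro!: continuous_intros c sc s'c)
  then have "pair \<phi> s' + pair (vderiv \<phi>) s = 0"
    using integrable_pair[OF test_function_L2(1)[OF \<phi>] L(2)] integrable_pair[OF test_function_L2(2)[OF \<phi>] L(1)]
    by (simp add: pair_def)
  then show ?thesis by (simp add: add_eq_0_iff2)
qed

lemma weak_derivative_pair:
  "weak_derivative f g \<longleftrightarrow> (\<forall>\<phi>\<in>test_functions. pair f (vderiv \<phi>) = - pair g \<phi>)"
  by (simp add: weak_derivative_def pair_def)

lemma cutoff_tendsto: assumes "x \<in> {0<..<pi}" shows "(\<lambda>k. cutoff k x) \<longlonglongrightarrow> 1"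
  unfolding cutoff_def using assms flat_scaled_tendsto[of x 0] flat_scaled_tendsto[of "pi - x" 0]
  by (auto intro!: tendsto_eq_intros)

lemma cutoff_mult_tendsto:
  assumes "\<phi> \<in> L2"
  shows "(\<lambda>k. l2norm (\<lambda>x. of_real (cutoff k x) * \<phi> x - \<phi> x)) \<longlonglongrightarrow> 0"
proof (rule l2norm_dominated_convergence[OF assms])
  note [measurable] = L2_D(1)[OF assms]
  show "(\<lambda>x. of_real (cutoff k x) * \<phi> x - \<phi> x) \<in> borel_measurable int_measure" for k
  proof -
    have "continuous_on {0..pi} (\<lambda>x. complex_of_real (cutoff k x))"
      by (intro continuous_at_imp_continuous_on ballI differentiable_imp_continuous_within
          smooth_algebra_differentiable[OF cutoff_smooth, of 0, unfolded funpow_0])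
    from measurable_continuous_Icc[OF this] show ?thesis by measurable
  qed
  show "AE x in int_measure. norm (of_real (cutoff k x) * \<phi> x - \<phi> x) \<le> norm (\<phi> x)" for k
  proof (rule AE_I2)
    fix x
    have "of_real (cutoff k x) * \<phi> x - \<phi> x = of_real (cutoff k x - 1) * \<phi> x" by (simp add: algebra_simps)
    then have "norm (of_real (cutoff k x) * \<phi> x - \<phi> x) = \<bar>cutoff k x - 1\<bar> * norm (\<phi> x)"
      by (simp only: norm_mult norm_of_real)
    also have "\<dots> \<le> 1 * norm (\<phi> x)" using cutoff_bounds[of k x] by (intro mult_right_mono) auto
    finally show "norm (of_real (cutoff k x) * \<phi> x - \<phi> x) \<le> norm (\<phi> x)" by simp
  qed
  show "AE x in int_measure. (\<lambda>k. of_real (cutoff k x) * \<phi> x - \<phi> x) \<longlonglongrightarrow> 0"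
  proof (rule AE_I2)
    fix x assume "x \<in> space int_measure"
    then have "(\<lambda>k. complex_of_real (cutoff k x)) \<longlonglongrightarrow> of_real 1"
      by (intro tendsto_of_real cutoff_tendsto) simp
    then have "(\<lambda>k. of_real (cutoff k x) * \<phi> x - \<phi> x) \<longlonglongrightarrow> of_real 1 * \<phi> x - \<phi> x"
      by (intro tendsto_diff tendsto_mult tendsto_const)
    then show "(\<lambda>k. of_real (cutoff k x) * \<phi> x - \<phi> x) \<longlonglongrightarrow> 0" by simp
  qed
qed

definition dcutoff :: "nat \<Rightarrow> real \<Rightarrow> real"
  where "dcutoff k x = real (Suc k) * flat 2 (real (Suc k) * x - 1) * flat 0 (real (Suc k) * (pi - x) - 1)
    - real (Suc k) * flat 2 (real (Suc k) * (pi - x) - 1) * flat 0 (real (Suc k) * x - 1)"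

lemma cutoff_has_derivative: "(cutoff k has_real_derivative dcutoff k x) (at x)"
proof -
  have 1: "((\<lambda>x. flat 0 (real (Suc k) * x - 1)) has_real_derivative flat 2 (real (Suc k) * x - 1) * real (Suc k)) (at x)"
    by (rule DERIV_chain2[where f="flat 0"])
      (use flat_has_derivative[of 0 "real (Suc k) * x - 1"] in \<open>auto intro!: derivative_eq_intros simp: numeral_2_eq_2\<close>)
  have 2: "((\<lambda>x. flat 0 (real (Suc k) * (pi - x) - 1)) has_real_derivative flat 2 (real (Suc k) * (pi - x) - 1) * - real (Suc k)) (at x)"
    by (rule DERIV_chain2[where f="flat 0"])
      (use flat_has_derivative[of 0 "real (Suc k) * (pi - x) - 1"] in \<open>auto intro!: derivative_eq_intros simp: numeral_2_eq_2\<close>)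
  show ?thesis
    unfolding cutoff_def[abs_def] dcutoff_def
    by (rule DERIV_cong[OF DERIV_mult[OF 1 2]]) (simp add: algebra_simps)
qed

text \<open>
  With $z = (k+1)x - 1$ one has $k + 1 = (z+1)/x$. This trades the growing factor in the
  derivative of the cutoff for the factor $1/x$, which the zero of the sine at the boundary absorbs.
\<close>
lemma scaled_flat2_eq:
  assumes "0 < x" shows "real (Suc k) * flat 2 (real (Suc k) * x - 1)
     = (1 / x) * (flat 2 (real (Suc k) * x - 1) + flat 1 (real (Suc k) * x - 1))"
proof (cases "0 < real (Suc k) * x - 1")
  case True
  define z where "z = real (Suc k) * x - 1"
  have z: "0 < z" "real (Suc k) = (1 / x) * (z + 1)" using True assms by (auto simp: z_def field_simps)
  have "(z + 1) * flat 2 z = flat 2 z + flat 1 z" using z(1) by (simp add: flat_def power2_eq_square field_simps)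
  then show ?thesis unfolding z_def[symmetric] z(2) by simp
qed (simp add: flat_def)

lemma abs_sin_scaled_flat2_le:
  assumes "0 < x" shows "\<bar>sin (real n * x)\<bar> * (real (Suc k) * flat 2 (real (Suc k) * x - 1)) \<le> 3 * real n"
proof -
  have "\<bar>sin (real n * x)\<bar> * (real (Suc k) * flat 2 (real (Suc k) * x - 1)) \<le> (real n * x) * ((1 / x) * (2 + 1))"
    unfolding scaled_flat2_eq[OF assms]
    using assms flat_le_fact[of 2 "real (Suc k) * x - 1"] flat_le_fact[of 1 "real (Suc k) * x - 1"] abs_sin_x_le_abs_x[of "real n * x"]
    by (intro mult_mono mult_left_mono add_mono mult_nonneg_nonneg add_nonneg_nonneg flat_nonneg) (auto simp: numeral_2_eq_2)
  also have "\<dots> = 3 * real n" using assms by simp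
  finally show ?thesis .
qed

lemma scaled_flat2_tendsto: assumes "0 < x" shows "(\<lambda>k. real (Suc k) * flat 2 (real (Suc k) * x - 1)) \<longlonglongrightarrow> 0"
  unfolding scaled_flat2_eq[OF assms]
  using flat_scaled_tendsto[OF assms, of 2] flat_scaled_tendsto[OF assms, of 1] assms by (auto intro!: tendsto_eq_intros)

lemma abs_dcutoff_mult_sin_le:
  assumes "x \<in> {0<..<pi}" shows "\<bar>dcutoff k x\<bar> * \<bar>sin (real n * x)\<bar> \<le> 6 * real n"
proof -
  have s: "\<bar>sin (real n * (pi - x))\<bar> = \<bar>sin (real n * x)\<bar>"
    by (simp add: right_diff_distrib sin_diff abs_mult)
  let ?A = "real (Suc k) * flat 2 (real (Suc k) * x - 1)" and ?B = "real (Suc k) * flat 2 (real (Suc k) * (pi - x) - 1)"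
  have A: "0 \<le> ?A" "0 \<le> ?B" by (simp_all add: flat_nonneg)
  have f: "flat 0 y \<le> 1" for y using flat_le_fact[of 0 y] by simp
  have "\<bar>dcutoff k x\<bar> \<le> ?A * 1 + ?B * 1"
    unfolding dcutoff_def using A
    by (intro order_trans[OF abs_triangle_ineq4] add_mono) (auto simp: abs_mult flat_nonneg intro!: mult_left_mono mult_right_mono f mult_left_le)
  then have "\<bar>dcutoff k x\<bar> * \<bar>sin (real n * x)\<bar> \<le> (?A + ?B) * \<bar>sin (real n * x)\<bar>" by (intro mult_right_mono) auto
  also have "\<dots> = \<bar>sin (real n * x)\<bar> * ?A + \<bar>sin (real n * (pi - x))\<bar> * ?B" unfolding s by (simp add: algebra_simps)
  also have "\<dots> \<le> 3 * real n + 3 * real n"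
    using assms by (intro add_mono abs_sin_scaled_flat2_le) auto
  finally show ?thesis by simp
qed

lemma dcutoff_tendsto: assumes "x \<in> {0<..<pi}" shows "(\<lambda>k. dcutoff k x) \<longlonglongrightarrow> 0"
proof -
  have x: "0 < x" "0 < pi - x" using assms by auto
  have f0: "(\<lambda>k. flat 0 (real (Suc k) * y - 1)) \<longlonglongrightarrow> 1" if "0 < y" for y
    using flat_scaled_tendsto[OF that, of 0] by simp
  have "(\<lambda>k. dcutoff k x) \<longlonglongrightarrow> 0 * 1 - 0 * 1"
    unfolding dcutoff_def by (intro tendsto_diff tendsto_mult[of _ 0] scaled_flat2_tendsto f0 x)
  then show ?thesis by simp
qed

definition cut_sine :: "nat \<Rightarrow> nat \<Rightarrow> real \<Rightarrow> complex"
  where "cut_sine n k x = of_real (cutoff k x) * sine n x"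

lemma cut_sine_test: "cut_sine n k \<in> test_functions"
  unfolding cut_sine_def[abs_def] by (rule cutoff_test_function[OF sine_smooth])

lemma vderiv_cut_sine: "vderiv (cut_sine n k) x = of_real (cutoff k x) * dsine n x + of_real (dcutoff k x) * sine n x"
  unfolding vderiv_def cut_sine_def[abs_def]
  by (intro vector_derivative_at has_vector_derivative_mult has_vector_derivative_of_real cutoff_has_derivative sine_has_derivative)

text \<open>
  The cutoff has a derivative of size $k$ at distance $1/k$ from the boundary, where the sine is of
  size $1/k$. So the error is bounded uniformly and tends to 0 pointwise, and dominated convergence
  applies.
\<close>
lemma vderiv_cut_sine_tendsto: "(\<lambda>k. l2norm (\<lambda>x. vderiv (cut_sine n k) x - dsine n x)) \<longlonglongrightarrow> 0"
proof (rule l2norm_dominated_convergence)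
  let ?c = "sqrt (2 / pi)"
  let ?B = "complex_of_real (?c * real n + 6 * real n * ?c)"
  show "(\<lambda>x. ?B) \<in> L2" by (intro L2_continuous continuous_intros)
  show "(\<lambda>x. vderiv (cut_sine n k) x - dsine n x) \<in> borel_measurable int_measure" for k
    by (intro measurable_continuous_Icc continuous_intros test_function_continuous cut_sine_test)
  have e: "vderiv (cut_sine n k) x - dsine n x = of_real (cutoff k x - 1) * dsine n x + of_real (dcutoff k x) * sine n x" for k x
    by (simp add: vderiv_cut_sine algebra_simps)
  show "AE x in int_measure. norm (vderiv (cut_sine n k) x - dsine n x) \<le> norm ?B" for k
  proof (rule AE_I2)
    fix x assume "x \<in> space int_measure"
    then have x: "x \<in> {0<..<pi}" by simp
    have "norm (vderiv (cut_sine n k) x - dsine n x) \<le> \<bar>cutoff k x - 1\<bar> * norm (dsine n x) + \<bar>dcutoff k x\<bar> * norm (sine n x)"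
      unfolding e by (rule order_trans[OF norm_triangle_ineq]) (simp only: norm_mult norm_of_real order_refl)
    also have "norm (sine n x) = \<bar>sin (real n * x)\<bar> * ?c" unfolding sine_def norm_of_real by (simp add: abs_mult)
    also have "\<bar>dcutoff k x\<bar> * (\<bar>sin (real n * x)\<bar> * ?c) \<le> 6 * real n * ?c"
      using mult_right_mono[OF abs_dcutoff_mult_sin_le[OF x, of k n], of ?c] by (simp only: mult.assoc) simp
    also have "\<bar>cutoff k x - 1\<bar> * norm (dsine n x) \<le> 1 * (?c * real n)"
    proof (intro mult_mono)
      show "\<bar>cutoff k x - 1\<bar> \<le> 1" using cutoff_bounds[of k x] by auto
      have "norm (dsine n x) = ?c * real n * \<bar>cos (real n * x)\<bar>" unfolding dsine_def norm_of_real by (simp add: abs_mult)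
      also have "\<dots> \<le> ?c * real n * 1" by (intro mult_left_mono abs_cos_le_one) auto
      finally show "norm (dsine n x) \<le> ?c * real n" by simp
    qed auto
    also have "1 * (?c * real n) + 6 * real n * ?c = norm ?B" unfolding norm_of_real by simp
    finally show "norm (vderiv (cut_sine n k) x - dsine n x) \<le> norm ?B" by simp
  qed
  show "AE x in int_measure. (\<lambda>k. vderiv (cut_sine n k) x - dsine n x) \<longlonglongrightarrow> 0"
  proof (rule AE_I2)
    fix x assume "x \<in> space int_measure"
    then have x: "x \<in> {0<..<pi}" by simp
    have "(\<lambda>k. of_real (cutoff k x - 1) * dsine n x + of_real (dcutoff k x) * sine n x) \<longlonglongrightarrow>
        of_real (1 - 1) * dsine n x + of_real 0 * sine n x"
      by (intro tendsto_intros cutoff_tendsto dcutoff_tendsto x)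
    then show "(\<lambda>k. vderiv (cut_sine n k) x - dsine n x) \<longlonglongrightarrow> 0" unfolding e by simp
  qed
qed

lemma cut_sine_tendsto: "(\<lambda>k. l2norm (\<lambda>x. cut_sine n k x - sine n x)) \<longlonglongrightarrow> 0"
  unfolding cut_sine_def by (rule cutoff_mult_tendsto[OF sine_L2])

lemma weak_derivative_sine: "weak_derivative (sine n) (dsine n)"
  unfolding weak_derivative_pair
  using test_function_integration_by_parts[OF _ sine_has_derivative continuous_on_dsine] by (simp add: pair_commute)

lemma weak_derivative_dsine: "weak_derivative (dsine n) (\<lambda>x. - (of_nat n)\<^sup>2 * sine n x)"
  unfolding weak_derivative_pair
proof
  fix \<phi> assume "\<phi> \<in> test_functions"
  then show "pair (dsine n) (vderiv \<phi>) = - pair (\<lambda>x. - (of_nat n)\<^sup>2 * sine n x) \<phi>"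
    using test_function_integration_by_parts[OF _ dsine_has_derivative, of \<phi> n]
    by (simp add: pair_commute continuous_intros)
qed

lemma sine_H10: "sine n \<in> H10"
  unfolding H10_def
  using sine_L2 dsine_L2 weak_derivative_sine cut_sine_test cut_sine_tendsto vderiv_cut_sine_tendsto by blast

text \<open>
  The sines satisfy the Dirichlet condition in the sense of approximability by test functions; the
  cut-off sines are the approximating sequence.
\<close>
lemma sine_schrodinger_op:
  assumes "V \<in> borel_measurable int_measure" "\<And>x. x \<in> {0<..<pi} \<Longrightarrow> norm (V x) \<le> B"
  shows "(sine n, \<lambda>x. (of_nat n)\<^sup>2 * sine n x + V x * sine n x) \<in> schrodinger_op V"
proof -
  have L: "(\<lambda>x. - (of_nat n)\<^sup>2 * sine n x) \<in> L2" by (intro L2_scale sine_L2)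
  have "(\<lambda>x. (of_nat n)\<^sup>2 * sine n x + V x * sine n x) \<in> L2"
    by (intro L2_add L2_scale sine_L2 L2_mult_bounded[OF _ assms])
  moreover have "sine n \<in> H2"
    unfolding H2_def using sine_L2 dsine_L2 L weak_derivative_sine weak_derivative_dsine by blast
  moreover have "\<exists>f1\<in>L2. \<exists>f2\<in>L2. weak_derivative (sine n) f1 \<and> weak_derivative f1 f2 \<and>
       (AE x in int_measure. (of_nat n)\<^sup>2 * sine n x + V x * sine n x = - f2 x + V x * sine n x)"
    by (rule bexI[OF _ dsine_L2[of n]], rule bexI[OF _ L])
      (simp add: weak_derivative_sine weak_derivative_dsine[simplified])
  ultimately show ?thesis
    unfolding schrodinger_op_def using sine_H10 by simp
qed

text \<open>
  Two integrations by parts move $-\partial_x^2$ onto the sine. In the first, the sine vanishes at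
  the boundary, in the second \<open>g\<close> does; each vanishing is available only through approximation by
  test functions.
\<close>
lemma coef_schrodinger_op:
  assumes V: "V \<in> borel_measurable int_measure" "\<And>x. x \<in> {0<..<pi} \<Longrightarrow> norm (V x) \<le> B"
    and gh: "(g, h) \<in> schrodinger_op V"
  shows "coef h n = (of_nat n)\<^sup>2 * coef g n + coef (\<lambda>x. V x * g x) n"
proof -
  obtain f1 f2 where f: "f1 \<in> L2" "f2 \<in> L2" "weak_derivative g f1" "weak_derivative f1 f2"
    and h: "AE x in int_measure. h x = - f2 x + V x * g x" and gH: "g \<in> H10" and hL: "h \<in> L2"
    using gh unfolding schrodinger_op_def by auto
  obtain g1 \<phi> where gL: "g \<in> L2" and g1: "g1 \<in> L2" "weak_derivative g g1" and \<phi>: "\<And>k. \<phi> k \<in> test_functions"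
    and lim0: "(\<lambda>k. l2norm (\<lambda>x. \<phi> k x - g x)) \<longlonglongrightarrow> 0"
    and lim1: "(\<lambda>k. l2norm (\<lambda>x. vderiv (\<phi> k) x - g1 x)) \<longlonglongrightarrow> 0"
    using gH unfolding H10_def by auto
  have L: "(\<lambda>x. - (of_nat n)\<^sup>2 * sine n x) \<in> L2" by (intro L2_scale sine_L2)
  have "pair g1 (dsine n) = (of_nat n)\<^sup>2 * coef g n"
  proof (rule LIMSEQ_unique)
    show "(\<lambda>k. pair (vderiv (\<phi> k)) (dsine n)) \<longlonglongrightarrow> pair g1 (dsine n)"
      by (intro tendsto_pair test_function_L2 \<phi> g1 dsine_L2 lim1)
    have "(\<lambda>k. - pair (\<phi> k) (\<lambda>x. - (of_nat n)\<^sup>2 * sine n x)) \<longlonglongrightarrow> - pair g (\<lambda>x. - (of_nat n)\<^sup>2 * sine n x)"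
      by (intro tendsto_minus tendsto_pair test_function_L2 \<phi> gL L lim0)
    moreover have "pair (vderiv (\<phi> k)) (dsine n) = - pair (\<phi> k) (\<lambda>x. - (of_nat n)\<^sup>2 * sine n x)" for k
      by (rule test_function_integration_by_parts[OF \<phi> dsine_has_derivative]) (intro continuous_intros)
    moreover have "- pair g (\<lambda>x. - (of_nat n)\<^sup>2 * sine n x) = (of_nat n)\<^sup>2 * coef g n"
      unfolding pair_commute[of g] pair_scale coef_def by simp
    ultimately show "(\<lambda>k. pair (vderiv (\<phi> k)) (dsine n)) \<longlonglongrightarrow> (of_nat n)\<^sup>2 * coef g n" by simp
  qed
  \<comment> \<open>Both functions are weak derivatives of \<open>g\<close>, one from $H^2$ and one from $H^1_0$. They agree when
    tested against the cosine, which test functions approximate in $L^2$.\<close>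
  moreover have "pair f1 (dsine n) = pair g1 (dsine n)"
  proof (rule LIMSEQ_unique)
    let ?\<psi> = "\<lambda>k x. of_real (cutoff k x) * dsine n x"
    have t: "?\<psi> k \<in> test_functions" for k by (rule cutoff_test_function[OF dsine_smooth])
    have l: "(\<lambda>k. pair (?\<psi> k) F) \<longlonglongrightarrow> pair (dsine n) F" if "F \<in> L2" for F
      by (intro tendsto_pair test_function_L2(1)[OF t] dsine_L2 that cutoff_mult_tendsto)
    show "(\<lambda>k. pair (?\<psi> k) f1) \<longlonglongrightarrow> pair f1 (dsine n)" using l[OF f(1)] by (simp add: pair_commute)
    have "pair f1 (?\<psi> k) = pair g1 (?\<psi> k)" for k
      using f(3) g1(2) t[of k] unfolding weak_derivative_pair by (metis neg_equal_iff_equal)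
    then show "(\<lambda>k. pair (?\<psi> k) f1) \<longlonglongrightarrow> pair g1 (dsine n)" using l[OF g1(1)] by (simp add: pair_commute)
  qed
  moreover have "pair f1 (dsine n) = - pair f2 (sine n)"
  proof (rule LIMSEQ_unique)
    show "(\<lambda>k. pair (vderiv (cut_sine n k)) f1) \<longlonglongrightarrow> pair f1 (dsine n)"
      unfolding pair_commute[of f1]
      by (intro tendsto_pair test_function_L2 cut_sine_test dsine_L2 f vderiv_cut_sine_tendsto)
    have "(\<lambda>k. - pair (cut_sine n k) f2) \<longlonglongrightarrow> - pair f2 (sine n)"
      unfolding pair_commute[of f2]
      by (intro tendsto_minus tendsto_pair test_function_L2 cut_sine_test sine_L2 f cut_sine_tendsto)
    moreover have "pair (vderiv (cut_sine n k)) f1 = - pair (cut_sine n k) f2" for k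
      using f(4) cut_sine_test unfolding weak_derivative_pair by (simp add: pair_commute)
    ultimately show "(\<lambda>k. pair (vderiv (cut_sine n k)) f1) \<longlonglongrightarrow> - pair f2 (sine n)" by simp
  qed
  moreover have "coef h n = - pair f2 (sine n) + coef (\<lambda>x. V x * g x) n"
  proof -
    have VL: "(\<lambda>x. V x * g x) \<in> L2" by (rule L2_mult_bounded[OF gL V])
    have "coef h n = pair (\<lambda>x. (-1) * f2 x + V x * g x) (sine n)"
      unfolding coef_def using h by (intro pair_cong_AE hL L2_add L2_scale f VL sine_L2) simp
    also have "\<dots> = - pair f2 (sine n) + coef (\<lambda>x. V x * g x) n"
      using pair_add[OF L2_scale[OF f(2), of "-1"] VL sine_L2, of n] pair_scale[of "-1" f2 "sine n"] by (simp add: coef_def)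
    finally show ?thesis .
  qed
  ultimately show ?thesis by simp
qed

section \<open>Oscillatory sums off resonance\<close>

text \<open>
  Since $n + m \ge \max(m, |n-m|)$ for $n \ne m$, one has
  $|n^2-m^2| = |n-m| (n+m) \ge |n-m|^{5/4} m^{3/4}$. The exponents leave a summable power of
  $|n-m|$ and a square summable power of $m$; the maximum with 1 covers $m = 0$.
\<close>
lemma sum_recip_square_diff_le:
  "(\<Sum>n | n < M \<and> n \<noteq> m. 1 / \<bar>(real n)\<^sup>2 - (real m)\<^sup>2\<bar>)
     \<le> 2 * (\<Sum>k. real k powr (-5/4)) * max 1 (real m) powr (-3/4)"
proof -
  let ?g = "\<lambda>k. real k powr (-5/4)"
  have sg: "summable ?g" by (simp add: summable_real_powr_iff)
  have each: "1 / \<bar>(real n)\<^sup>2 - (real m)\<^sup>2\<bar> \<le> \<bar>real n - real m\<bar> powr (-5/4) * max 1 (real m) powr (-3/4)"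
    if "n \<noteq> m" for n
  proof -
    define D where "D = \<bar>real n - real m\<bar>"
    define S where "S = real n + real m"
    define P where "P = max 1 (real m)"
    have D: "1 \<le> D" "D \<le> S" using that by (auto simp: D_def S_def)
    have P: "1 \<le> P" "P \<le> S" using that by (auto simp: P_def S_def)
    have "D powr (5/4) * P powr (3/4) = D * (D powr (1/4) * P powr (3/4))"
      using D powr_add[of D 1 "1/4"] by simp
    also have "\<dots> \<le> D * (S powr (1/4) * S powr (3/4))"
      using D P by (intro mult_left_mono mult_mono powr_mono2) auto
    also have "S powr (1/4) * S powr (3/4) = S"
      using D powr_add[of S "1/4" "3/4"] by simp
    also have "D * S = \<bar>(real n)\<^sup>2 - (real m)\<^sup>2\<bar>"
      unfolding D_def S_def by (simp add: power2_eq_square abs_mult square_diff_square_factored)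
    finally have "1 / \<bar>(real n)\<^sup>2 - (real m)\<^sup>2\<bar> \<le> 1 / (D powr (5/4) * P powr (3/4))"
      using D P by (intro frac_le) auto
    also have "\<dots> = D powr (-5/4) * P powr (-3/4)"
      by (simp add: powr_minus field_simps)
    finally show ?thesis by (simp add: D_def P_def)
  qed
  have "(\<Sum>n | n < M \<and> n \<noteq> m. \<bar>real n - real m\<bar> powr (-5/4))
      \<le> (\<Sum>n\<in>{..<m} \<union> {m<..<M}. \<bar>real n - real m\<bar> powr (-5/4))"
    by (intro sum_mono2) auto
  also have "\<dots> = (\<Sum>n\<in>{..<m}. \<bar>real n - real m\<bar> powr (-5/4)) + (\<Sum>n\<in>{m<..<M}. \<bar>real n - real m\<bar> powr (-5/4))"
    by (intro sum.union_disjoint) auto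
  also have "(\<Sum>n\<in>{..<m}. \<bar>real n - real m\<bar> powr (-5/4)) = sum ?g ((\<lambda>n. m - n) ` {..<m})"
    by (subst sum.reindex) (auto simp: inj_on_def of_nat_diff intro!: sum.cong)
  also have "\<dots> \<le> suminf ?g" by (intro sum_le_suminf sg) auto
  also have "(\<Sum>n\<in>{m<..<M}. \<bar>real n - real m\<bar> powr (-5/4)) = sum ?g ((\<lambda>n. n - m) ` {m<..<M})"
    by (subst sum.reindex) (auto simp: inj_on_def of_nat_diff intro!: sum.cong)
  also have "\<dots> \<le> suminf ?g" by (intro sum_le_suminf sg) auto
  finally have "(\<Sum>n | n < M \<and> n \<noteq> m. \<bar>real n - real m\<bar> powr (-5/4)) \<le> 2 * suminf ?g" by simp
  then have "(\<Sum>n | n < M \<and> n \<noteq> m. \<bar>real n - real m\<bar> powr (-5/4)) * max 1 (real m) powr (-3/4)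
     \<le> 2 * suminf ?g * max 1 (real m) powr (-3/4)"
    by (intro mult_right_mono) auto
  moreover have "(\<Sum>n | n < M \<and> n \<noteq> m. 1 / \<bar>(real n)\<^sup>2 - (real m)\<^sup>2\<bar>)
     \<le> (\<Sum>n | n < M \<and> n \<noteq> m. \<bar>real n - real m\<bar> powr (-5/4) * max 1 (real m) powr (-3/4))"
    by (intro sum_mono each) auto
  ultimately show ?thesis by (simp add: sum_distrib_right)
qed

lemma sum_mult_le_of_square_sums:
  fixes f g :: "nat \<Rightarrow> real"
  assumes "(\<Sum>i\<in>I. (f i)\<^sup>2) \<le> A\<^sup>2" "(\<Sum>i\<in>I. (g i)\<^sup>2) \<le> B\<^sup>2" "0 \<le> A" "0 \<le> B"
  shows "(\<Sum>i\<in>I. \<bar>f i\<bar> * \<bar>g i\<bar>) \<le> A * B"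
proof -
  have "(\<Sum>i\<in>I. \<bar>f i\<bar> * \<bar>g i\<bar>) \<le> L2_set f I * L2_set g I" by (rule L2_set_mult_ineq)
  also have "\<dots> \<le> A * B"
    using assms unfolding L2_set_def by (intro mult_mono real_le_lsqrt) (auto simp: sum_nonneg)
  finally show ?thesis .
qed

text \<open>
  Minkowski's inequality for the norm in $\ell^2$ of an integral. With $\alpha$ the sequence of the
  integrals, the Cauchy-Schwarz inequality under the integral bounds $|\alpha|^2$ by
  $tK |\alpha|$.
\<close>
lemma sum_square_integral_le:
  fixes h :: "nat \<Rightarrow> real \<Rightarrow> complex"
  assumes "0 \<le> t" "0 \<le> K" "\<And>n. continuous_on {0..t} (h n)"
    and "\<And>s. s \<in> {0..t} \<Longrightarrow> (\<Sum>n<N. (norm (h n s))\<^sup>2) \<le> K\<^sup>2"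
  shows "(\<Sum>n<N. (integral {0..t} (\<lambda>s. norm (h n s)))\<^sup>2) \<le> (t * K)\<^sup>2"
proof -
  define a where "a n = integral {0..t} (\<lambda>s. norm (h n s))" for n
  have int: "(\<lambda>s. norm (h n s)) integrable_on {0..t}" for n
    by (intro integrable_continuous_interval continuous_intros assms(3))
  define A where "A = sqrt (\<Sum>n<N. (a n)\<^sup>2)"
  have A0: "0 \<le> A" by (simp add: A_def sum_nonneg)
  have AA: "A\<^sup>2 = (\<Sum>n<N. (a n)\<^sup>2)" by (simp add: A_def sum_nonneg)
  have a0: "0 \<le> a n" for n unfolding a_def by (intro Henstock_Kurzweil_Integration.integral_nonneg int) auto
  have "A\<^sup>2 = (\<Sum>n<N. integral {0..t} (\<lambda>s. a n * norm (h n s)))"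
    unfolding AA by (simp add: power2_eq_square a_def)
  also have "\<dots> = integral {0..t} (\<lambda>s. \<Sum>n<N. a n * norm (h n s))"
    by (subst Henstock_Kurzweil_Integration.integral_sum) (auto intro!: integrable_on_mult_right int)
  also have "\<dots> \<le> integral {0..t} (\<lambda>s. A * K)"
  proof (rule Henstock_Kurzweil_Integration.integral_le)
    show "(\<lambda>s. \<Sum>n<N. a n * norm (h n s)) integrable_on {0..t}"
      by (auto intro!: integrable_sum integrable_on_mult_right int)
    fix s assume "s \<in> {0..t}"
    then show "(\<Sum>n<N. a n * norm (h n s)) \<le> A * K"
      using sum_mult_le_of_square_sums[of a "{..<N}" A "\<lambda>n. norm (h n s)" K] assms A0 AA a0 by simp
  qed auto
  also have "\<dots> = t * K * A" using assms by simp
  finally have "A * A \<le> t * K * A" by (simp add: power2_eq_square)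
  then have "A \<le> t * K"
    using A0 assms by (cases "A = 0") (auto intro: mult_right_le_imp_le)
  then have "A\<^sup>2 \<le> (t * K)\<^sup>2" using A0 by (rule power_mono)
  then show ?thesis unfolding AA a_def .
qed

text \<open>
  Integration by parts in time: the antiderivative of the phase is smaller by the factor
  $1/|\omega|$.
\<close>
lemma oscillatory_integral_le:
  fixes c r :: "real \<Rightarrow> complex"
  assumes "0 \<le> t" "\<omega> \<noteq> 0" "continuous_on {0..t} r"
    and der: "\<And>s. s \<in> {0..t} \<Longrightarrow> (c has_vector_derivative r s) (at s within {0..t})"
  shows "norm (integral {0..t} (\<lambda>s. exp (\<i> * of_real \<omega> * of_real s) * c s))
     \<le> (norm (c t) + norm (c 0) + integral {0..t} (\<lambda>s. norm (r s))) / \<bar>\<omega>\<bar>"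
proof -
  let ?e = "\<lambda>s. exp (\<i> * of_real \<omega> * of_real s)"
  let ?F = "\<lambda>s. ?e s * c s / (\<i> * of_real \<omega>)"
  have cc: "continuous_on {0..t} c"
    using der by (rule continuous_on_vector_derivative)
  have ne: "norm (?e s) = 1" for s by (simp add: norm_exp_eq_Re)
  have ed: "(?e has_vector_derivative \<i> * of_real \<omega> * ?e s) (at s within {0..t})" for s
    by (rule has_vector_derivative_real_field | auto intro!: derivative_eq_intros)+
  have hF: "((\<lambda>s. ?e s * c s + ?e s * r s / (\<i> * of_real \<omega>)) has_integral ?F t - ?F 0) {0..t}"
  proof (rule fundamental_theorem_of_calculus[OF assms(1)])
    fix s assume s: "s \<in> {0..t}"
    have "(?F has_vector_derivative (?e s * r s + \<i> * of_real \<omega> * ?e s * c s) / (\<i> * of_real \<omega>)) (at s within {0..t})"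
      by (intro has_vector_derivative_divide has_vector_derivative_mult ed der s)
    also have "(?e s * r s + \<i> * of_real \<omega> * ?e s * c s) / (\<i> * of_real \<omega>) = ?e s * c s + ?e s * r s / (\<i> * of_real \<omega>)"
      using assms(2) by (simp add: field_simps)
    finally show "(?F has_vector_derivative ?e s * c s + ?e s * r s / (\<i> * of_real \<omega>)) (at s within {0..t})" .
  qed
  have i1: "(\<lambda>s. ?e s * c s) integrable_on {0..t}"
    and i2: "(\<lambda>s. ?e s * r s / (\<i> * of_real \<omega>)) integrable_on {0..t}"
    by (intro integrable_continuous_interval continuous_intros cc assms; use assms in simp)+
  have tri: "norm (x - y - z) \<le> norm x + norm y + norm z" for x y z :: complex
    using norm_triangle_ineq4[of "x - y" z] norm_triangle_ineq4[of x y] by linarith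
  have "integral {0..t} (\<lambda>s. ?e s * c s) = ?F t - ?F 0 - integral {0..t} (\<lambda>s. ?e s * r s / (\<i> * of_real \<omega>))"
    using integral_unique[OF hF] Henstock_Kurzweil_Integration.integral_add[OF i1 i2] by (simp only: eq_diff_eq)
  also have "norm \<dots> \<le> norm (?F t) + norm (?F 0) + norm (integral {0..t} (\<lambda>s. ?e s * r s / (\<i> * of_real \<omega>)))"
    by (rule tri)
  also have "norm (integral {0..t} (\<lambda>s. ?e s * r s / (\<i> * of_real \<omega>))) \<le> integral {0..t} (\<lambda>s. norm (r s) / \<bar>\<omega>\<bar>)"
    by (intro integral_norm_bound_integral integrable_continuous_interval continuous_intros assms)
      (use assms in \<open>auto simp: norm_mult norm_divide ne\<close>)
  finally show ?thesis by (simp add: norm_mult norm_divide ne add_divide_distrib)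
qed

text \<open>
  The summability argument in isolation. The frequencies $n^2 - m^2$ vanish on the diagonal only.
  Off the diagonal, integration by parts and the bound for $\sum_n 1/|n^2-m^2|$ give absolute
  convergence of the double sum; on the diagonal the square summability of $W_{nn}$ takes the place
  of oscillation.
\<close>
lemma summable_off_resonance:
  fixes c r :: "nat \<Rightarrow> real \<Rightarrow> complex" and W :: "nat \<Rightarrow> nat \<Rightarrow> complex"
  assumes t: "0 \<le> t" and K: "0 \<le> K" and B: "0 \<le> B"
    and der: "\<And>n s. s \<in> {0..t} \<Longrightarrow> (c n has_vector_derivative r n s) (at s within {0..t})"
    and rcont: "\<And>n. continuous_on {0..t} (r n)"
    and cK: "\<And>s N. s \<in> {0..t} \<Longrightarrow> (\<Sum>n<N. (norm (c n s))\<^sup>2) \<le> K\<^sup>2"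
    and rK: "\<And>s N. s \<in> {0..t} \<Longrightarrow> (\<Sum>n<N. (norm (r n s))\<^sup>2) \<le> K\<^sup>2"
    and W: "\<And>n N. (\<Sum>m<N. (norm (W n m))\<^sup>2) \<le> B\<^sup>2"
    and Wdiag: "\<And>N. (\<Sum>n<N. (norm (W n n))\<^sup>2) \<le> B\<^sup>2"
    and expand: "\<And>n s. s \<in> {0..t} \<Longrightarrow>
      (\<lambda>m. W n m * (exp (\<i> * of_real ((real n)\<^sup>2 - (real m)\<^sup>2) * of_real s) * c m s)) sums r n s"
  shows "summable (\<lambda>n. norm (c n t - c n 0))"
proof -
  let ?e = "\<lambda>n m s. exp (\<i> * of_real ((real n)\<^sup>2 - (real m)\<^sup>2) * of_real s) :: complex"
  have ne: "norm (?e n m s) = 1" for n m s by (simp add: norm_exp_eq_Re)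
  have cc: "continuous_on {0..t} (c n)" for n
    using der by (rule continuous_on_vector_derivative)
  define I where "I n m = integral {0..t} (\<lambda>s. ?e n m s * c m s)" for n m
  define b where "b m = norm (c m t) + norm (c m 0) + integral {0..t} (\<lambda>s. norm (r m s))" for m
  define d where "d n = integral {0..t} (\<lambda>s. norm (c n s))" for n
  have int: "(\<lambda>s. norm (f s)) integrable_on {0..t}" if "continuous_on {0..t} f" for f :: "real \<Rightarrow> complex"
    by (intro integrable_continuous_interval continuous_intros that)
  have b0: "0 \<le> b m" for m
    unfolding b_def by (intro add_nonneg_nonneg Henstock_Kurzweil_Integration.integral_nonneg int rcont) auto
  have d0: "0 \<le> d m" for m
    unfolding d_def by (intro Henstock_Kurzweil_Integration.integral_nonneg int cc) auto
  have WB: "norm (W n m) \<le> B" for n m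
  proof -
    have "(norm (W n m))\<^sup>2 \<le> (\<Sum>m<Suc m. (norm (W n m))\<^sup>2)" by (intro member_le_sum) auto
    then have "(norm (W n m))\<^sup>2 \<le> B\<^sup>2" using W[where n=n and N="Suc m"] by linarith
    then show ?thesis using B by (rule power2_le_imp_le)
  qed
  \<comment> \<open>The rows of \<open>W\<close> and the vector \<open>c\<close> are in $\ell^2$, so the partial sums are uniformly bounded
    and dominated convergence justifies integrating the series term by term.\<close>
  have lim: "(\<lambda>N. \<Sum>m<N. W n m * I n m) \<longlonglongrightarrow> c n t - c n 0" for n
  proof -
    let ?f = "\<lambda>N s. \<Sum>m<N. W n m * (?e n m s * c m s)"
    have ci: "(\<lambda>s. W n m * (?e n m s * c m s)) integrable_on {0..t}" for m
      by (intro integrable_continuous_interval continuous_intros cc)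
    have "(\<lambda>N. integral {0..t} (?f N)) \<longlonglongrightarrow> integral {0..t} (r n)"
    proof (rule dominated_convergence(2))
      show "?f N integrable_on {0..t}" for N by (intro integrable_sum ci) auto
      show "(\<lambda>s. B * K) integrable_on {0..t}" by auto
      fix s assume s: "s \<in> {0..t}"
      then show "(\<lambda>N. ?f N s) \<longlonglongrightarrow> r n s" using expand by (simp add: sums_def)
      have "norm (?f N s) \<le> (\<Sum>m<N. norm (W n m * (?e n m s * c m s)))" for N by (rule norm_sum)
      also have "\<dots> N \<le> B * K" for N
        using sum_mult_le_of_square_sums[OF W[where n=n and N=N] cK[OF s, of N] B K] by (simp add: norm_mult ne)
      finally show "norm (?f N s) \<le> B * K" for N .
    qed
    moreover have "integral {0..t} (?f N) = (\<Sum>m<N. W n m * I n m)" for N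
      by (subst Henstock_Kurzweil_Integration.integral_sum) (use ci in \<open>simp_all add: I_def\<close>)
    moreover have "integral {0..t} (r n) = c n t - c n 0"
      using der by (intro integral_unique fundamental_theorem_of_calculus t)
    ultimately show ?thesis by simp
  qed
  have Idiag: "norm (I n n) \<le> d n" for n
    unfolding I_def d_def
    by (intro integral_norm_bound_integral integrable_continuous_interval continuous_intros cc)
      (auto simp: norm_mult)
  have Ioff: "norm (I n m) \<le> b m * (1 / \<bar>(real n)\<^sup>2 - (real m)\<^sup>2\<bar>)" if "n \<noteq> m" for n m
    using oscillatory_integral_le[OF t, of "(real n)\<^sup>2 - (real m)\<^sup>2" "r m" "c m"] that rcont der
    by (simp add: I_def b_def)
  define P where "P m = max 1 (real m) powr (-3/4)" for m
  define Q where "Q = sqrt (1 + (\<Sum>m. real m powr (-3/2)))"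
  have Q0: "0 \<le> (\<Sum>m. real m powr (-3/2))"
    by (intro suminf_nonneg) (auto simp: summable_real_powr_iff)
  have PQ: "(\<Sum>m<N. (P m)\<^sup>2) \<le> Q\<^sup>2" for N
  proof -
    have "(P m)\<^sup>2 = max 1 (real m) powr (-3/2)" for m
      unfolding P_def power2_eq_square by (simp add: powr_add[symmetric])
    then have "(P m)\<^sup>2 = (if m = 0 then 1 else 0) + real m powr (-3/2)" for m
      by (cases "m = 0") (auto simp: max_def)
    then have "(\<Sum>m<N. (P m)\<^sup>2) = (\<Sum>m<N. if m = 0 then 1 else 0) + (\<Sum>m<N. real m powr (-3/2))"
      by (simp add: sum.distrib)
    also have "\<dots> \<le> 1 + (\<Sum>m. real m powr (-3/2))"
      by (intro add_mono sum_le_suminf) (auto simp: summable_real_powr_iff sum.delta)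
    finally show ?thesis using Q0 by (simp add: Q_def)
  qed
  have bK: "(\<Sum>m<N. (b m)\<^sup>2) \<le> (K + K + t * K)\<^sup>2" for N
  proof -
    have "L2_set b {..<N} \<le> L2_set (\<lambda>m. norm (c m t)) {..<N} + L2_set (\<lambda>m. norm (c m 0)) {..<N}
        + L2_set (\<lambda>m. integral {0..t} (\<lambda>s. norm (r m s))) {..<N}"
      unfolding b_def by (intro order_trans[OF L2_set_triangle_ineq] add_mono L2_set_triangle_ineq) auto
    also have "\<dots> \<le> K + K + t * K"
      unfolding L2_set_def
      using cK[of t N] cK[of 0 N] sum_square_integral_le[OF t K rcont rK, of N] K t
      by (intro add_mono real_le_lsqrt) (auto simp: sum_nonneg)
    finally have "(L2_set b {..<N})\<^sup>2 \<le> (K + K + t * K)\<^sup>2" by (intro power_mono) auto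
    then show ?thesis by (simp add: L2_set_def sum_nonneg)
  qed
  define Z where "Z = 2 * (\<Sum>k. real k powr (-5/4))"
  have Z0: "0 \<le> Z" unfolding Z_def by (intro mult_nonneg_nonneg suminf_nonneg) (auto simp: summable_real_powr_iff)
  have Q0': "0 \<le> Q" using Q0 by (simp add: Q_def)
  define C where "C = B * (t * K) + B * (Z * ((K + K + t * K) * Q))"
  \<comment> \<open>Both sums are finite at this point, so that they may be interchanged; the bound does not depend
    on \<open>M\<close> and \<open>N\<close>.\<close>
  have bound: "(\<Sum>n<M. norm (\<Sum>m<N. W n m * I n m)) \<le> C" for M N
  proof -
    have "norm (\<Sum>m<N. W n m * I n m) \<le> norm (W n n) * d n
      + (\<Sum>m | m < N \<and> n \<noteq> m. B * (b m * (1 / \<bar>(real n)\<^sup>2 - (real m)\<^sup>2\<bar>)))" for n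
    proof -
      have "norm (\<Sum>m<N. W n m * I n m) \<le> (\<Sum>m<N. norm (W n m) * norm (I n m))"
        by (rule order_trans[OF norm_sum]) (simp add: norm_mult)
      also have "\<dots> \<le> (\<Sum>m\<in>insert n {m. m < N \<and> n \<noteq> m}. norm (W n m) * norm (I n m))"
        by (intro sum_mono2) auto
      also have "\<dots> = norm (W n n) * norm (I n n) + (\<Sum>m | m < N \<and> n \<noteq> m. norm (W n m) * norm (I n m))"
        by (subst sum.insert) auto
      also have "\<dots> \<le> norm (W n n) * d n
          + (\<Sum>m | m < N \<and> n \<noteq> m. B * (b m * (1 / \<bar>(real n)\<^sup>2 - (real m)\<^sup>2\<bar>)))"
        by (intro add_mono sum_mono mult_mono mult_left_mono Idiag Ioff WB) (auto simp: B)
      finally show ?thesis .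
    qed
    then have "(\<Sum>n<M. norm (\<Sum>m<N. W n m * I n m)) \<le> (\<Sum>n<M. norm (W n n) * d n
      + (\<Sum>m | m < N \<and> n \<noteq> m. B * (b m * (1 / \<bar>(real n)\<^sup>2 - (real m)\<^sup>2\<bar>))))" by (intro sum_mono)
    also have "\<dots> = (\<Sum>n<M. norm (W n n) * d n)
       + (\<Sum>n<M. \<Sum>m | m < N \<and> n \<noteq> m. B * (b m * (1 / \<bar>(real n)\<^sup>2 - (real m)\<^sup>2\<bar>)))"
      by (rule sum.distrib)
    also have "(\<Sum>n<M. \<Sum>m | m < N \<and> n \<noteq> m. B * (b m * (1 / \<bar>(real n)\<^sup>2 - (real m)\<^sup>2\<bar>)))
       = (\<Sum>m<N. \<Sum>n | n < M \<and> n \<noteq> m. B * (b m * (1 / \<bar>(real n)\<^sup>2 - (real m)\<^sup>2\<bar>)))"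
      using sum.swap_restrict[of "{..<M}" "{..<N}" "\<lambda>n m. B * (b m * (1 / \<bar>(real n)\<^sup>2 - (real m)\<^sup>2\<bar>))" "\<lambda>n m. n \<noteq> m"]
      by (simp only: finite_lessThan lessThan_iff simp_thms)
    also have "\<dots> = (\<Sum>m<N. B * (b m * (\<Sum>n | n < M \<and> n \<noteq> m. 1 / \<bar>(real n)\<^sup>2 - (real m)\<^sup>2\<bar>)))"
      by (simp add: sum_distrib_left)
    also have "\<dots> \<le> (\<Sum>m<N. B * (b m * (Z * P m)))"
      using sum_recip_square_diff_le unfolding Z_def P_def
      by (intro sum_mono mult_left_mono b0 B)
    also have "\<dots> = B * (Z * (\<Sum>m<N. \<bar>b m\<bar> * \<bar>P m\<bar>))"
      by (simp add: sum_distrib_left b0 P_def mult_ac)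
    also have "\<dots> \<le> B * (Z * ((K + K + t * K) * Q))"
      using K t Q0' by (intro mult_left_mono sum_mult_le_of_square_sums bK PQ B Z0) auto
    also have "(\<Sum>n<M. norm (W n n) * d n) \<le> B * (t * K)"
      using sum_mult_le_of_square_sums[OF Wdiag[of M] sum_square_integral_le[OF t K cc cK, of M] B] t K d0
      by (simp add: d_def)
    finally show ?thesis by (simp add: C_def)
  qed
  show ?thesis
  proof (rule summableI_nonneg_bounded)
    fix M
    have "(\<lambda>N. \<Sum>n<M. norm (\<Sum>m<N. W n m * I n m)) \<longlonglongrightarrow> (\<Sum>n<M. norm (c n t - c n 0))"
      by (intro tendsto_intros lim)
    then show "(\<Sum>n<M. norm (c n t - c n 0)) \<le> C"
      by (rule LIMSEQ_le_const2) (use bound in auto)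
  qed auto
qed

section \<open>Local boundedness of strongly continuous semigroups\<close>

lemma C0_semigroup_L2: "C0_semigroup T \<Longrightarrow> 0 \<le> t \<Longrightarrow> f \<in> L2 \<Longrightarrow> T t f \<in> L2"
  by (simp add: C0_semigroup_def)

lemma C0_semigroup_lin:
  assumes "C0_semigroup T" "0 \<le> t" "f \<in> L2" "g \<in> L2"
  shows "AE x in int_measure. T t (\<lambda>y. a * f y + b * g y) x = a * T t f x + b * T t g x"
  using assms by (simp add: C0_semigroup_def)

lemma C0_semigroup_bounded:
  assumes "C0_semigroup T" "0 \<le> t"
  obtains C where "0 \<le> C" "\<And>f. f \<in> L2 \<Longrightarrow> l2norm (T t f) \<le> C * l2norm f"
proof -
  obtain C where C: "\<forall>f\<in>L2. l2norm (T t f) \<le> C * l2norm f"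
    using assms unfolding C0_semigroup_def by meson
  show ?thesis
  proof (rule that[of "max 0 C"])
    fix f assume "f \<in> L2"
    then have "l2norm (T t f) \<le> C * l2norm f" using C by blast
    also have "\<dots> \<le> max 0 C * l2norm f" by (intro mult_right_mono) auto
    finally show "l2norm (T t f) \<le> max 0 C * l2norm f" .
  qed simp
qed

lemma C0_semigroup_0: "C0_semigroup T \<Longrightarrow> f \<in> L2 \<Longrightarrow> AE x in int_measure. T 0 f x = f x"
  by (simp add: C0_semigroup_def)

lemma C0_semigroup_add:
  "C0_semigroup T \<Longrightarrow> 0 \<le> s \<Longrightarrow> 0 \<le> t \<Longrightarrow> f \<in> L2 \<Longrightarrow> AE x in int_measure. T (s + t) f x = T s (T t f) x"
  by (simp add: C0_semigroup_def)

lemma C0_semigroup_tendsto: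
  "C0_semigroup T \<Longrightarrow> f \<in> L2 \<Longrightarrow> ((\<lambda>t. l2norm (\<lambda>x. T t f x - f x)) \<longlongrightarrow> 0) (at_right 0)"
  by (simp add: C0_semigroup_def)

lemma C0_semigroup_scale:
  assumes "C0_semigroup T" "0 \<le> t" "f \<in> L2"
  shows "AE x in int_measure. T t (\<lambda>y. a * f y) x = a * T t f x"
  using C0_semigroup_lin[OF assms(1,2,3,3), of a 0] by simp

lemma C0_semigroup_diff:
  assumes "C0_semigroup T" "0 \<le> t" "f \<in> L2" "g \<in> L2"
  shows "AE x in int_measure. T t (\<lambda>y. f y - g y) x = T t f x - T t g x"
  using C0_semigroup_lin[OF assms, of 1 "-1"] by simp

lemma l2norm_semigroup_scale:
  assumes "C0_semigroup T" "0 \<le> t" "f \<in> L2"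
  shows "l2norm (T t (\<lambda>y. a * f y)) = norm a * l2norm (T t f)"
  using l2norm_cong_AE[OF C0_semigroup_L2[OF assms(1,2) L2_scale[OF assms(3)]]
      L2_scale[OF C0_semigroup_L2[OF assms]] C0_semigroup_scale[OF assms, of a]]
  by (simp add: l2norm_scale)

text \<open>
  The supremum that defines the norm of \<open>T t\<close> need not be attained. The factor 4/3 leaves room for
  the geometric series in the gliding hump argument below.
\<close>
lemma near_optimal_vector:
  assumes T: "C0_semigroup T" and t: "0 \<le> t" and A: "0 \<le> A"
    and f: "f \<in> L2" "A * l2norm f < l2norm (T t f)"
  shows "\<exists>y\<in>L2. l2norm y \<le> 1 \<and> A < l2norm (T t y) \<and>
    (\<forall>g\<in>L2. l2norm (T t g) \<le> 4 / 3 * l2norm (T t y) * l2norm g)"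
proof -
  obtain C where C: "0 \<le> C" "\<And>f. f \<in> L2 \<Longrightarrow> l2norm (T t f) \<le> C * l2norm f"
    using C0_semigroup_bounded[OF T t] by blast
  define S where "S = {l2norm (T t g) | g. g \<in> L2 \<and> l2norm g \<le> 1}"
  have unit: "l2norm (\<lambda>y. of_real (1 / l2norm g) * g y) = 1" "l2norm (T t (\<lambda>y. of_real (1 / l2norm g) * g y)) = l2norm (T t g) / l2norm g"
    if "g \<in> L2" "0 < l2norm g" for g
    unfolding l2norm_scale l2norm_semigroup_scale[OF T t that(1)] norm_of_real using that by simp_all
  have ratio: "l2norm (T t g) / l2norm g \<in> S" if "g \<in> L2" "0 < l2norm g" for g
  proof -
    have "(\<lambda>y. of_real (1 / l2norm g) * g y) \<in> L2" by (intro L2_scale that)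
    then show ?thesis unfolding S_def mem_Collect_eq
      by (intro exI[of _ "\<lambda>y. of_real (1 / l2norm g) * g y"] conjI) (simp_all only: unit[OF that] order_refl)
  qed
  have bdd: "bdd_above S"
  proof (rule bdd_aboveI[of _ C])
    fix v assume "v \<in> S"
    then obtain g where g: "g \<in> L2" "l2norm g \<le> 1" "v = l2norm (T t g)" by (auto simp: S_def)
    have "v \<le> C * l2norm g" using C(2) g by simp
    also have "\<dots> \<le> C * 1" using g C by (intro mult_left_mono) auto
    finally show "v \<le> C" by simp
  qed
  have f0: "0 < l2norm f"
  proof (rule ccontr)
    assume "\<not> 0 < l2norm f"
    then have "l2norm f = 0" using l2norm_nonneg[of f] by linarith
    then show False using C(2)[OF f(1)] f(2) by simp
  qed
  define s where "s = Sup S"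
  have le_s: "v \<le> s" if "v \<in> S" for v unfolding s_def using that bdd by (rule cSup_upper)
  have "A < l2norm (T t f) / l2norm f" using f f0 by (simp add: field_simps)
  also have "\<dots> \<le> s" by (rule le_s[OF ratio[OF f(1) f0]])
  finally have "A < s" .
  then have "max A (3 / 4 * s) < Sup S" using A by (simp add: s_def)
  then obtain v where "v \<in> S" and v: "max A (3 / 4 * s) < v"
    using less_cSup_iff[OF _ bdd] ratio[OF f(1) f0] by blast
  then obtain y where y: "y \<in> L2" "l2norm y \<le> 1" "v = l2norm (T t y)" by (auto simp: S_def)
  have "l2norm (T t g) \<le> 4 / 3 * l2norm (T t y) * l2norm g" if "g \<in> L2" for g
  proof (cases "l2norm g = 0")
    case True
    then show ?thesis using C(2)[OF that] by simp
  next
    case False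
    then have g: "0 < l2norm g" using l2norm_nonneg[of g] by linarith
    have "l2norm (T t g) / l2norm g \<le> 4 / 3 * v" using le_s[OF ratio[OF that g]] v by linarith
    then show ?thesis using g y by (simp add: field_simps)
  qed
  then show ?thesis using y v by (intro bexI[of _ y]) auto
qed

text \<open>
  The uniform boundedness principle, by a gliding hump. If the norms were unbounded near time 0,
  choose times $t_n \to 0$ with $\|T(t_n)\|$ larger than a multiple of $n 3^n$, and add up vectors
  of size $3^{-n}$ that almost attain these norms, each with a sign for which \<open>T (t n)\<close> maps the new
  partial sum to a vector at least as large as the image of the new term. All later terms together
  are at most half as large as the \<open>n\<close>-th one, so $\|T(t_n) X\| \ge n$ holds for the limit \<open>X\<close>. This contradicts strong continuity at 0.
\<close>
lemma C0_semigroup_bounded_near_0: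
  assumes T: "C0_semigroup T"
  shows "\<exists>\<delta>>0. \<exists>C. \<forall>t\<in>{0..\<delta>}. \<forall>f\<in>L2. l2norm (T t f) \<le> C * l2norm f"
proof (rule ccontr)
  assume neg: "\<not> ?thesis"
  define hump where "hump n t y \<longleftrightarrow> 0 \<le> t \<and> t \<le> 1 / real (Suc n) \<and> y \<in> L2 \<and> l2norm y \<le> 1 \<and>
    3 * 3 ^ n * real n < l2norm (T t y) \<and>
    (\<forall>g\<in>L2. l2norm (T t g) \<le> 4 / 3 * l2norm (T t y) * l2norm g)" for n t y
  have "\<forall>n. \<exists>t. \<exists>y. hump n t y"
  proof
    fix n
    have "0 < 1 / real (Suc n)" by simp
    then have "\<not> (\<forall>t\<in>{0..1 / real (Suc n)}. \<forall>f\<in>L2. l2norm (T t f) \<le> (3 * 3 ^ n * real n) * l2norm f)"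
      using neg by blast
    then obtain t f where t: "0 \<le> t" "t \<le> 1 / real (Suc n)"
      and f: "f \<in> L2" "(3 * 3 ^ n * real n) * l2norm f < l2norm (T t f)"
      by (auto simp: not_le)
    have "0 \<le> (3 * 3 ^ n * real n :: real)" by simp
    from near_optimal_vector[OF T t(1) this f] t
    show "\<exists>t. \<exists>y. hump n t y" unfolding hump_def by blast
  qed
  from choice[OF this] obtain t where "\<forall>n. \<exists>y. hump n (t n) y" by (rule exE)
  from choice[OF this] obtain y where ty: "\<forall>n. hump n (t n) (y n)" by (rule exE)
  have t0: "0 \<le> t n" and t1: "t n \<le> 1 / real (Suc n)" and yL: "y n \<in> L2" and y1: "l2norm (y n) \<le> 1"
    and big: "3 * 3 ^ n * real n < l2norm (T (t n) (y n))"
    and opt: "\<And>g. g \<in> L2 \<Longrightarrow> l2norm (T (t n) g) \<le> 4 / 3 * l2norm (T (t n) (y n)) * l2norm g" for n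
    using ty unfolding hump_def by blast+
  define q where "q n = complex_of_real ((1 / 3) ^ n)" for n :: nat
  have nq: "norm (q n) = (1 / 3) ^ n" for n unfolding q_def norm_of_real by simp
  define step where "step n z = (if norm (q n) * l2norm (T (t n) (y n)) \<le> l2norm (T (t n) (\<lambda>x. z x + q n * y n x))
     then (\<lambda>x. z x + q n * y n x) else (\<lambda>x. z x - q n * y n x))" for n z
  define x where "x = rec_nat (\<lambda>_. 0) step"
  have x0: "x 0 = (\<lambda>_. 0)" and xS: "x (Suc n) = step n (x n)" for n by (simp_all add: x_def)
  have qL: "(\<lambda>x. q n * y n x) \<in> L2" for n by (intro L2_scale yL)
  have xL: "x n \<in> L2" for n
    by (induction n) (auto simp: x0 xS step_def L2_zero L2_add L2_diff qL)
  \<comment> \<open>By $2\|Ty\| \le \|T(x+y)\| + \|T(x-y)\|$ one of the two signs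
    works.\<close>
  have large: "norm (q n) * l2norm (T (t n) (y n)) \<le> l2norm (T (t n) (x (Suc n)))" for n
  proof (cases "norm (q n) * l2norm (T (t n) (y n)) \<le> l2norm (T (t n) (\<lambda>z. x n z + q n * y n z))")
    case True
    then show ?thesis by (simp add: xS step_def)
  next
    case False
    let ?p = "\<lambda>z. x n z + q n * y n z" and ?m = "\<lambda>z. x n z - q n * y n z"
    have pm: "?p \<in> L2" "?m \<in> L2" by (intro L2_add L2_diff xL qL)+
    have TL: "T (t n) ?p \<in> L2" "T (t n) ?m \<in> L2" by (intro C0_semigroup_L2[OF T t0] pm)+
    have "(\<lambda>z. ?p z - ?m z) = (\<lambda>z. (2 * q n) * y n z)" by (auto simp: algebra_simps)
    then have "2 * (norm (q n) * l2norm (T (t n) (y n))) = l2norm (T (t n) (\<lambda>z. ?p z - ?m z))"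
      by (simp add: l2norm_semigroup_scale[OF T t0 yL] norm_mult del: add_diff_cancel_left)
    also have "\<dots> = l2norm (\<lambda>z. T (t n) ?p z - T (t n) ?m z)"
      by (intro l2norm_cong_AE C0_semigroup_diff[OF T t0] C0_semigroup_L2[OF T t0] L2_diff TL pm)
    also have "\<dots> \<le> l2norm (T (t n) ?p) + l2norm (T (t n) ?m)" by (intro l2norm_triangle_diff TL)
    finally have "norm (q n) * l2norm (T (t n) (y n)) \<le> l2norm (T (t n) ?m)" using False by linarith
    then show ?thesis using False by (simp add: xS step_def)
  qed
  have inc: "l2norm (\<lambda>z. x (Suc n) z - x n z) \<le> (1 / 3) ^ n" for n
  proof -
    have "l2norm (\<lambda>z. x (Suc n) z - x n z) = norm (q n) * l2norm (y n)"
      using l2norm_scale[of "q n" "y n"] l2norm_scale[of "- q n" "y n"] by (auto simp: xS step_def)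
    also have "\<dots> \<le> (1 / 3) ^ n * 1" unfolding nq by (intro mult_left_mono y1) auto
    finally show ?thesis by simp
  qed
  have geo: "(\<Sum>k. (1 / 3 :: real) ^ (k + n)) = 3 / 2 * (1 / 3) ^ n" for n
    by (simp add: power_add suminf_mult2[symmetric] summable_geometric suminf_geometric)
  obtain X where X: "X \<in> L2" "\<And>n. l2norm (\<lambda>z. X z - x n z) \<le> 3 / 2 * (1 / 3) ^ n"
    using L2_complete[of x "\<lambda>n. (1 / 3) ^ n", OF xL inc summable_geometric] unfolding geo by auto
  have TX: "real n \<le> l2norm (T (t n) X)" for n
  proof -
    let ?d = "\<lambda>z. X z - x (Suc n) z" and ?A = "l2norm (T (t n) (y n))"
    have d: "?d \<in> L2" by (intro L2_diff X xL)
    have L: "T (t n) X \<in> L2" "T (t n) ?d \<in> L2" "T (t n) (x (Suc n)) \<in> L2" by (intro C0_semigroup_L2[OF T t0] X d xL)+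
    have "AE z in int_measure. T (t n) (x (Suc n)) z = T (t n) X z - T (t n) ?d z"
      using C0_semigroup_diff[OF T t0 X(1) xL, of n "Suc n"] by eventually_elim simp
    then have "l2norm (T (t n) (x (Suc n))) \<le> l2norm (T (t n) X) + l2norm (T (t n) ?d)"
      using l2norm_cong_AE[OF L(3) L2_diff[OF L(1,2)]] l2norm_triangle_diff[OF L(1,2)] by simp
    moreover have "l2norm (T (t n) ?d) \<le> 4 / 3 * ?A * (3 / 2 * (1 / 3) ^ Suc n)"
      using opt[OF d, of n] X(2)[of "Suc n"] mult_left_mono[of "l2norm ?d" "3 / 2 * (1 / 3) ^ Suc n" "4 / 3 * ?A"] by simp
    moreover have "(1 / 3) ^ n * ?A \<le> l2norm (T (t n) (x (Suc n)))" using large[of n] unfolding nq .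
    moreover have "4 / 3 * ?A * (3 / 2 * (1 / 3) ^ Suc n) = 2 / 3 * ((1 / 3) ^ n * ?A)" by simp
    ultimately have "(1 / 3) ^ n * ?A / 3 \<le> l2norm (T (t n) X)" by linarith
    moreover have "real n \<le> (1 / 3) ^ n * ?A / 3"
      using mult_left_mono[OF less_imp_le[OF big[of n]], of "(1 / 3) ^ n / 3"] by (simp add: field_simps power_one_over)
    ultimately show ?thesis by simp
  qed
  have "\<forall>\<^sub>F h in at_right 0. l2norm (\<lambda>x. T h X x - X x) < 1"
    by (rule order_tendstoD[OF C0_semigroup_tendsto[OF T X(1)]]) simp
  then obtain b where b: "0 < b" "\<And>h. 0 < h \<Longrightarrow> h < b \<Longrightarrow> l2norm (\<lambda>x. T h X x - X x) < 1"
    by (auto simp: eventually_at_right_field)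
  obtain n0 :: nat where n0: "1 / b < real n0" using reals_Archimedean2 by blast
  obtain n1 :: nat where n1: "l2norm X + 1 < real n1" using reals_Archimedean2 by blast
  define n where "n = max n0 n1"
  have "1 / real (Suc n) < b"
  proof -
    have "1 / b < real (Suc n)" using n0 by (simp add: n_def)
    then show ?thesis using b(1) by (simp add: field_simps)
  qed
  then have tn: "t n < b" using t1[of n] by simp
  have "l2norm (T (t n) X) \<le> l2norm X + 1"
  proof (cases "t n = 0")
    case True
    then show ?thesis
      using l2norm_cong_AE[OF C0_semigroup_L2[OF T t0 X(1)] X(1), of n] C0_semigroup_0[OF T X(1)] by simp
  next
    case False
    then have "l2norm (\<lambda>x. T (t n) X x - X x) < 1" using b(2) tn t0[of n] by simp
    moreover have "l2norm (T (t n) X) \<le> l2norm (\<lambda>x. T (t n) X x - X x) + l2norm X"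
      using l2norm_triangle[OF L2_diff[OF C0_semigroup_L2[OF T t0 X(1)] X(1)] X(1), of n] by simp
    ultimately show ?thesis by simp
  qed
  then show False using TX[of n] n1 by (simp add: n_def)
qed

lemma C0_semigroup_locally_bounded:
  assumes T: "C0_semigroup T"
  obtains C where "0 \<le> C" "\<And>t f. t \<in> {0..\<tau>} \<Longrightarrow> f \<in> L2 \<Longrightarrow> l2norm (T t f) \<le> C * l2norm f"
proof -
  obtain \<delta> C0 where d: "0 < \<delta>" and C0: "\<forall>t\<in>{0..\<delta>}. \<forall>f\<in>L2. l2norm (T t f) \<le> C0 * l2norm f"
    using C0_semigroup_bounded_near_0[OF T] by blast
  define C where "C = max 1 C0"
  have C: "l2norm (T t f) \<le> C * l2norm f" if "t \<in> {0..\<delta>}" "f \<in> L2" for t f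
  proof -
    have "l2norm (T t f) \<le> C0 * l2norm f" using C0 that by blast
    also have "\<dots> \<le> C * l2norm f" by (intro mult_right_mono) (auto simp: C_def)
    finally show ?thesis .
  qed
  have C1: "1 \<le> C" by (simp add: C_def)
  have n: "l2norm (T t f) \<le> C ^ Suc n * l2norm f" if "t \<in> {0..real n * \<delta>}" "f \<in> L2" for n t f
    using that
  proof (induction n arbitrary: t)
    case 0
    then show ?case using C[of t f] d by simp
  next
    case (Suc n)
    show ?case
    proof (cases "t \<le> \<delta>")
      case True
      then have "l2norm (T t f) \<le> C * l2norm f" using C Suc.prems by simp
      also have "\<dots> \<le> C ^ Suc (Suc n) * l2norm f"
        using C1 by (intro mult_right_mono self_le_power) auto
      finally show ?thesis .
    next
      case False
      then have s: "0 \<le> t - \<delta>" "t - \<delta> \<in> {0..real n * \<delta>}" using Suc.prems by (auto simp: algebra_simps)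
      have L: "T (t - \<delta>) f \<in> L2" by (intro C0_semigroup_L2[OF T s(1)] Suc.prems)
      have "0 \<le> \<delta>" using d by simp
      have "l2norm (T t f) = l2norm (T \<delta> (T (t - \<delta>) f))"
        using C0_semigroup_add[OF T \<open>0 \<le> \<delta>\<close> s(1) Suc.prems(2)] Suc.prems
        by (intro l2norm_cong_AE C0_semigroup_L2[OF T] L) (use d in auto)
      also have "\<dots> \<le> C * l2norm (T (t - \<delta>) f)" by (intro C L) (use d in auto)
      also have "\<dots> \<le> C * (C ^ Suc n * l2norm f)"
        using C1 by (intro mult_left_mono Suc.IH s Suc.prems) auto
      finally show ?thesis by simp
    qed
  qed
  obtain n :: nat where "\<tau> / \<delta> < real n" using reals_Archimedean2 by blast
  then have "\<tau> \<le> real n * \<delta>" using d by (simp add: field_simps)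
  then show ?thesis using that[of "C ^ Suc n"] n C1 by auto
qed

section \<open>The Schroedinger flow in sine coefficients\<close>

lemma C0_semigroup_commute:
  assumes T: "C0_semigroup T" and "0 \<le> s" "0 \<le> t" "f \<in> L2"
  shows "AE x in int_measure. T s (T t f) x = T t (T s f) x"
proof -
  have "AE x in int_measure. T (s + t) f x = T s (T t f) x"
    using assms by (intro C0_semigroup_add)
  moreover have "AE x in int_measure. T (t + s) f x = T t (T s f) x"
    using assms by (intro C0_semigroup_add)
  ultimately show ?thesis by eventually_elim (simp add: add.commute)
qed

lemma C0_semigroup_increment:
  assumes T: "C0_semigroup T" and t: "0 \<le> t" and h: "0 \<le> h" and f: "f \<in> L2"
  shows "l2norm (\<lambda>x. T (t + h) f x - T t f x) = l2norm (T t (\<lambda>x. T h f x - f x))"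
proof (rule l2norm_cong_AE)
  have L: "T h f \<in> L2" "T t f \<in> L2" by (intro C0_semigroup_L2[OF T] t h f)+
  show "(\<lambda>x. T (t + h) f x - T t f x) \<in> L2"
    using t h by (intro L2_diff L C0_semigroup_L2[OF T] f) auto
  show "T t (\<lambda>x. T h f x - f x) \<in> L2" by (intro C0_semigroup_L2[OF T] L2_diff t L f)
  show "AE x in int_measure. T (t + h) f x - T t f x = T t (\<lambda>x. T h f x - f x) x"
    using C0_semigroup_add[OF T t h f] C0_semigroup_diff[OF T t L(1) f]
    by eventually_elim simp
qed

text \<open>
  Local boundedness turns right continuity at 0 into two-sided continuity:
  $\|T(s)f - T(t)f\| \le C \|T(|s-t|)f - f\|$.
\<close>
lemma orbit_uniformly_continuous:
  assumes T: "C0_semigroup T" and f: "f \<in> L2" and e: "0 < \<epsilon>"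
  shows "\<exists>d>0. \<forall>s\<in>{0..\<tau>}. \<forall>t\<in>{0..\<tau>}. \<bar>s - t\<bar> < d \<longrightarrow> l2norm (\<lambda>x. T s f x - T t f x) \<le> \<epsilon>"
proof -
  obtain C where C: "0 \<le> C" "\<And>t f. t \<in> {0..\<tau>} \<Longrightarrow> f \<in> L2 \<Longrightarrow> l2norm (T t f) \<le> C * l2norm f"
    using C0_semigroup_locally_bounded[OF T] by blast
  have "\<forall>\<^sub>F h in at_right 0. l2norm (\<lambda>x. T h f x - f x) < \<epsilon> / (C + 1)"
    using e C(1) by (intro order_tendstoD[OF C0_semigroup_tendsto[OF T f]]) auto
  then obtain d where d: "0 < d" "\<And>h. 0 < h \<Longrightarrow> h < d \<Longrightarrow> l2norm (\<lambda>x. T h f x - f x) < \<epsilon> / (C + 1)"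
    by (auto simp: eventually_at_right_field)
  have main: "l2norm (\<lambda>x. T s f x - T t f x) \<le> \<epsilon>"
    if "s \<in> {0..\<tau>}" "t \<in> {0..\<tau>}" "t < s" "s - t < d" for s t
  proof -
    have t: "0 \<le> t" "0 \<le> s - t" using that by auto
    have "l2norm (\<lambda>x. T s f x - T t f x) = l2norm (T t (\<lambda>x. T (s - t) f x - f x))"
      using C0_semigroup_increment[OF T t f] by simp
    also have "\<dots> \<le> C * l2norm (\<lambda>x. T (s - t) f x - f x)"
      by (intro C that L2_diff C0_semigroup_L2[OF T] t f)
    also have "\<dots> \<le> C * (\<epsilon> / (C + 1))"
      using d(2)[of "s - t"] that C(1) by (intro mult_left_mono) auto
    also have "\<dots> \<le> \<epsilon>" using C(1) e by (simp add: field_simps)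
    finally show ?thesis .
  qed
  have "l2norm (\<lambda>x. T s f x - T t f x) \<le> \<epsilon>" if "s \<in> {0..\<tau>}" "t \<in> {0..\<tau>}" "\<bar>s - t\<bar> < d" for s t
  proof (cases s t rule: linorder_cases)
    case less
    then show ?thesis using main[of t s] that l2norm_minus_commute[of "T s f" "T t f"] by auto
  next
    case greater
    then show ?thesis using main[of s t] that by auto
  qed (use e in simp)
  then show ?thesis using d(1) by blast
qed

lemma pair_orbit_continuous:
  assumes T: "C0_semigroup T" and f: "f \<in> L2" and h: "h \<in> L2"
  shows "continuous_on {0..\<tau>} (\<lambda>s. pair (T s f) h)"
  unfolding continuous_on_iff
proof (intro ballI allI impI)
  fix s \<epsilon> :: real assume s: "s \<in> {0..\<tau>}" and e: "0 < \<epsilon>"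
  have h1: "0 < l2norm h + 1" using l2norm_nonneg[of h] by linarith
  then have "0 < \<epsilon> / (2 * (l2norm h + 1))" using e by simp
  from orbit_uniformly_continuous[OF T f this, of \<tau>] obtain d where d: "0 < d"
    "\<And>s t. s \<in> {0..\<tau>} \<Longrightarrow> t \<in> {0..\<tau>} \<Longrightarrow> \<bar>s - t\<bar> < d \<Longrightarrow> l2norm (\<lambda>x. T s f x - T t f x) \<le> \<epsilon> / (2 * (l2norm h + 1))"
    by blast
  have "dist (pair (T t f) h) (pair (T s f) h) < \<epsilon>" if "t \<in> {0..\<tau>}" "dist t s < d" for t
  proof -
    have L: "T t f \<in> L2" "T s f \<in> L2" using that s by (auto intro!: C0_semigroup_L2[OF T] f)
    have "dist (pair (T t f) h) (pair (T s f) h) \<le> l2norm (\<lambda>x. T t f x - T s f x) * l2norm h"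
      using norm_pair_le[OF L2_diff[OF L] h] pair_diff[OF L h] by (simp add: dist_norm)
    also have "\<dots> \<le> \<epsilon> / (2 * (l2norm h + 1)) * l2norm h"
      by (rule mult_right_mono[OF d(2)[OF that(1) s] l2norm_nonneg]) (use that in \<open>simp add: dist_real_def\<close>)
    also have "\<dots> \<le> \<epsilon> / 2" using e h1 by (simp add: field_simps)
    also have "\<dots> < \<epsilon>" using e by simp
    finally show ?thesis .
  qed
  then show "\<exists>d>0. \<forall>x'\<in>{0..\<tau>}. dist x' s < d \<longrightarrow> dist (pair (T x' f) h) (pair (T s f) h) < \<epsilon>"
    using d(1) by blast
qed

text \<open>
  The generator only provides a derivative from the right, at time 0. Forward increments reduce to
  it at once; a backward increment is compared with the forward increment from the earlier time, at
  the cost of moving \<open>T s g\<close> to \<open>T t g\<close>.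
\<close>
lemma orbit_uniformly_differentiable:
  assumes T: "C0_semigroup T" and fg: "(f, g) \<in> generator T" and e: "0 < \<epsilon>"
  shows "\<exists>d>0. \<forall>s\<in>{0..\<tau>}. \<forall>t\<in>{0..\<tau>}. \<bar>s - t\<bar> < d \<longrightarrow>
     l2norm (\<lambda>x. T s f x - T t f x - of_real (s - t) * T t g x) \<le> \<epsilon> * \<bar>s - t\<bar>"
proof -
  have f: "f \<in> L2" and g: "g \<in> L2"
    and lim: "((\<lambda>h. l2norm (\<lambda>x. (T h f x - f x) / of_real h - g x)) \<longlongrightarrow> 0) (at_right 0)"
    using fg by (auto simp: generator_def)
  obtain C where C: "0 \<le> C" "\<And>t f. t \<in> {0..\<tau>} \<Longrightarrow> f \<in> L2 \<Longrightarrow> l2norm (T t f) \<le> C * l2norm f"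
    using C0_semigroup_locally_bounded[OF T] by blast
  have "\<forall>\<^sub>F h in at_right 0. l2norm (\<lambda>x. (T h f x - f x) / of_real h - g x) < \<epsilon> / (2 * (C + 1))"
    using e C(1) by (intro order_tendstoD[OF lim]) auto
  then obtain d1 where d1: "0 < d1"
    "\<And>h. 0 < h \<Longrightarrow> h < d1 \<Longrightarrow> l2norm (\<lambda>x. (T h f x - f x) / of_real h - g x) < \<epsilon> / (2 * (C + 1))"
    by (auto simp: eventually_at_right_field)
  have "0 < \<epsilon> / 2" using e by simp
  from orbit_uniformly_continuous[OF T g this, of \<tau>] obtain d2 where d2: "0 < d2"
    "\<And>s t. s \<in> {0..\<tau>} \<Longrightarrow> t \<in> {0..\<tau>} \<Longrightarrow> \<bar>s - t\<bar> < d2 \<Longrightarrow> l2norm (\<lambda>x. T s g x - T t g x) \<le> \<epsilon> / 2"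
    by blast
  have forward: "l2norm (\<lambda>x. T s f x - T t f x - of_real (s - t) * T t g x) \<le> (\<epsilon> / 2) * (s - t)"
    if "s \<in> {0..\<tau>}" "t \<in> {0..\<tau>}" "t < s" "s - t < d1" for s t
  proof -
    have t: "0 \<le> t" "0 \<le> s - t" "0 \<le> s" using that by auto
    let ?h = "s - t"
    let ?D = "\<lambda>x. T ?h f x - f x" and ?R = "\<lambda>x. T ?h f x - f x - of_real ?h * g x"
    have DL: "?D \<in> L2" and RL: "?R \<in> L2" by (intro L2_diff C0_semigroup_L2[OF T] t f L2_scale g)+
    have "AE x in int_measure. T s f x - T t f x - of_real ?h * T t g x = T t ?R x"
      using C0_semigroup_add[OF T t(1,2) f] C0_semigroup_diff[OF T t(1) C0_semigroup_L2[OF T t(2) f] f]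
        C0_semigroup_diff[OF T t(1) DL L2_scale[OF g, of "of_real ?h"]] C0_semigroup_scale[OF T t(1) g, of "of_real ?h"]
      by eventually_elim simp
    then have "l2norm (\<lambda>x. T s f x - T t f x - of_real ?h * T t g x) = l2norm (T t ?R)"
      by (intro l2norm_cong_AE L2_diff L2_scale C0_semigroup_L2[OF T] t f g RL)
    also have "\<dots> \<le> C * l2norm ?R" by (intro C that RL)
    also have R: "?R = (\<lambda>x. of_real ?h * ((T ?h f x - f x) / of_real ?h - g x))"
    proof -
      have "complex_of_real ?h \<noteq> 0" using that by (simp del: of_real_diff)
      then have "of_real ?h * (X / of_real ?h - Y) = X - of_real ?h * Y" for X Y :: complex
        by (simp add: right_diff_distrib del: of_real_diff)
      then show ?thesis by (simp only:)
    qed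
    also have "l2norm \<dots> = ?h * l2norm (\<lambda>x. (T ?h f x - f x) / of_real ?h - g x)"
      unfolding l2norm_scale norm_of_real using that by simp
    also have "C * \<dots> \<le> C * (?h * (\<epsilon> / (2 * (C + 1))))"
      using that d1(2)[of ?h] C(1) by (intro mult_left_mono) auto
    also have "\<dots> = (C / (C + 1)) * (\<epsilon> / 2 * ?h)"
      using C(1) by (simp add: field_simps)
    also have "\<dots> \<le> 1 * (\<epsilon> / 2 * ?h)"
      using that e C(1) by (intro mult_right_mono) auto
    finally show ?thesis by simp
  qed
  have "l2norm (\<lambda>x. T s f x - T t f x - of_real (s - t) * T t g x) \<le> \<epsilon> * \<bar>s - t\<bar>"
    if st: "s \<in> {0..\<tau>}" "t \<in> {0..\<tau>}" "\<bar>s - t\<bar> < min d1 d2" for s t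
  proof (cases s t rule: linorder_cases)
    case greater
    then have "l2norm (\<lambda>x. T s f x - T t f x - of_real (s - t) * T t g x) \<le> (\<epsilon> / 2) * (s - t)"
      using st by (intro forward) auto
    also have "\<dots> \<le> \<epsilon> * (s - t)" using greater e by (intro mult_right_mono) auto
    finally show ?thesis using greater by simp
  next
    case less
    have L: "T s f \<in> L2" "T t f \<in> L2" "T s g \<in> L2" "T t g \<in> L2"
      using st by (auto intro!: C0_semigroup_L2[OF T] f g)
    let ?A = "\<lambda>x. T t f x - T s f x - of_real (t - s) * T s g x"
    let ?B = "\<lambda>x. of_real (t - s) * (T t g x - T s g x)"
    have AB: "?A \<in> L2" "?B \<in> L2" by (intro L2_diff L2_scale L)+
    have "(\<lambda>x. T s f x - T t f x - of_real (s - t) * T t g x) = (\<lambda>x. ?B x - ?A x)"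
      by (auto simp: algebra_simps)
    then have "l2norm (\<lambda>x. T s f x - T t f x - of_real (s - t) * T t g x) \<le> l2norm ?B + l2norm ?A"
      using l2norm_triangle_diff[OF AB(2,1)] by simp
    also have "l2norm ?A \<le> (\<epsilon> / 2) * (t - s)" using less st by (intro forward) auto
    also have "l2norm ?B = (t - s) * l2norm (\<lambda>x. T t g x - T s g x)"
      unfolding l2norm_scale norm_of_real using less by simp
    also have "\<dots> \<le> (t - s) * (\<epsilon> / 2)" using less st by (intro mult_left_mono d2) auto
    finally show ?thesis using less by (simp add: field_simps)
  qed (use st in \<open>simp\<close>)
  then show ?thesis using d1(1) d2(1) by (intro exI[of _ "min d1 d2"]) auto
qed

lemma pair_orbit_has_derivative:
  assumes T: "C0_semigroup T" and fg: "(f, g) \<in> generator T" and h: "h \<in> L2" and t: "t \<in> {0..\<tau>}"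
  shows "((\<lambda>s. pair (T s f) h) has_vector_derivative pair (T t g) h) (at t within {0..\<tau>})"
  unfolding has_vector_derivative_def has_derivative_within_alt
proof (intro conjI allI impI)
  have f: "f \<in> L2" and g: "g \<in> L2" using fg by (auto simp: generator_def)
  show "bounded_linear (\<lambda>x. x *\<^sub>R pair (T t g) h)" by (rule bounded_linear_scaleR_left)
  fix e :: real assume e: "0 < e"
  have h1: "0 < l2norm h + 1" using l2norm_nonneg[of h] by linarith
  then have "0 < e / (l2norm h + 1)" using e by simp
  from orbit_uniformly_differentiable[OF T fg this, of \<tau>] obtain d where d: "0 < d"
    "\<And>s t. s \<in> {0..\<tau>} \<Longrightarrow> t \<in> {0..\<tau>} \<Longrightarrow> \<bar>s - t\<bar> < d \<Longrightarrow>
      l2norm (\<lambda>x. T s f x - T t f x - of_real (s - t) * T t g x) \<le> e / (l2norm h + 1) * \<bar>s - t\<bar>"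
    by blast
  have "norm (pair (T s f) h - pair (T t f) h - (s - t) *\<^sub>R pair (T t g) h) \<le> e * norm (s - t)"
    if "s \<in> {0..\<tau>}" "norm (s - t) < d" for s
  proof -
    have L: "T s f \<in> L2" "T t f \<in> L2" "T t g \<in> L2" using that t by (auto intro!: C0_semigroup_L2[OF T] f g)
    have D: "(\<lambda>x. T s f x - T t f x) \<in> L2" "(\<lambda>x. of_real (s - t) * T t g x) \<in> L2"
      by (intro L2_diff L2_scale L)+
    have eq: "pair (T s f) h - pair (T t f) h - (s - t) *\<^sub>R pair (T t g) h =
        pair (\<lambda>x. T s f x - T t f x - of_real (s - t) * T t g x) h"
      unfolding pair_diff[OF D h] pair_diff[OF L(1,2) h] pair_scale by (simp add: scaleR_conv_of_real)
    have "norm (pair (T s f) h - pair (T t f) h - (s - t) *\<^sub>R pair (T t g) h)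
        \<le> l2norm (\<lambda>x. T s f x - T t f x - of_real (s - t) * T t g x) * l2norm h"
      unfolding eq by (intro norm_pair_le L2_diff D h)
    also have "\<dots> \<le> e / (l2norm h + 1) * \<bar>s - t\<bar> * l2norm h"
      by (rule mult_right_mono[OF d(2)[OF that(1) t] l2norm_nonneg]) (use that in simp)
    also have "\<dots> = (l2norm h / (l2norm h + 1)) * (e * norm (s - t))" by simp
    also have "\<dots> \<le> 1 * (e * norm (s - t))"
      using e h1 by (intro mult_right_mono) (auto simp: divide_le_eq_1)
    finally show ?thesis by simp
  qed
  then show "\<exists>d>0. \<forall>y\<in>{0..\<tau>}. norm (y - t) < d \<longrightarrow>
      norm (pair (T y f) h - pair (T t f) h - (y - t) *\<^sub>R pair (T t g) h) \<le> e * norm (y - t)"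
    using d(1) by blast
qed

lemma generator_invariant:
  assumes T: "C0_semigroup T" and fg: "(f, g) \<in> generator T" and t: "0 \<le> t"
  shows "(T t f, T t g) \<in> generator T"
proof -
  have f: "f \<in> L2" and g: "g \<in> L2"
    and lim: "((\<lambda>h. l2norm (\<lambda>x. (T h f x - f x) / of_real h - g x)) \<longlongrightarrow> 0) (at_right 0)"
    using fg by (auto simp: generator_def)
  obtain C where C: "0 \<le> C" "\<And>f. f \<in> L2 \<Longrightarrow> l2norm (T t f) \<le> C * l2norm f"
    using C0_semigroup_bounded[OF T t] by blast
  have "((\<lambda>h. l2norm (\<lambda>x. (T h (T t f) x - T t f x) / of_real h - T t g x)) \<longlongrightarrow> 0) (at_right 0)"
  proof (rule tendsto_sandwich[OF _ _ tendsto_const])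
    show "((\<lambda>h. C * l2norm (\<lambda>x. (T h f x - f x) / of_real h - g x)) \<longlongrightarrow> 0) (at_right 0)"
      using tendsto_mult_right_zero[OF lim] .
    show "\<forall>\<^sub>F h in at_right 0. l2norm (\<lambda>x. (T h (T t f) x - T t f x) / of_real h - T t g x)
        \<le> C * l2norm (\<lambda>x. (T h f x - f x) / of_real h - g x)"
      unfolding eventually_at_right_field
    proof (intro exI[of _ 1] conjI allI impI)
      fix h :: real assume "0 < h"
      then have h: "0 \<le> h" by simp
      let ?c = "1 / complex_of_real h"
      let ?Q = "\<lambda>x. ?c * (T h f x - f x)"
      have L: "T h f \<in> L2" "T t f \<in> L2" "T h (T t f) \<in> L2" "T t g \<in> L2" by (intro C0_semigroup_L2[OF T] t h f g)+
      have D: "(\<lambda>x. T h f x - f x) \<in> L2" "?Q \<in> L2" "(\<lambda>x. ?Q x - g x) \<in> L2" by (intro L2_diff L2_scale L f g)+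
      have "AE x in int_measure. ?c * (T h (T t f) x - T t f x) - T t g x = T t (\<lambda>x. ?Q x - g x) x"
        using C0_semigroup_commute[OF T h t f] C0_semigroup_diff[OF T t L(1) f]
          C0_semigroup_scale[OF T t D(1), of ?c] C0_semigroup_diff[OF T t D(2) g]
        by eventually_elim simp
      then have "l2norm (\<lambda>x. ?c * (T h (T t f) x - T t f x) - T t g x) = l2norm (T t (\<lambda>x. ?Q x - g x))"
        by (intro l2norm_cong_AE L2_diff L2_scale L C0_semigroup_L2[OF T] t D)
      also have "\<dots> \<le> C * l2norm (\<lambda>x. ?Q x - g x)" by (intro C D)
      finally show "l2norm (\<lambda>x. (T h (T t f) x - T t f x) / of_real h - T t g x)
        \<le> C * l2norm (\<lambda>x. (T h f x - f x) / of_real h - g x)" by simp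
    qed simp
  qed auto
  then show ?thesis
    unfolding generator_def by (auto intro!: C0_semigroup_L2[OF T t] f g)
qed

lemma generator_sine:
  assumes gen: "generator T = (\<lambda>(g, h). (g, \<lambda>x. - \<i> * h x)) ` schrodinger_op V"
    and V: "V \<in> borel_measurable int_measure" "\<And>x. x \<in> {0<..<pi} \<Longrightarrow> norm (V x) \<le> B"
  shows "(sine m, \<lambda>x. - \<i> * ((of_nat m)\<^sup>2 * sine m x + V x * sine m x)) \<in> generator T"
  unfolding gen using sine_schrodinger_op[OF V, of m] by force

lemma coef_generator:
  assumes gen: "generator T = (\<lambda>(g, h). (g, \<lambda>x. - \<i> * h x)) ` schrodinger_op V"
    and V: "V \<in> borel_measurable int_measure" "\<And>x. x \<in> {0<..<pi} \<Longrightarrow> norm (V x) \<le> B"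
    and fg: "(f, g) \<in> generator T"
  shows "coef g n = - \<i> * ((of_nat n)\<^sup>2 * coef f n + coef (\<lambda>x. V x * f x) n)"
proof -
  obtain h where h: "(f, h) \<in> schrodinger_op V" "g = (\<lambda>x. - \<i> * h x)"
    using fg unfolding gen by auto
  show ?thesis
    unfolding h(2) coef_def pair_scale unfolding coef_def[symmetric]
    by (simp only: coef_schrodinger_op[OF V h(1)])
qed

text \<open>
  The inverse of the flow of $-\partial_x^2 + a$ on the \<open>n\<close>-th sine coefficient.
\<close>
definition phase :: "complex \<Rightarrow> nat \<Rightarrow> real \<Rightarrow> complex"
  where "phase a n s = exp (\<i> * ((of_nat n)\<^sup>2 + a) * of_real s)"

lemma phase_0 [simp]: "phase a n 0 = 1"
  by (simp add: phase_def)

lemma continuous_on_phase [continuous_intros]: "continuous_on S (phase a n)"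
  unfolding phase_def by (intro continuous_intros)

lemma norm_phase_le:
  assumes "s \<in> {0..t}" shows "norm (phase a n s) \<le> exp (\<bar>Im a\<bar> * t)"
proof -
  have "Re (\<i> * ((of_nat n)\<^sup>2 + a) * of_real s) = - Im a * s"
    by (simp add: power2_eq_square)
  then have "norm (phase a n s) = exp (- Im a * s)" by (simp only: phase_def norm_exp_eq_Re)
  also have "- Im a * s \<le> \<bar>Im a\<bar> * s" using assms by (intro mult_right_mono) auto
  also have "\<dots> \<le> \<bar>Im a\<bar> * t" using assms by (intro mult_left_mono) auto
  finally show ?thesis by simp
qed

lemma phase_has_derivative:
  "(phase a n has_vector_derivative \<i> * ((of_nat n)\<^sup>2 + a) * phase a n s) (at s within S)"
  unfolding phase_def[abs_def]
  by (rule has_vector_derivative_real_field | auto intro!: derivative_eq_intros)+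

text \<open>
  The equation for the rotating coefficients in integrated form, which makes sense for every initial
  value in $L^2$. For $f = e_m$ the orbit stays in the domain of the generator and the equation may
  be differentiated; both sides are bounded linear functionals of \<open>f\<close>, so this case suffices.
\<close>
lemma interaction_picture:
  assumes T: "C0_semigroup T"
    and gen: "generator T = (\<lambda>(g, h). (g, \<lambda>x. - \<i> * h x)) ` schrodinger_op V"
    and V: "V \<in> borel_measurable int_measure" "\<And>x. x \<in> {0<..<pi} \<Longrightarrow> norm (V x) \<le> B"
    and f: "f \<in> L2" and t: "0 \<le> t"
  shows "phase a n t * coef (T t f) n - coef f n
     = integral {0..t} (\<lambda>s. - \<i> * phase a n s * pair (T s f) (\<lambda>x. (V x - a) * sine n x))"
proof -
  let ?v = "\<lambda>x. (V x - a) * sine n x"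
  have Va: "(\<lambda>x. V x - a) \<in> borel_measurable int_measure" using V(1) by simp
  have vL: "?v \<in> L2"
  proof (rule L2_mult_bounded[OF sine_L2 Va])
    show "norm (V x - a) \<le> B + norm a" if "x \<in> {0<..<pi}" for x
      using V(2)[OF that] norm_triangle_ineq4[of "V x" a] by linarith
  qed
  define r where "r f s = - \<i> * phase a n s * pair (T s f) ?v" for f s
  define D where "D f = phase a n t * coef (T t f) n - coef f n - integral {0..t} (r f)" for f
  have rc: "continuous_on {0..t} (r f)" if "f \<in> L2" for f
    unfolding r_def[abs_def] by (intro continuous_intros pair_orbit_continuous[OF T that vL])
  have ri: "r f integrable_on {0..t}" if "f \<in> L2" for f
    by (intro integrable_continuous_interval rc that)
  have D_lin: "D (\<lambda>x. b * f x + c * g x) = b * D f + c * D g" if fg: "f \<in> L2" "g \<in> L2" for f g b c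
  proof -
    let ?h = "\<lambda>x. b * f x + c * g x"
    have hL: "?h \<in> L2" by (intro L2_add L2_scale fg)
    have p: "pair (T s ?h) k = b * pair (T s f) k + c * pair (T s g) k" if "0 \<le> s" "k \<in> L2" for s k
    proof -
      have L: "T s f \<in> L2" "T s g \<in> L2" "T s ?h \<in> L2" by (intro C0_semigroup_L2[OF T] that fg hL)+
      have "pair (T s ?h) k = pair (\<lambda>x. b * T s f x + c * T s g x) k"
        by (intro pair_cong_AE C0_semigroup_lin[OF T] L L2_add L2_scale that fg)
      then show ?thesis using L that by (simp add: pair_add L2_scale pair_scale)
    qed
    have "integral {0..t} (r ?h) = integral {0..t} (\<lambda>s. b * r f s + c * r g s)"
    proof (rule integral_cong)
      fix s assume "s \<in> {0..t}"
      then have "0 \<le> s" by simp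
      show "r ?h s = b * r f s + c * r g s"
        unfolding r_def p[OF \<open>0 \<le> s\<close> vL] by (simp add: algebra_simps)
    qed
    also have "\<dots> = b * integral {0..t} (r f) + c * integral {0..t} (r g)"
      using ri[OF fg(1)] ri[OF fg(2)]
      by (subst Henstock_Kurzweil_Integration.integral_add) (auto intro: integrable_on_mult_right)
    finally show ?thesis
      unfolding D_def coef_lin[OF fg] by (simp add: coef_def p[OF t sine_L2] algebra_simps)
  qed
  have D_sine: "D (sine m) = 0" for m
  proof -
    have "((\<lambda>s. phase a n s * coef (T s (sine m)) n) has_vector_derivative r (sine m) s) (at s within {0..t})"
      if s: "s \<in> {0..t}" for s
    proof -
      define g where "g x = - \<i> * ((of_nat m)\<^sup>2 * sine m x + V x * sine m x)" for x
      let ?F = "T s (sine m)"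
      have sg: "(sine m, g) \<in> generator T"
        unfolding g_def[abs_def] by (rule generator_sine[OF gen V])
      have s0: "0 \<le> s" using s by simp
      have FL: "?F \<in> L2" by (intro C0_semigroup_L2[OF T s0] sine_L2)
      have A: "coef (T s g) n = - \<i> * ((of_nat n)\<^sup>2 * coef ?F n + coef (\<lambda>x. V x * ?F x) n)"
        by (intro coef_generator[OF gen V] generator_invariant[OF T sg s0])
      have B: "((\<lambda>s. coef (T s (sine m)) n) has_vector_derivative coef (T s g) n) (at s within {0..t})"
        unfolding coef_def by (rule pair_orbit_has_derivative[OF T sg sine_L2 s])
      have d: "((\<lambda>s. phase a n s * coef (T s (sine m)) n) has_vector_derivative
          phase a n s * (- \<i> * ((of_nat n)\<^sup>2 * coef ?F n + coef (\<lambda>x. V x * ?F x) n))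
           + \<i> * ((of_nat n)\<^sup>2 + a) * phase a n s * coef ?F n) (at s within {0..t})"
        by (rule has_vector_derivative_mult[OF phase_has_derivative B[unfolded A]])
      \<comment> \<open>The constant \<open>a\<close> in the phase cancels against the one subtracted from the potential.\<close>
      have P: "pair ?F ?v = coef (\<lambda>x. V x * ?F x) n - a * coef ?F n"
      proof -
        have VFL: "(\<lambda>x. V x * ?F x) \<in> L2" by (rule L2_mult_bounded[OF FL V])
        have "pair ?F ?v = pair (\<lambda>x. V x * ?F x - a * ?F x) (sine n)"
          by (simp add: pair_def algebra_simps)
        also have "\<dots> = coef (\<lambda>x. V x * ?F x) n - a * coef ?F n"
          by (simp add: pair_diff[OF VFL L2_scale[OF FL] sine_L2] pair_scale coef_def)
        finally show ?thesis .
      qed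
      have "phase a n s * (- \<i> * ((of_nat n)\<^sup>2 * coef ?F n + coef (\<lambda>x. V x * ?F x) n))
           + \<i> * ((of_nat n)\<^sup>2 + a) * phase a n s * coef ?F n = r (sine m) s"
        unfolding r_def P by (simp add: algebra_simps)
      then show ?thesis using d by (simp only:)
    qed
    then have "(r (sine m) has_integral phase a n t * coef (T t (sine m)) n - phase a n 0 * coef (T 0 (sine m)) n) {0..t}"
      by (intro fundamental_theorem_of_calculus t)
    moreover have "coef (T 0 (sine m)) n = coef (sine m) n"
      unfolding coef_def by (intro pair_cong_AE C0_semigroup_L2[OF T] sine_L2 C0_semigroup_0[OF T]) simp
    ultimately show ?thesis unfolding D_def by (simp add: integral_unique)
  qed
  obtain C where C: "0 \<le> C" "\<And>s f. s \<in> {0..t} \<Longrightarrow> f \<in> L2 \<Longrightarrow> l2norm (T s f) \<le> C * l2norm f"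
    using C0_semigroup_locally_bounded[OF T] by blast
  define E where "E = exp (\<bar>Im a\<bar> * t)"
  define K where "K = E * (C * l2norm (sine n)) + l2norm (sine n) + t * (E * (C * l2norm ?v))"
  have D_le: "norm (D f) \<le> K * l2norm f" if f: "f \<in> L2" for f
  proof -
    have p: "norm (phase a n s * pair (T s f) k) \<le> E * (C * l2norm k) * l2norm f" if "s \<in> {0..t}" "k \<in> L2" for s k
    proof -
      have "norm (pair (T s f) k) \<le> l2norm (T s f) * l2norm k"
        using that by (intro norm_pair_le C0_semigroup_L2[OF T] f) auto
      also have "\<dots> \<le> (C * l2norm f) * l2norm k" using that f by (intro mult_right_mono C) auto
      finally have "norm (phase a n s) * norm (pair (T s f) k) \<le> E * ((C * l2norm f) * l2norm k)"
        unfolding E_def using that by (intro mult_mono norm_phase_le) auto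
      then show ?thesis by (simp add: norm_mult mult_ac)
    qed
    have "norm (integral {0..t} (r f)) \<le> integral {0..t} (\<lambda>s. E * (C * l2norm ?v) * l2norm f)"
      using p[OF _ vL] by (intro integral_norm_bound_integral ri f) (auto simp: r_def norm_mult)
    also have "\<dots> = t * (E * (C * l2norm ?v)) * l2norm f" using t by simp
    finally have 1: "norm (integral {0..t} (r f)) \<le> t * (E * (C * l2norm ?v)) * l2norm f" .
    have 2: "norm (phase a n t * coef (T t f) n) \<le> E * (C * l2norm (sine n)) * l2norm f"
      unfolding coef_def using t by (intro p sine_L2) auto
    have 3: "norm (coef f n) \<le> l2norm (sine n) * l2norm f"
      unfolding coef_def using norm_pair_le[OF f sine_L2] by (simp add: mult.commute)
    have "norm (D f) \<le> norm (phase a n t * coef (T t f) n) + norm (coef f n) + norm (integral {0..t} (r f))"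
      unfolding D_def by (intro order_trans[OF norm_triangle_ineq4] add_mono norm_triangle_ineq4 order_refl)
    also have "\<dots> \<le> K * l2norm f" using 1 2 3 by (simp add: K_def distrib_right)
    finally show ?thesis .
  qed
  have "D f = 0" by (rule L2_functional_eq_0[OF D_lin D_le D_sine f])
  then show ?thesis unfolding D_def r_def[abs_def] by (simp only: right_minus_eq)
qed

section \<open>The continuous remainder\<close>

lemma norm_sine_le: "norm (sine n x) \<le> 1"
proof -
  have "norm (sine n x) = sqrt (2 / pi) * \<bar>sin (real n * x)\<bar>"
    unfolding sine_def norm_of_real by (simp add: abs_mult)
  also have "\<dots> \<le> 1 * 1"
    using pi_ge_two by (intro mult_mono abs_sin_le_one) auto
  finally show ?thesis by simp
qed

lemma l2norm_sine_le: "l2norm (sine n) \<le> 1"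
proof -
  have "(l2norm (sine n))\<^sup>2 = Re (pair (sine n) (sine n))"
    using l2norm_power2_pair[OF sine_L2, of n] by (simp add: sine_def[abs_def])
  also have "\<dots> \<le> 1\<^sup>2" by (simp add: pair_sine_sine)
  finally show ?thesis by (rule power2_le_imp_le) simp
qed

lemma coef_0 [simp]: "coef f 0 = 0"
  by (simp add: coef_def pair_def sine_def)

lemma l2norm_one: "(l2norm (\<lambda>x. 1))\<^sup>2 = pi"
  using LINT_cos[of 0] by (simp add: l2norm_power2 scaleR_conv_of_real)

lemma sine_squared: "sine n x * sine n x = of_real (1 / pi) - of_real (sqrt (1 / pi)) * cosine2 n x"
proof -
  have "sine n x * sine n x = of_real ((sqrt (2 / pi) * sqrt (2 / pi)) * (sin (real n * x))\<^sup>2)"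
    unfolding sine_def by (simp only: of_real_mult power2_eq_square mult_ac)
  also have "(sqrt (2 / pi) * sqrt (2 / pi)) * (sin (real n * x))\<^sup>2 = 1 / pi - (sqrt (1 / pi) * sqrt (1 / pi)) * cos (2 * real n * x)"
    using cos_double_sin[of "real n * x"] by (simp add: field_simps)
  also have "complex_of_real \<dots> = of_real (1 / pi) - of_real (sqrt (1 / pi)) * cosine2 n x"
    unfolding cosine2_def by (simp only: of_real_mult of_real_diff mult_ac)
  finally show ?thesis .
qed

text \<open>
  The matrix entries are \<open>W n m = - \<i> * coef (v n) m\<close> with \<open>v n = (V - a) * sine n\<close>. Parseval's
  identity expands the integrand of \<open>interaction_picture\<close> in the coefficients of the solution, and
  Bessel's inequality yields all the square summability that \<open>summable_off_resonance\<close> requires.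
\<close>
lemma smoothing_summable:
  assumes T: "C0_semigroup T"
    and gen: "generator T = (\<lambda>(g, h). (g, \<lambda>x. - \<i> * h x)) ` schrodinger_op V"
    and V: "V \<in> borel_measurable int_measure" "\<And>x. x \<in> {0<..<pi} \<Longrightarrow> norm (V x) \<le> M"
    and f: "f \<in> L2" and t: "0 \<le> t"
  shows "summable (\<lambda>n. norm (phase (mean V) n t * coef (T t f) n - coef f n))"
proof -
  define a where "a = mean V"
  define B where "B = \<bar>M\<bar> + norm a"
  have B0: "0 \<le> B" by (simp add: B_def)
  define U where "U x = V x - a" for x
  have Um: "U \<in> borel_measurable int_measure" unfolding U_def[abs_def] using V(1) by simp
  have UB: "norm (U x) \<le> B" if "x \<in> {0<..<pi}" for x
    using V(2)[OF that] norm_triangle_ineq4[of "V x" a] unfolding U_def B_def by linarith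
  have UL: "U \<in> L2" by (rule L2_bounded[OF Um UB])
  define v where "v n x = U x * sine n x" for n x
  have vL: "v n \<in> L2" for n unfolding v_def[abs_def] by (rule L2_mult_bounded[OF sine_L2 Um UB])
  have v_norm: "l2norm (v n) \<le> B" for n
  proof -
    have "l2norm (v n) \<le> B * l2norm (sine n)"
      unfolding v_def[abs_def] by (rule l2norm_mult_bounded[OF sine_L2 Um UB B0])
    also have "\<dots> \<le> B * 1" by (intro mult_left_mono l2norm_sine_le B0)
    finally show ?thesis by simp
  qed
  obtain C where C: "0 \<le> C" "\<And>s f. s \<in> {0..t} \<Longrightarrow> f \<in> L2 \<Longrightarrow> l2norm (T s f) \<le> C * l2norm f"
    using C0_semigroup_locally_bounded[OF T] by blast
  define E where "E = exp (\<bar>Im a\<bar> * t)"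
  define N where "N = C * l2norm f"
  have N0: "0 \<le> N" by (simp add: N_def C)
  define c where "c n s = phase a n s * coef (T s f) n" for n s
  define r where "r n s = - \<i> * phase a n s * pair (T s f) (v n)" for n s
  define W where "W n m = - \<i> * coef (v n) m" for n m
  have TL: "T s f \<in> L2" "l2norm (T s f) \<le> N" if "s \<in> {0..t}" for s
    using that C(2)[OF that f] by (auto simp: N_def intro!: C0_semigroup_L2[OF T] f)
  have rc: "continuous_on {0..t} (r n)" for n
    unfolding r_def[abs_def] by (intro continuous_intros pair_orbit_continuous[OF T f vL])
  have c_eq: "c n s = coef f n + integral {0..s} (r n)" if "s \<in> {0..t}" for n s
    using interaction_picture[OF T gen V f, of s a n] that
    by (simp add: c_def r_def[abs_def] v_def[abs_def] U_def algebra_simps)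
  have "summable (\<lambda>n. norm (c n t - c n 0))"
  proof (rule summable_off_resonance[OF t, where K = "E * N * (1 + B)" and B = B and r = r and W = W])
    show "0 \<le> E * N * (1 + B)" using N0 B0 by (simp add: E_def)
    show "(c n has_vector_derivative r n s) (at s within {0..t})" if s: "s \<in> {0..t}" for n s
    proof -
      have "((\<lambda>s. coef f n + integral {0..s} (r n)) has_vector_derivative r n s) (at s within {0..t})"
        using has_vector_derivative_add[OF has_vector_derivative_const integral_has_vector_derivative[OF rc s]] by simp
      then show ?thesis
        by (rule has_vector_derivative_transform[OF s, rotated]) (rule c_eq)
    qed
    show "(\<Sum>n<K. (norm (c n s))\<^sup>2) \<le> (E * N * (1 + B))\<^sup>2" if s: "s \<in> {0..t}" for s K
    proof -
      have "(norm (c n s))\<^sup>2 \<le> E\<^sup>2 * (norm (coef (T s f) n))\<^sup>2" for n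
        unfolding c_def norm_mult power_mult_distrib E_def
        by (intro mult_right_mono power_mono norm_phase_le s) auto
      then have "(\<Sum>n<K. (norm (c n s))\<^sup>2) \<le> E\<^sup>2 * (\<Sum>n<K. (norm (coef (T s f) n))\<^sup>2)"
        by (simp add: sum_distrib_left sum_mono)
      also have "\<dots> \<le> E\<^sup>2 * (l2norm (T s f))\<^sup>2" by (intro mult_left_mono sum_norm_coef_le TL s) auto
      also have "\<dots> \<le> E\<^sup>2 * N\<^sup>2" using TL(2)[OF s] by (intro mult_left_mono power_mono) auto
      also have "\<dots> = (E * N * 1)\<^sup>2" by (simp add: power_mult_distrib)
      also have "\<dots> \<le> (E * N * (1 + B))\<^sup>2" using N0 B0 by (intro power_mono mult_left_mono) (auto simp: E_def)
      finally show ?thesis .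
    qed
    show "(\<Sum>n<K. (norm (r n s))\<^sup>2) \<le> (E * N * (1 + B))\<^sup>2" if s: "s \<in> {0..t}" for s K
    proof -
      have UT: "(\<lambda>x. U x * T s f x) \<in> L2" by (rule L2_mult_bounded[OF TL(1)[OF s] Um UB])
      have p: "pair (T s f) (v n) = coef (\<lambda>x. U x * T s f x) n" for n
        by (simp add: pair_def coef_def v_def mult_ac)
      have "(norm (r n s))\<^sup>2 \<le> E\<^sup>2 * (norm (coef (\<lambda>x. U x * T s f x) n))\<^sup>2" for n
        unfolding r_def norm_mult power_mult_distrib E_def p
        using mult_right_mono[OF power_mono[OF norm_phase_le[OF s, of a n] norm_ge_zero, of 2], of "(norm (coef (\<lambda>x. U x * T s f x) n))\<^sup>2"]
        by simp
      then have "(\<Sum>n<K. (norm (r n s))\<^sup>2) \<le> E\<^sup>2 * (\<Sum>n<K. (norm (coef (\<lambda>x. U x * T s f x) n))\<^sup>2)"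
        by (simp add: sum_distrib_left sum_mono)
      also have "\<dots> \<le> E\<^sup>2 * (l2norm (\<lambda>x. U x * T s f x))\<^sup>2" by (intro mult_left_mono sum_norm_coef_le UT) auto
      also have "\<dots> \<le> E\<^sup>2 * (B * N)\<^sup>2"
      proof (intro mult_left_mono power_mono)
        have "l2norm (\<lambda>x. U x * T s f x) \<le> B * l2norm (T s f)" by (rule l2norm_mult_bounded[OF TL(1)[OF s] Um UB B0])
        also have "\<dots> \<le> B * N" by (intro mult_left_mono TL s B0)
        finally show "l2norm (\<lambda>x. U x * T s f x) \<le> B * N" .
      qed auto
      also have "\<dots> = (E * N * B)\<^sup>2" by (simp add: power_mult_distrib)
      also have "\<dots> \<le> (E * N * (1 + B))\<^sup>2" using N0 B0 by (intro power_mono mult_left_mono) (auto simp: E_def)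
      finally show ?thesis .
    qed
    show "(\<Sum>m<K. (norm (W n m))\<^sup>2) \<le> B\<^sup>2" for n K
    proof -
      have "(\<Sum>m<K. (norm (W n m))\<^sup>2) = (\<Sum>m<K. (norm (coef (v n) m))\<^sup>2)" by (simp add: W_def norm_mult)
      also have "\<dots> \<le> (l2norm (v n))\<^sup>2" by (rule sum_norm_coef_le[OF vL])
      also have "\<dots> \<le> B\<^sup>2" by (intro power_mono v_norm) auto
      finally show ?thesis .
    qed
    show "(\<Sum>n<K. (norm (W n n))\<^sup>2) \<le> B\<^sup>2" for K
    proof -
      have one: "(\<lambda>x. 1 :: complex) \<in> L2" by (intro L2_continuous continuous_intros)
      have "V \<in> L2" by (rule L2_bounded[OF V])
      then have "integrable int_measure V" using integrable_pair[OF _ one] by simp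
      moreover have "(LINT x|int_measure. a) = a * of_real pi"
        using LINT_cos[of 0] by (simp add: scaleR_conv_of_real)
      ultimately have U0: "pair U (\<lambda>x. 1) = 0"
        unfolding pair_def U_def using integrable_pair[OF L2_scale[OF one, of a] one] by (simp add: a_def mean_def)
      \<comment> \<open>By $e_n^2 = 1/\pi - \cos(2nx)/\pi$ the diagonal consists of a mean, which vanishes, and a cosine
        coefficient.\<close>
      have "coef (v n) n = - of_real (sqrt (1 / pi)) * pair U (cosine2 n)" for n
      proof -
        have "coef (v n) n = pair (\<lambda>x. of_real (1 / pi) * 1 - of_real (sqrt (1 / pi)) * cosine2 n x) U"
          unfolding coef_def pair_def v_def mult_1_right sine_squared[symmetric] by (simp add: mult_ac)
        also have "\<dots> = of_real (1 / pi) * pair (\<lambda>x. 1) U - of_real (sqrt (1 / pi)) * pair (cosine2 n) U"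
          by (simp only: pair_diff[OF L2_scale[OF one] L2_scale[OF cosine2_L2] UL] pair_scale)
        finally show ?thesis using U0 by (simp add: pair_commute[of _ U])
      qed
      then have "(norm (W n n))\<^sup>2 = (1 / pi) * (norm (pair U (cosine2 n)))\<^sup>2" for n
        by (simp add: W_def norm_mult power_mult_distrib)
      then have "(\<Sum>n<K. (norm (W n n))\<^sup>2) = (1 / pi) * (\<Sum>n<K. (norm (pair U (cosine2 n)))\<^sup>2)"
        by (simp add: sum_distrib_left)
      also have "\<dots> \<le> (1 / pi) * (l2norm (\<lambda>x. U x * 1))\<^sup>2"
        using sum_norm_cosine2_le[OF UL] by (intro mult_left_mono) auto
      also have "\<dots> \<le> (1 / pi) * (B * l2norm (\<lambda>x. 1))\<^sup>2"
        by (intro mult_left_mono power_mono l2norm_mult_bounded[OF one Um UB B0]) auto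
      also have "\<dots> = B\<^sup>2" by (simp add: power_mult_distrib l2norm_one)
      finally show ?thesis .
    qed
    show "(\<lambda>m. W n m * (exp (\<i> * of_real ((real n)\<^sup>2 - (real m)\<^sup>2) * of_real s) * c m s)) sums r n s"
      if s: "s \<in> {0..t}" for n s
    proof -
      have "- \<i> * phase a n s * (coef (T s f) m * coef (v n) m)
          = W n m * (exp (\<i> * of_real ((real n)\<^sup>2 - (real m)\<^sup>2) * of_real s) * c m s)" for m
      proof -
        have "phase a n s = exp (\<i> * of_real ((real n)\<^sup>2 - (real m)\<^sup>2) * of_real s) * phase a m s"
          unfolding phase_def exp_add[symmetric] by (simp add: algebra_simps)
        then show ?thesis by (simp add: W_def c_def)
      qed
      then show ?thesis
        using sums_mult[OF Parseval_sums[OF TL(1)[OF s] vL[of n]], of "- \<i> * phase a n s"] by (simp only: r_def)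
    qed
  qed (rule B0 rc)+
  moreover have "c n 0 = coef f n" for n using c_eq[of 0 n] t by simp
  ultimately show ?thesis by (simp add: c_def a_def)
qed

lemma sine_series_continuous:
  assumes "summable (\<lambda>n. norm (b n))"
  shows "continuous_on UNIV (\<lambda>x. \<Sum>n. b n * sine n x)"
proof -
  have "norm (b n * sine n x) \<le> norm (b n)" for n x
    using mult_left_mono[OF norm_sine_le norm_ge_zero, of "b n" n x] by (simp add: norm_mult)
  then have "uniform_limit UNIV (\<lambda>N x. \<Sum>n<N. b n * sine n x) (\<lambda>x. \<Sum>n. b n * sine n x) sequentially"
    using assms by (intro Weierstrass_m_test) auto
  then show ?thesis
    by (rule uniform_limit_theorem[rotated])
      (auto intro!: always_eventually continuous_intros)
qed

text \<open>
  The condition on \<open>b 0\<close> makes the formula true at the index 0 as well, where the sine vanishes.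
\<close>
lemma coef_sine_series:
  assumes b: "summable (\<lambda>n. norm (b n))" and b0: "b 0 = 0"
  shows "coef (\<lambda>x. \<Sum>n. b n * sine n x) m = b m"
proof -
  let ?w = "\<lambda>x. \<Sum>n. b n * sine n x" and ?S = "\<lambda>N x. \<Sum>n<N. b n * sine n x"
  have le: "norm (b n * sine n x) \<le> norm (b n)" for n x
    using mult_left_mono[OF norm_sine_le norm_ge_zero, of "b n" n x] by (simp add: norm_mult)
  have sn: "summable (\<lambda>n. norm (b n * sine n x))" for x
    by (rule summable_comparison_test'[OF b, of 0]) (use le in auto)
  have wL: "?w \<in> L2" by (intro L2_continuous continuous_on_subset[OF sine_series_continuous[OF b]]) auto
  have SL: "?S N \<in> L2" for N by (intro L2_sum L2_scale sine_L2)
  have lim: "(\<lambda>N. ?S N x - ?w x) \<longlonglongrightarrow> 0" for x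
    using summable_LIMSEQ[OF summable_norm_cancel[OF sn[of x]]] by (simp add: LIM_zero)
  have "(\<lambda>N. l2norm (\<lambda>x. ?S N x - ?w x)) \<longlonglongrightarrow> 0"
  proof (rule l2norm_dominated_convergence)
    let ?B = "2 * (\<Sum>n. norm (b n))"
    show "(\<lambda>x. complex_of_real ?B) \<in> L2" by (intro L2_continuous continuous_intros)
    show "(\<lambda>x. ?S N x - ?w x) \<in> borel_measurable int_measure" for N by (intro L2_D(1) L2_diff SL wL)
    have "norm (?S N x - ?w x) \<le> norm (complex_of_real ?B)" for N x
    proof -
      have "norm (?S N x) \<le> (\<Sum>n<N. norm (b n))" by (rule order_trans[OF norm_sum]) (intro sum_mono le)
      also have "\<dots> \<le> (\<Sum>n. norm (b n))" by (intro sum_le_suminf b) auto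
      finally have 1: "norm (?S N x) \<le> (\<Sum>n. norm (b n))" .
      have "norm (?w x) \<le> (\<Sum>n. norm (b n * sine n x))" by (rule summable_norm[OF sn])
      also have "\<dots> \<le> (\<Sum>n. norm (b n))" by (intro suminf_le le sn b)
      finally have 2: "norm (?w x) \<le> (\<Sum>n. norm (b n))" .
      have "norm (?S N x - ?w x) \<le> ?B" using norm_triangle_ineq4[of "?S N x" "?w x"] 1 2 by linarith
      then show ?thesis by (simp only: norm_of_real)
    qed
    then show "AE x in int_measure. norm (?S N x - ?w x) \<le> norm (complex_of_real ?B)" for N by simp
    show "AE x in int_measure. (\<lambda>N. ?S N x - ?w x) \<longlonglongrightarrow> 0" using lim by simp
  qed
  then have "(\<lambda>N. pair (?S N) (sine m)) \<longlonglongrightarrow> pair ?w (sine m)"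
    by (intro tendsto_pair SL wL sine_L2)
  moreover have "pair (?S N) (sine m) = b m" if "N > m" for N
  proof -
    have "pair (?S N) (sine m) = (\<Sum>n<N. b n * pair (sine n) (sine m))"
      by (simp add: pair_sum L2_scale sine_L2 pair_scale)
    also have "\<dots> = (\<Sum>n<N. if n = m then b m else 0)"
      by (intro sum.cong) (auto simp: pair_sine_sine b0)
    also have "\<dots> = b m" using that by simp
    finally show ?thesis .
  qed
  then have "(\<lambda>N. pair (?S N) (sine m)) \<longlonglongrightarrow> b m"
    by (intro tendsto_eventually eventually_sequentiallyI[of "Suc m"]) simp
  ultimately show ?thesis unfolding coef_def by (rule LIMSEQ_unique)
qed

text \<open>
  Undoing the rotation costs a factor that is bounded in \<open>n\<close>, also when the mean of the potential is
  not real.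
\<close>
lemma continuous_remainder:
  assumes T: "C0_semigroup T"
    and gen: "generator T = (\<lambda>(g, h). (g, \<lambda>x. - \<i> * h x)) ` schrodinger_op V"
    and V: "V \<in> borel_measurable int_measure" "\<And>x. x \<in> {0<..<pi} \<Longrightarrow> norm (V x) \<le> M"
    and f: "f \<in> L2" and t: "0 \<le> t"
  shows "\<exists>w. continuous_on UNIV w \<and>
    (\<forall>n. coef (T t f) n = exp (- \<i> * ((of_nat n)\<^sup>2 + mean V) * of_real t) * coef f n + coef w n)"
proof -
  let ?p = "\<lambda>n. phase (mean V) n t" and ?q = "\<lambda>n. exp (- \<i> * ((of_nat n)\<^sup>2 + mean V) * of_real t)"
  have pq: "?q n * ?p n = 1" for n
    unfolding phase_def exp_add[symmetric] by simp
  define b where "b n = ?q n * (?p n * coef (T t f) n - coef f n)" for n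
  have "norm (?q n) \<le> exp (\<bar>Im (mean V)\<bar> * t)" for n
  proof -
    have "Re (- \<i> * ((of_nat n)\<^sup>2 + mean V) * of_real t) = Im (mean V) * t"
      by (simp add: power2_eq_square)
    then have "norm (?q n) = exp (Im (mean V) * t)" by (simp only: norm_exp_eq_Re)
    also have "\<dots> \<le> exp (\<bar>Im (mean V)\<bar> * t)" using t by (simp add: mult_right_mono)
    finally show ?thesis .
  qed
  then have le: "norm (b n) \<le> exp (\<bar>Im (mean V)\<bar> * t) * norm (?p n * coef (T t f) n - coef f n)" for n
    unfolding b_def norm_mult by (intro mult_right_mono) auto
  have bs: "summable (\<lambda>n. norm (b n))"
  proof (rule summable_comparison_test'[of _ 0])
    show "summable (\<lambda>n. exp (\<bar>Im (mean V)\<bar> * t) * norm (?p n * coef (T t f) n - coef f n))"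
      by (intro summable_mult smoothing_summable[OF T gen V f t])
    show "norm (norm (b n)) \<le> exp (\<bar>Im (mean V)\<bar> * t) * norm (?p n * coef (T t f) n - coef f n)" for n
      using le[of n] by (simp only: real_norm_def abs_norm_cancel)
  qed
  have "coef (T t f) n = ?q n * coef f n + b n" for n
    using pq[of n] unfolding b_def by (simp add: right_diff_distrib mult.assoc[symmetric])
  moreover have "coef (\<lambda>x. \<Sum>n. b n * sine n x) n = b n" for n
    by (intro coef_sine_series bs) (simp add: b_def)
  ultimately show ?thesis using sine_series_continuous[OF bs]
    by (intro exI[of _ "\<lambda>x. \<Sum>n. b n * sine n x"]) simp
qed

section \<open>The free flow at rational times\<close>

definition zero_ext :: "(real \<Rightarrow> complex) \<Rightarrow> real \<Rightarrow> complex"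
  where "zero_ext f x = (if x \<in> {0<..<pi} then f x else 0)"

text \<open>
  Translations and reflections preserve Lebesgue measure on the line.
\<close>
lemma zero_ext_affine_L2:
  assumes f: "f \<in> L2" and c: "\<bar>c\<bar> = 1"
  shows "(\<lambda>x. zero_ext f (b + c * x)) \<in> L2" and "l2norm (\<lambda>x. zero_ext f (b + c * x)) \<le> l2norm f"
proof -
  have gm [measurable]: "zero_ext f \<in> borel_measurable lebesgue"
    using L2_D(1)[OF f] unfolding zero_ext_def[abs_def] by (subst borel_measurable_if) auto
  have aff: "(\<lambda>x. b + c * x) \<in> lebesgue \<rightarrow>\<^sub>M lebesgue"
    using lebesgue_affine_measurable[of "\<lambda>_. c" b] c by auto
  have comp: "(\<lambda>x. zero_ext f (b + c * x)) \<in> borel_measurable lebesgue"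
    using measurable_compose[OF aff gm] .
  then have m: "(\<lambda>x. zero_ext f (b + c * x)) \<in> borel_measurable int_measure"
    by (rule measurable_restrict_space1)
  have "(\<integral>\<^sup>+x. ennreal ((norm (zero_ext f (b + c * x)))\<^sup>2) \<partial>int_measure)
      \<le> (\<integral>\<^sup>+x. ennreal ((norm (zero_ext f (b + c * x)))\<^sup>2) \<partial>lebesgue)"
    by (subst nn_integral_restrict_space) (auto intro!: nn_integral_mono simp: indicator_def)
  also have "\<dots> = (\<integral>\<^sup>+x. ennreal ((norm (zero_ext f x))\<^sup>2) \<partial>lebesgue)"
    using nn_integral_real_affine_lebesgue[of "\<lambda>x. ennreal ((norm (zero_ext f x))\<^sup>2)" c b] c by auto
  also have "\<dots> = (\<integral>\<^sup>+x. ennreal ((norm (f x))\<^sup>2) \<partial>int_measure)"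
    by (subst nn_integral_restrict_space) (auto intro!: nn_integral_cong simp: indicator_def zero_ext_def)
  also have "\<dots> = ennreal ((l2norm f)\<^sup>2)" by (rule nn_integral_norm2[OF f])
  finally have le: "(\<integral>\<^sup>+x. ennreal ((norm (zero_ext f (b + c * x)))\<^sup>2) \<partial>int_measure) \<le> ennreal ((l2norm f)\<^sup>2)" .
  show "(\<lambda>x. zero_ext f (b + c * x)) \<in> L2" "l2norm (\<lambda>x. zero_ext f (b + c * x)) \<le> l2norm f"
    using L2_I_nn_integral[OF m l2norm_nonneg le] by auto
qed

text \<open>
  On this range only three of the pieces of the odd periodic extension are met. The identity also
  holds at multiples of $\pi$, where all terms are 0.
\<close>
lemma odd_ext_eq_zero_ext:
  assumes "- 2 * pi < y" "y < pi"
  shows "odd_ext f y = zero_ext f y - zero_ext f (- y) + zero_ext f (y + 2 * pi)"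
proof -
  consider "- 2 * pi < y \<and> y < - pi" | "y = - pi" | "- pi < y \<and> y < 0" | "y = 0" | "0 < y"
    using assms(1) less_linear[of y "- pi"] less_linear[of y 0] by blast
  then show ?thesis
  proof cases
    case 1
    then have "odd_ext f y = f (y + 2 * pi)"
      using odd_ext_periodic[of f y] odd_ext_eq[of "y + 2 * pi" f] by simp
    then show ?thesis using 1 by (simp add: zero_ext_def)
  next
    case 2
    have "odd_ext f (- pi) = - odd_ext f pi" by (rule odd_ext_minus)
    moreover have "odd_ext f (- pi) = odd_ext f pi" using odd_ext_periodic[of f "- pi"] by simp
    ultimately have "odd_ext f y = 0" using 2 by simp
    then show ?thesis using 2 by (simp add: zero_ext_def)
  next
    case 3
    then have "odd_ext f y = - f (- y)"
      using odd_ext_minus[of f "- y"] odd_ext_eq[of "- y" f] by simp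
    then show ?thesis using 3 by (simp add: zero_ext_def)
  next
    case 4
    then show ?thesis by (simp add: zero_ext_def odd_ext_def)
  next
    case 5
    then show ?thesis using assms odd_ext_eq[of y f] by (simp add: zero_ext_def)
  qed
qed

lemma odd_ext_shift_L2:
  assumes f: "f \<in> L2" and a: "0 \<le> a" "a < 2 * pi"
  shows "(\<lambda>x. odd_ext f (x - a)) \<in> L2" and "l2norm (\<lambda>x. odd_ext f (x - a)) \<le> 3 * l2norm f"
proof -
  let ?g1 = "\<lambda>x. zero_ext f (- a + 1 * x)" and ?g2 = "\<lambda>x. zero_ext f (a + (- 1) * x)"
    and ?g3 = "\<lambda>x. zero_ext f ((2 * pi - a) + 1 * x)"
  have L: "?g1 \<in> L2" "?g2 \<in> L2" "?g3 \<in> L2" by (intro zero_ext_affine_L2 f; simp)+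
  have n: "l2norm ?g1 \<le> l2norm f" "l2norm ?g2 \<le> l2norm f" "l2norm ?g3 \<le> l2norm f"
    by (intro zero_ext_affine_L2 f; simp)+
  have gL: "(\<lambda>x. ?g1 x - ?g2 x + ?g3 x) \<in> L2" by (intro L2_add L2_diff L)
  have eq: "odd_ext f (x - a) = ?g1 x - ?g2 x + ?g3 x" if "x \<in> {0<..<pi}" for x
    using odd_ext_eq_zero_ext[of "x - a" f] that a by (simp add: algebra_simps)
  have m: "(\<lambda>x. odd_ext f (x - a)) \<in> borel_measurable int_measure"
    by (subst measurable_cong[of _ _ "\<lambda>x. ?g1 x - ?g2 x + ?g3 x"]) (use eq L2_D(1)[OF gL] in auto)
  have ae: "AE x in int_measure. ?g1 x - ?g2 x + ?g3 x = odd_ext f (x - a)"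
    by (intro AE_I2) (use eq in auto)
  show fL: "(\<lambda>x. odd_ext f (x - a)) \<in> L2" by (rule L2_cong_AE[OF gL m ae])
  have "l2norm (\<lambda>x. odd_ext f (x - a)) = l2norm (\<lambda>x. ?g1 x - ?g2 x + ?g3 x)"
    by (rule l2norm_cong_AE[OF gL fL ae, symmetric])
  also have "\<dots> \<le> l2norm (\<lambda>x. ?g1 x - ?g2 x) + l2norm ?g3" by (intro l2norm_triangle L2_diff L)
  also have "\<dots> \<le> l2norm ?g1 + l2norm ?g2 + l2norm ?g3" by (intro add_mono l2norm_triangle_diff L order_refl)
  finally show "l2norm (\<lambda>x. odd_ext f (x - a)) \<le> 3 * l2norm f" using n by linarith
qed

lemma odd_ext_lin: "odd_ext (\<lambda>x. a * f x + b * g x) y = a * odd_ext f y + b * odd_ext g y"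
  by (simp add: odd_ext_def Let_def algebra_simps)

lemma odd_ext_sine: "odd_ext (sine n) y = sine n y"
proof -
  define z where "z = 2 * pi * frac (y / (2 * pi))"
  have y: "y = z + of_int \<lfloor>y / (2 * pi)\<rfloor> * (2 * pi)"
    by (simp add: z_def frac_def algebra_simps)
  have "sin (real n * y) = sin (real n * z + of_int (int n * \<lfloor>y / (2 * pi)\<rfloor>) * (2 * pi))"
    by (subst y) (simp add: algebra_simps)
  also have "\<dots> = sin (real n * z)"
    using sin.plus_of_int[of "real n * z" "int n * \<lfloor>y / (2 * pi)\<rfloor>"] by (simp add: mult_ac)
  finally have s: "sine n y = sine n z" by (simp add: sine_def)
  have r: "sine n (2 * pi - z) = - sine n z"
  proof -
    have "sin (real n * (2 * pi - z)) = sin (- (real n * z) + of_int (int n) * (2 * pi))"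
      by (simp add: algebra_simps)
    also have "\<dots> = sin (- (real n * z))"
      using sin.plus_of_int[of "- (real n * z)" "int n"] by (simp add: mult_ac)
    finally show ?thesis by (simp add: sine_def)
  qed
  have "0 \<le> z" by (simp add: z_def)
  then have "z = 0 \<or> 0 < z \<and> z < pi \<or> z = pi \<or> pi < z" by linarith
  then show ?thesis
    unfolding odd_ext_def Let_def z_def[symmetric] s using r
    by (elim disjE) (auto simp: sine_def mult.commute[of _ pi])
qed

definition expi :: "real \<Rightarrow> complex"
  where "expi x = exp (2 * of_real pi * \<i> * of_real x)"

lemma expi_add: "expi (x + y) = expi x * expi y"
  by (simp add: expi_def exp_add[symmetric] algebra_simps)

lemma expi_of_int [simp]: "expi (of_int j) = 1"
  unfolding expi_def exp_eq_1 by (auto intro!: exI[of _ j])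

lemma expi_eq_1_iff: "expi x = 1 \<longleftrightarrow> x \<in> \<int>"
  unfolding expi_def exp_eq_1 by (auto simp: Ints_def)

lemma expi_power: "expi x ^ k = expi (x * real k)"
  by (simp add: expi_def exp_of_nat_mult[symmetric] mult_ac)

lemma sum_roots_of_unity:
  assumes "0 < q" shows "(\<Sum>k<q. expi (of_int j * (real k / real q))) = (if int q dvd j then of_nat q else 0)"
proof -
  let ?w = "expi (of_int j / real q)"
  have w: "expi (of_int j * (real k / real q)) = ?w ^ k" for k by (simp add: expi_power)
  show ?thesis
  proof (cases "int q dvd j")
    case True
    then obtain l where "j = int q * l" by auto
    then have "of_int j / real q = of_int l" using assms by simp
    then have "?w = 1" by (metis expi_of_int)
    then show ?thesis using True unfolding w by simp
  next
    case False
    have "?w \<noteq> 1"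
    proof
      assume "?w = 1"
      then obtain l where "of_int j / real q = of_int l" by (auto simp: expi_eq_1_iff Ints_def)
      then have "real_of_int j = of_int (int q * l)" using assms by (simp add: field_simps)
      then have "j = int q * l" by (simp only: of_int_eq_iff)
      then show False using False by simp
    qed
    then have "(\<Sum>k<q. ?w ^ k) = (?w ^ q - 1) / (?w - 1)" by (rule geometric_sum)
    moreover have "?w ^ q = 1" using assms by (simp add: expi_power)
    ultimately show ?thesis using False unfolding w by simp
  qed
qed

text \<open>
  Summing over \<open>k\<close> first selects the single residue \<open>m\<close> congruent to \<open>j\<close> modulo \<open>q\<close>, and there
  $m^2 p/q$ and $n^2 p/q$ differ by an integer. Both signs $j = \pm n$ are needed, since a sine is a
  combination of two exponentials.
\<close>
lemma quadratic_phase_sum: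
  assumes q: "0 < q" and j: "j\<^sup>2 = (int n)\<^sup>2"
  shows "(\<Sum>m<q. \<Sum>k<q. expi (real m * (real k / real q) - (real m)\<^sup>2 * (real p / real q)) * expi (- (of_int j * (real k / real q))))
    = of_nat q * expi (- ((real n)\<^sup>2 * (real p / real q)))"
    (is "(\<Sum>m<q. \<Sum>k<q. ?e m k) = ?R")
proof -
  define m0 where "m0 = nat (j mod int q)"
  have m0: "m0 < q" unfolding m0_def using q by (simp add: nat_less_iff)
  have iff: "int q dvd int m - j \<longleftrightarrow> m = m0" if "m < q" for m
  proof -
    have "int q dvd int m - j \<longleftrightarrow> int m mod int q = j mod int q" by (simp add: mod_eq_dvd_iff)
    also have "int m mod int q = int m" using that by simp
    finally show ?thesis unfolding m0_def using q by auto
  qed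
  have inner: "(\<Sum>k<q. ?e m k)
     = (if m = m0 then ?R else 0)" if m: "m < q" for m
  proof -
    have "(\<Sum>k<q. ?e m k)
      = (\<Sum>k<q. expi (- ((real m)\<^sup>2 * (real p / real q))) * expi (of_int (int m - j) * (real k / real q)))"
      unfolding expi_add[symmetric]
      by (intro sum.cong refl arg_cong[where f=expi]) (use q in \<open>simp add: field_simps\<close>)
    also have "\<dots> = expi (- ((real m)\<^sup>2 * (real p / real q))) * (if int q dvd int m - j then of_nat q else 0)"
      by (simp only: sum_distrib_left[symmetric] sum_roots_of_unity[OF q])
    also have "\<dots> = (if m = m0 then ?R else 0)"
    proof (cases "m = m0")
      case True
      then obtain l where l: "int m - j = int q * l" using iff[OF m] by auto
      have "(int m)\<^sup>2 - (int n)\<^sup>2 = (int m - j) * (int m + j)"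
        unfolding j[symmetric] by (simp add: power2_eq_square algebra_simps)
      also have "\<dots> = int q * (l * (int m + j))" by (simp add: l)
      finally have "(int m)\<^sup>2 = (int n)\<^sup>2 + int q * (l * (int m + j))" by simp
      then have "real_of_int ((int m)\<^sup>2) = real_of_int ((int n)\<^sup>2 + int q * (l * (int m + j)))" by (simp only:)
      then have "(real m)\<^sup>2 = (real n)\<^sup>2 + real q * of_int (l * (int m + j))" by simp
      then have "- ((real m)\<^sup>2 * (real p / real q)) = - ((real n)\<^sup>2 * (real p / real q)) + of_int (- (l * (int m + j) * int p))"
        using q by (simp add: field_simps)
      then have "expi (- ((real m)\<^sup>2 * (real p / real q))) = expi (- ((real n)\<^sup>2 * (real p / real q)))"
        by (simp only: expi_add expi_of_int mult_1_right)
      then show ?thesis using True iff[OF m] by simp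
    next
      case False
      then show ?thesis using iff[OF m] by simp
    qed
    finally show ?thesis .
  qed
  have "(\<Sum>m<q. \<Sum>k<q. ?e m k)
     = (\<Sum>m<q. if m = m0 then ?R else 0)"
    by (intro sum.cong refl inner) simp
  also have "\<dots> = ?R" using m0 by simp
  finally show ?thesis .
qed

text \<open>
  The finite sum of translates in the theorem, without the factor from the mean of the potential.
\<close>
definition talbot :: "nat \<Rightarrow> nat \<Rightarrow> (real \<Rightarrow> complex) \<Rightarrow> real \<Rightarrow> complex"
  where "talbot p q f x = 1 / of_nat q * (\<Sum>k<q. \<Sum>m<q.
     expi (real m * (real k / real q) - (real m)\<^sup>2 * (real p / real q)) * odd_ext f (x - 2 * pi * (real k / real q)))"

lemma sine_shift:
  "sine n (x - 2 * pi * y) = of_real (sqrt (2 / pi)) / (2 * \<i>) *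
     (exp (\<i> * of_real (real n * x)) * expi (- (of_int (int n) * y)) - exp (- (\<i> * of_real (real n * x))) * expi (- (of_int (- int n) * y)))"
proof -
  have 1: "exp (\<i> * of_real (real n * x)) * expi (- (of_int (int n) * y)) = exp (\<i> * of_real (real n * (x - 2 * pi * y)))"
    unfolding expi_def exp_add[symmetric] by (simp add: algebra_simps)
  have 2: "exp (- (\<i> * of_real (real n * x))) * expi (- (of_int (- int n) * y)) = exp (- (\<i> * of_real (real n * (x - 2 * pi * y))))"
    unfolding expi_def exp_add[symmetric] by (simp add: algebra_simps)
  show ?thesis
    unfolding 1 2 sine_def of_real_mult[of "sqrt (2 / pi)"] sin_of_real[symmetric] sin_exp_eq by simp
qed

lemma talbot_sine:
  assumes q: "0 < q" shows "talbot p q (sine n) x = expi (- ((real n)\<^sup>2 * (real p / real q))) * sine n x"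
proof -
  define s where "s = complex_of_real (sqrt (2 / pi)) / (2 * \<i>)"
  define A where "A = exp (\<i> * of_real (real n * x))"
  define A' where "A' = exp (- (\<i> * of_real (real n * x)))"
  let ?e = "\<lambda>m k. expi (real m * (real k / real q) - (real m)\<^sup>2 * (real p / real q))"
  let ?E = "of_nat q * expi (- ((real n)\<^sup>2 * (real p / real q)))"
  have "(\<Sum>k<q. \<Sum>m<q. ?e m k * odd_ext (sine n) (x - 2 * pi * (real k / real q)))
    = (\<Sum>k<q. \<Sum>m<q. s * A * (?e m k * expi (- (of_int (int n) * (real k / real q)))) - s * A' * (?e m k * expi (- (of_int (- int n) * (real k / real q)))))"
    unfolding odd_ext_sine sine_shift s_def[symmetric] A_def[symmetric] A'_def[symmetric]
    by (intro sum.cong refl) (simp only: right_diff_distrib mult_ac)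
  also have "\<dots> = (\<Sum>m<q. \<Sum>k<q. s * A * (?e m k * expi (- (of_int (int n) * (real k / real q)))) - s * A' * (?e m k * expi (- (of_int (- int n) * (real k / real q)))))"
    by (rule sum.swap)
  also have "\<dots> = s * A * (\<Sum>m<q. \<Sum>k<q. ?e m k * expi (- (of_int (int n) * (real k / real q))))
      - s * A' * (\<Sum>m<q. \<Sum>k<q. ?e m k * expi (- (of_int (- int n) * (real k / real q))))"
    by (simp only: sum_subtractf sum_distrib_left)
  also have "\<dots> = s * A * ?E - s * A' * ?E"
    using quadratic_phase_sum[OF q, of "int n" n p] quadratic_phase_sum[OF q, of "- int n" n p] by (simp only: power2_minus)
  also have "\<dots> = ?E * (s * (A - A'))" by (simp add: algebra_simps)
  also have "s * (A - A') = sine n x"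
    using sine_shift[of n x 0] by (simp add: s_def A_def A'_def expi_def)
  finally show ?thesis using q by (simp add: talbot_def)
qed

lemma talbot_L2:
  assumes f: "f \<in> L2"
  shows "talbot p q f \<in> L2" and "l2norm (talbot p q f) \<le> 3 * real q * l2norm f"
proof -
  let ?F = "\<lambda>k x. odd_ext f (x - 2 * pi * (real k / real q))"
  let ?e = "\<lambda>m k. expi (real m * (real k / real q) - (real m)\<^sup>2 * (real p / real q))"
  have ne: "norm (?e m k) = 1" for m k by (simp add: expi_def norm_exp_eq_Re)
  have a: "0 \<le> 2 * pi * (real k / real q)" "2 * pi * (real k / real q) < 2 * pi" if "k < q" for k
    using that by (auto simp: field_simps)
  have FL: "?F k \<in> L2" "l2norm (?F k) \<le> 3 * l2norm f" if "k < q" for k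
    using odd_ext_shift_L2[OF f a[OF that]] by auto
  have L: "(\<lambda>x. \<Sum>m<q. ?e m k * ?F k x) \<in> L2" if "k < q" for k by (intro L2_sum L2_scale FL that)
  have SL: "(\<lambda>x. \<Sum>k<q. \<Sum>m<q. ?e m k * ?F k x) \<in> L2" by (intro L2_sum L) simp
  show "talbot p q f \<in> L2" unfolding talbot_def[abs_def] by (intro L2_scale SL)
  have "l2norm (\<lambda>x. \<Sum>k<q. \<Sum>m<q. ?e m k * ?F k x) \<le> (\<Sum>k<q. l2norm (\<lambda>x. \<Sum>m<q. ?e m k * ?F k x))"
    by (intro l2norm_sum L) simp
  also have "\<dots> \<le> (\<Sum>k<q. \<Sum>m<q. l2norm (\<lambda>x. ?e m k * ?F k x))"
    by (intro sum_mono l2norm_sum L2_scale FL) simp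
  also have "\<dots> \<le> (\<Sum>k<q. \<Sum>m<q. 3 * l2norm f)"
    unfolding l2norm_scale ne by (intro sum_mono) (use FL(2) in simp)
  also have "\<dots> = real q * (3 * real q * l2norm f)" by simp
  finally have "l2norm (\<lambda>x. \<Sum>k<q. \<Sum>m<q. ?e m k * ?F k x) \<le> real q * (3 * real q * l2norm f)" .
  then show "l2norm (talbot p q f) \<le> 3 * real q * l2norm f"
    unfolding talbot_def[abs_def] l2norm_scale
    by (cases "q = 0") (auto simp: norm_divide field_simps)
qed

lemma talbot_lin: "talbot p q (\<lambda>x. a * f x + b * g x) x = a * talbot p q f x + b * talbot p q g x"
  unfolding talbot_def odd_ext_lin
  by (simp add: distrib_left sum.distrib sum_distrib_left mult.left_commute)

text \<open>
  The finite sum acts as the free flow at time $2\pi p/q$. On a sine this is a computation with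
  exponentials; boundedness of translations of the odd extension carries it over to $L^2$.
\<close>
lemma coef_talbot:
  assumes f: "f \<in> L2" and q: "0 < q"
  shows "coef (talbot p q f) n = expi (- ((real n)\<^sup>2 * (real p / real q))) * coef f n"
proof -
  let ?l = "\<lambda>n. expi (- ((real n)\<^sup>2 * (real p / real q)))"
  define D where "D f = coef (talbot p q f) n - ?l n * coef f n" for f
  have "D f = 0"
  proof (rule L2_functional_eq_0[OF _ _ _ f])
    fix f g :: "real \<Rightarrow> complex" and a b assume fg: "f \<in> L2" "g \<in> L2"
    have "talbot p q (\<lambda>x. a * f x + b * g x) = (\<lambda>x. a * talbot p q f x + b * talbot p q g x)"
      by (rule ext) (rule talbot_lin)
    then show "D (\<lambda>x. a * f x + b * g x) = a * D f + b * D g"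
      unfolding D_def coef_lin[OF fg] using coef_lin[OF talbot_L2(1)[OF fg(1)] talbot_L2(1)[OF fg(2)]]
      by (simp add: algebra_simps)
  next
    fix f :: "real \<Rightarrow> complex" assume f: "f \<in> L2"
    have "norm (D f) \<le> norm (coef (talbot p q f) n) + norm (?l n * coef f n)"
      unfolding D_def by (rule norm_triangle_ineq4)
    also have "norm (?l n * coef f n) = norm (coef f n)" by (simp add: norm_mult expi_def norm_exp_eq_Re)
    also have "norm (coef (talbot p q f) n) \<le> (3 * real q * l2norm f) * l2norm (sine n)"
      unfolding coef_def
      by (rule order_trans[OF norm_pair_le[OF talbot_L2(1)[OF f] sine_L2]])
        (intro mult_right_mono talbot_L2 f l2norm_nonneg)
    also have "norm (coef f n) \<le> l2norm f * l2norm (sine n)"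
      unfolding coef_def by (rule norm_pair_le[OF f sine_L2])
    finally show "norm (D f) \<le> ((3 * real q + 1) * l2norm (sine n)) * l2norm f"
      by (simp add: algebra_simps)
  next
    fix m
    have "talbot p q (sine m) = (\<lambda>x. ?l m * sine m x)" by (rule ext) (rule talbot_sine[OF q])
    then show "D (sine m) = 0"
      unfolding D_def coef_def by (simp add: pair_scale pair_sine_sine)
  qed
  then show ?thesis by (simp add: D_def)
qed

section \<open>Revivals\<close>

lemma talbot_eq:
  assumes "1 \<le> q"
  shows "talbot p q f x = 1 / of_nat q * (\<Sum>k=0..q-1. \<Sum>m=0..q-1.
     exp (2 * of_real pi * \<i> * (of_nat m * (of_nat k / of_nat q) - (of_nat m)\<^sup>2 * (of_nat p / of_nat q))) *
     odd_ext f (x - 2 * pi * (real k / real q)))"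
proof -
  have "{0..q-1} = {..<q}" using assms by auto
  then show ?thesis by (simp add: talbot_def expi_def)
qed

theorem theorem1:
  fixes V f :: "real \<Rightarrow> complex" and u :: "real \<Rightarrow> real \<Rightarrow> complex"
  assumes "V \<in> H2" and "continuous_on {0..pi} V" and "supnorm V < 3 / 2"
    and "f \<in> L2"
    and "schrodinger_solution V f u"
  shows "\<exists>w :: real \<Rightarrow> real \<Rightarrow> complex.
    (\<forall>t>0. continuous_on {0<..<pi} (\<lambda>x. w x t)) \<and>
    (\<forall>p q :: nat. p \<ge> 1 \<longrightarrow> q \<ge> 1 \<longrightarrow> coprime p q \<longrightarrow>
      (AE x in int_measure.
        u x (2 * pi * (real p / real q)) =
          w x (2 * pi * (real p / real q)) +
          1 / of_nat q * exp (- 2 * of_real pi * \<i> * mean V * (of_nat p / of_nat q)) *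
          (\<Sum>k=0..q-1. \<Sum>m=0..q-1.
             exp (2 * of_real pi * \<i> *
                  (of_nat m * (of_nat k / of_nat q) - (of_nat m)\<^sup>2 * (of_nat p / of_nat q))) *
             odd_ext f (x - 2 * pi * (real k / real q)))))"
proof -
  obtain T where T: "C0_semigroup T"
    and gen: "generator T = (\<lambda>(g, h). (g, \<lambda>x. - \<i> * h x)) ` schrodinger_op V"
    and u: "\<And>t. 0 \<le> t \<Longrightarrow> AE x in int_measure. u x t = T t f x"
    using assms(5) unfolding schrodinger_solution_def by auto
  have "compact (V ` {0..pi})" by (intro compact_continuous_image assms) auto
  then obtain M where M: "\<And>x. x \<in> {0..pi} \<Longrightarrow> norm (V x) \<le> M"
    by (meson bounded_iff compact_imp_bounded imageI)
  have V: "V \<in> borel_measurable int_measure" "\<And>x. x \<in> {0<..<pi} \<Longrightarrow> norm (V x) \<le> M"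
    using measurable_continuous_Icc[OF assms(2)] M by auto
  have "\<forall>t. \<exists>w. 0 \<le> t \<longrightarrow> continuous_on UNIV w \<and>
    (\<forall>n. coef (T t f) n = exp (- \<i> * ((of_nat n)\<^sup>2 + mean V) * of_real t) * coef f n + coef w n)"
    using continuous_remainder[OF T gen V assms(4)] by blast
  from choice[OF this] obtain w where w: "\<And>t. 0 \<le> t \<Longrightarrow> continuous_on UNIV (w t)"
    "\<And>t n. 0 \<le> t \<Longrightarrow> coef (T t f) n = exp (- \<i> * ((of_nat n)\<^sup>2 + mean V) * of_real t) * coef f n + coef (w t) n"
    by blast
  have "AE x in int_measure. u x (2 * pi * (real p / real q)) = w (2 * pi * (real p / real q)) x +
      1 / of_nat q * exp (- 2 * of_real pi * \<i> * mean V * (of_nat p / of_nat q)) *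
          (\<Sum>k=0..q-1. \<Sum>m=0..q-1.
             exp (2 * of_real pi * \<i> *
                  (of_nat m * (of_nat k / of_nat q) - (of_nat m)\<^sup>2 * (of_nat p / of_nat q))) *
             odd_ext f (x - 2 * pi * (real k / real q)))"
    if q: "1 \<le> q" for p q
  proof -
    define t where "t = 2 * pi * (real p / real q)"
    have t: "0 \<le> t" by (simp add: t_def)
    define c where "c = exp (- 2 * of_real pi * \<i> * mean V * (of_nat p / of_nat q))"
    have TL: "T t f \<in> L2" by (rule C0_semigroup_L2[OF T t assms(4)])
    have wL: "w t \<in> L2" by (intro L2_continuous continuous_on_subset[OF w(1)[OF t]]) auto
    have tL: "talbot p q f \<in> L2" by (rule talbot_L2[OF assms(4)])
    have RL: "(\<lambda>x. 1 * w t x + c * talbot p q f x) \<in> L2" by (intro L2_add L2_scale wL tL)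
    have "coef (\<lambda>x. 1 * T t f x + (-1) * (1 * w t x + c * talbot p q f x)) n = 0" for n
    proof -
      \<comment> \<open>At this time the phase splits into the free part and the part of the mean.\<close>
      have "exp (- \<i> * ((of_nat n)\<^sup>2 + mean V) * of_real t) = c * expi (- ((real n)\<^sup>2 * (real p / real q)))"
        unfolding c_def expi_def exp_add[symmetric] t_def by (simp add: algebra_simps)
      then show ?thesis
        unfolding coef_lin[OF TL RL] coef_lin[OF wL tL] w(2)[OF t] using coef_talbot[OF assms(4), of q p n] q
        by simp
    qed
    then have "AE x in int_measure. 1 * T t f x + (-1) * (1 * w t x + c * talbot p q f x) = 0"
      by (intro coef_zero_imp_AE_zero L2_add L2_scale TL RL)
    with u[OF t] have "AE x in int_measure. u x t = w t x + c * talbot p q f x"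
    proof eventually_elim
      case (elim x)
      have "T t f x = w t x + c * talbot p q f x"
        using elim(2) by (simp only: mult_minus1 mult_1 add_uminus_conv_diff right_minus_eq)
      then show ?case using elim(1) by simp
    qed
    then show ?thesis
      by eventually_elim (simp only: talbot_eq[OF q] c_def t_def mult_ac)
  qed
  moreover have "\<forall>t>0. continuous_on {0<..<pi} (w t)"
  proof (intro allI impI)
    fix t :: real assume "0 < t"
    then show "continuous_on {0<..<pi} (w t)" by (intro continuous_on_subset[OF w(1)]) auto
  qed
  ultimately show ?thesis by (intro exI[of _ "\<lambda>x t. w t x"]) simp
qed

end
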